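(* Let $V$ be a commutative valuation domain with quotient field $F$, let $K/F$ be a finite Galois extension with group $G$ which is tamely ramified and defectless, let $S$ be the integral closure of $V$ in $K$, and let $f:G\times G\to S\setminus\{0\}$ be a normalized $2$-cocycle. Then $J(A_f)=J_G(A_f)$.
   Context: $V$ has arbitrary Krull dimension. A normalized 2-cocycle satisfies $\sigma(f(\tau,\gamma))f(\sigma,\tau\gamma)=f(\sigma,\tau)f(\sigma\tau,\gamma)$ and $f(1,\sigma)=f(\sigma,1)=1$; its values lie in $S\setminus\{0\}$ but need not be units of $S$. $A_f=\bigoplus_{\sigma\in G}Sx_\sigma$ is the free left $S$-module on symbols $x_\sigma$ with multiplication $(sx_\sigma)(tx_\tau)=s\,\sigma(t)f(\sigma,\tau)x_{\sigma\tau}$ ($s,t\in S$); it is a $G$-graded ring with homogeneous components $Sx_\sigma$, an order in the crossed-product algebra $\Sigma_f=\bigoplus_{\sigma}Kx_\sigma=(K/F,G,f)$. $J(R)$ denotes the Jacobson radical, $U(R)$ the unit group. $J_G(A_f)$ is the graded Jacobson radical of the $G$-graded ring $A_f$ (the intersection of all graded left ideals that are maximal among proper graded left ideals). For a maximal ideal $M$ of $S$, let $e=[\Gamma_{S_M}:\Gamma_V]$ (value groups), $\overline{S_M},\overline V$ the residue fields and $r$ the number of maximal ideals of $S$. $K/F$ is defectless if $[K:F]=e\,[\overline{S_M}:\overline V]\,r$, and tamely ramified if the characteristic of $\overline V$ does not divide $e$ and $\overline{S_M}/\overline V$ is separable (these do not depend on $M$). *)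

theory Defs
  imports "HOL-Algebra.Ideal" "HOL-Computational_Algebra.Polynomial"
begin

section \<open>Subrings of a field K (the field K is the type 'k)\<close>

definition subring_of :: "'k::field set \<Rightarrow> bool" where
  "subring_of A \<longleftrightarrow> 0 \<in> A \<and> 1 \<in> A \<and>
     (\<forall>x\<in>A. \<forall>y\<in>A. x + y \<in> A \<and> x - y \<in> A \<and> x * y \<in> A)"

definition subfield_of :: "'k::field set \<Rightarrow> bool" where
  "subfield_of F \<longleftrightarrow> subring_of F \<and> (\<forall>x\<in>F. inverse x \<in> F)"

definition units_of_sr :: "'k::field set \<Rightarrow> 'k set" where
  "units_of_sr A = {x \<in> A. x \<noteq> 0 \<and> inverse x \<in> A}"

definition ideal_of :: "'k::field set \<Rightarrow> 'k set \<Rightarrow> bool" where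
  "ideal_of A I \<longleftrightarrow> I \<subseteq> A \<and> 0 \<in> I \<and> (\<forall>x\<in>I. \<forall>y\<in>I. x + y \<in> I \<and> x - y \<in> I)
     \<and> (\<forall>a\<in>A. \<forall>x\<in>I. a * x \<in> I)"

definition max_ideal_of :: "'k::field set \<Rightarrow> 'k set \<Rightarrow> bool" where
  "max_ideal_of A M \<longleftrightarrow> ideal_of A M \<and> M \<noteq> A \<and>
     (\<forall>I. ideal_of A I \<and> M \<subseteq> I \<and> I \<noteq> A \<longrightarrow> I = M)"

definition local_max_ideal :: "'k::field set \<Rightarrow> 'k set" where
  "local_max_ideal A = A - units_of_sr A"

definition valuation_domain_with_qf :: "'k::field set \<Rightarrow> 'k set \<Rightarrow> bool" where
  "valuation_domain_with_qf V F \<longleftrightarrow> subfield_of F \<and> subring_of V \<and> V \<subseteq> F \<and>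
     F = {a / b | a b. a \<in> V \<and> b \<in> V \<and> b \<noteq> 0} \<and>
     (\<forall>x\<in>F. x \<noteq> 0 \<longrightarrow> x \<in> V \<or> inverse x \<in> V)"

definition field_degree :: "'k::field set \<Rightarrow> nat \<Rightarrow> bool" where
  "field_degree F n \<longleftrightarrow> (\<exists>b :: nat \<Rightarrow> 'k.
     (\<forall>c. (\<forall>i<n. c i \<in> F) \<and> (\<Sum>i<n. c i * b i) = 0 \<longrightarrow> (\<forall>i<n. c i = 0)) \<and>
     (\<forall>y. \<exists>c. (\<forall>i<n. c i \<in> F) \<and> y = (\<Sum>i<n. c i * b i)))"

definition field_aut :: "('k::field \<Rightarrow> 'k) \<Rightarrow> bool" where
  "field_aut \<sigma> \<longleftrightarrow> bij \<sigma> \<and> \<sigma> 1 = 1 \<and> (\<forall>x y. \<sigma> (x + y) = \<sigma> x + \<sigma> y \<and> \<sigma> (x * y) = \<sigma> x * \<sigma> y)"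

definition gal :: "'k::field set \<Rightarrow> ('k \<Rightarrow> 'k) set" where
  "gal F = {\<sigma>. field_aut \<sigma> \<and> (\<forall>x\<in>F. \<sigma> x = x)}"

definition finite_galois :: "'k::field set \<Rightarrow> bool" where
  "finite_galois F \<longleftrightarrow> subfield_of F \<and> (\<exists>n. field_degree F n) \<and>
     {x. \<forall>\<sigma>\<in>gal F. \<sigma> x = x} = F"

definition integral_closure :: "'k::field set \<Rightarrow> 'k set" where
  "integral_closure V = {x. \<exists>p. lead_coeff p = 1 \<and> (\<forall>i. coeff p i \<in> V) \<and> poly p x = 0}"

definition localization :: "'k::field set \<Rightarrow> 'k set \<Rightarrow> 'k set" where
  "localization S M = {a / b | a b. a \<in> S \<and> b \<in> S \<and> b \<notin> M}"

text \<open>Ramification index e = [Gamma_W : Gamma_V], where Gamma_W = K*/U(W) and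
  Gamma_V = F*/U(V) is identified with its image F* U(W) / U(W); so the index is the
  number of cosets of F* U(W) in K*.\<close>
definition ram_index :: "'k::field set \<Rightarrow> 'k set \<Rightarrow> nat" where
  "ram_index F W = card ((UNIV - {0}) //
     {(x, y). x \<noteq> 0 \<and> y \<noteq> 0 \<and> (\<exists>a\<in>F - {0}. \<exists>u\<in>units_of_sr W. x = a * u * y)})"

text \<open>[residue field of W : residue field of V] = n: there are n elements of W whose
  residues form a basis of the residue field of W over that of V.\<close>
definition residue_degree :: "'k::field set \<Rightarrow> 'k set \<Rightarrow> nat \<Rightarrow> bool" where
  "residue_degree V W n \<longleftrightarrow> (\<exists>b :: nat \<Rightarrow> 'k. (\<forall>i<n. b i \<in> W) \<and>
     (\<forall>c. (\<forall>i<n. c i \<in> V) \<and> (\<Sum>i<n. c i * b i) \<in> local_max_ideal W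
          \<longrightarrow> (\<forall>i<n. c i \<in> local_max_ideal V)) \<and>
     (\<forall>y\<in>W. \<exists>c. (\<forall>i<n. c i \<in> V) \<and> y - (\<Sum>i<n. c i * b i) \<in> local_max_ideal W))"

definition residue_char :: "'k::field set \<Rightarrow> nat" where
  "residue_char V = (if \<exists>n>0. of_nat n \<in> local_max_ideal V
     then LEAST n. n > 0 \<and> of_nat n \<in> local_max_ideal V else 0)"

text \<open>A monic polynomial p with coefficients in V whose reduction mod m_V is irreducible
  over the residue field of V.\<close>
definition residue_irreducible :: "'k::field set \<Rightarrow> 'k poly \<Rightarrow> bool" where
  "residue_irreducible V p \<longleftrightarrow> lead_coeff p = 1 \<and> (\<forall>i. coeff p i \<in> V) \<and> degree p \<ge> 1 \<and>
     \<not> (\<exists>q r. lead_coeff q = 1 \<and> lead_coeff r = 1 \<and> (\<forall>i. coeff q i \<in> V) \<and>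
           (\<forall>i. coeff r i \<in> V) \<and> degree q \<ge> 1 \<and> degree r \<ge> 1 \<and>
           (\<forall>i. coeff (p - q * r) i \<in> local_max_ideal V))"

text \<open>The residue field of W is a separable (algebraic) extension of that of V: every
  residue class is a root of a monic irreducible polynomial over the residue field of V
  whose derivative is nonzero.\<close>
definition residue_separable :: "'k::field set \<Rightarrow> 'k set \<Rightarrow> bool" where
  "residue_separable V W \<longleftrightarrow> (\<forall>x\<in>W. \<exists>p. residue_irreducible V p \<and>
     poly p x \<in> local_max_ideal W \<and> (\<exists>i. coeff (pderiv p) i \<notin> local_max_ideal V))"

definition num_max_ideals :: "'k::field set \<Rightarrow> nat" where
  "num_max_ideals S = card {M. max_ideal_of S M}"

definition defectless :: "'k::field set \<Rightarrow> 'k set \<Rightarrow> bool" where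
  "defectless V F \<longleftrightarrow> (\<forall>M. max_ideal_of (integral_closure V) M \<longrightarrow>
     (\<exists>n f. field_degree F n \<and> residue_degree V (localization (integral_closure V) M) f \<and>
        n = ram_index F (localization (integral_closure V) M) * f
              * num_max_ideals (integral_closure V)))"

definition tamely_ramified :: "'k::field set \<Rightarrow> 'k set \<Rightarrow> bool" where
  "tamely_ramified V F \<longleftrightarrow> (\<forall>M. max_ideal_of (integral_closure V) M \<longrightarrow>
     \<not> residue_char V dvd ram_index F (localization (integral_closure V) M) \<and>
     residue_separable V (localization (integral_closure V) M))"

definition normalized_cocycle ::
  "('k::field \<Rightarrow> 'k) set \<Rightarrow> 'k set \<Rightarrow> (('k \<Rightarrow> 'k) \<Rightarrow> ('k \<Rightarrow> 'k) \<Rightarrow> 'k) \<Rightarrow> bool" where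
  "normalized_cocycle G S f \<longleftrightarrow>
     (\<forall>\<sigma>\<in>G. \<forall>\<tau>\<in>G. f \<sigma> \<tau> \<in> S - {0}) \<and>
     (\<forall>\<sigma>\<in>G. \<forall>\<tau>\<in>G. \<forall>\<gamma>\<in>G. \<sigma> (f \<tau> \<gamma>) * f \<sigma> (\<tau> \<circ> \<gamma>) = f \<sigma> \<tau> * f (\<sigma> \<circ> \<tau>) \<gamma>) \<and>
     (\<forall>\<sigma>\<in>G. f id \<sigma> = 1 \<and> f \<sigma> id = 1)"

text \<open>A_f = direct sum of S x_sigma; an element is its coefficient function G -> S
  (zero outside G).\<close>
definition crossed_product ::
  "('k::field \<Rightarrow> 'k) set \<Rightarrow> 'k set \<Rightarrow> (('k \<Rightarrow> 'k) \<Rightarrow> ('k \<Rightarrow> 'k) \<Rightarrow> 'k)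
     \<Rightarrow> (('k \<Rightarrow> 'k) \<Rightarrow> 'k) ring" where
  "crossed_product G S f =
     \<lparr>carrier = {a. (\<forall>\<sigma>\<in>G. a \<sigma> \<in> S) \<and> (\<forall>\<sigma>. \<sigma> \<notin> G \<longrightarrow> a \<sigma> = 0)},
      monoid.mult = (\<lambda>a b \<rho>. \<Sum>\<sigma>\<in>G. \<Sum>\<tau>\<in>G.
                        if \<sigma> \<circ> \<tau> = \<rho> then a \<sigma> * \<sigma> (b \<tau>) * f \<sigma> \<tau> else 0),
      one = (\<lambda>\<rho>. if \<rho> = id then 1 else 0),
      zero = (\<lambda>\<rho>. 0),
      add = (\<lambda>a b \<rho>. a \<rho> + b \<rho>)\<rparr>"

definition left_ideal :: "('a, 'b) ring_scheme \<Rightarrow> 'a set \<Rightarrow> bool" where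
  "left_ideal R I \<longleftrightarrow> additive_subgroup I R \<and>
     (\<forall>a\<in>carrier R. \<forall>x\<in>I. a \<otimes>\<^bsub>R\<^esub> x \<in> I)"

definition maximal_left_ideal :: "('a, 'b) ring_scheme \<Rightarrow> 'a set \<Rightarrow> bool" where
  "maximal_left_ideal R I \<longleftrightarrow> left_ideal R I \<and> I \<noteq> carrier R \<and>
     (\<forall>L. left_ideal R L \<and> I \<subseteq> L \<and> L \<noteq> carrier R \<longrightarrow> L = I)"

definition jacobson_radical :: "('a, 'b) ring_scheme \<Rightarrow> 'a set" where
  "jacobson_radical R = carrier R \<inter> \<Inter> {I. maximal_left_ideal R I}"

definition hcomp :: "('g \<Rightarrow> 'k::zero) \<Rightarrow> 'g \<Rightarrow> ('g \<Rightarrow> 'k)" where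
  "hcomp a \<sigma> = (\<lambda>\<tau>. if \<tau> = \<sigma> then a \<sigma> else 0)"

definition graded_left_ideal :: "(('g \<Rightarrow> 'k::zero), 'b) ring_scheme \<Rightarrow> ('g \<Rightarrow> 'k) set \<Rightarrow> bool" where
  "graded_left_ideal R I \<longleftrightarrow> left_ideal R I \<and> (\<forall>a\<in>I. \<forall>\<sigma>. hcomp a \<sigma> \<in> I)"

definition maximal_graded_left_ideal ::
  "(('g \<Rightarrow> 'k::zero), 'b) ring_scheme \<Rightarrow> ('g \<Rightarrow> 'k) set \<Rightarrow> bool" where
  "maximal_graded_left_ideal R I \<longleftrightarrow> graded_left_ideal R I \<and> I \<noteq> carrier R \<and>
     (\<forall>L. graded_left_ideal R L \<and> I \<subseteq> L \<and> L \<noteq> carrier R \<longrightarrow> L = I)"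

definition graded_jacobson_radical :: "(('g \<Rightarrow> 'k::zero), 'b) ring_scheme \<Rightarrow> ('g \<Rightarrow> 'k) set" where
  "graded_jacobson_radical R = carrier R \<inter> \<Inter> {I. maximal_graded_left_ideal R I}"

end

theory Submission
  imports Defs "Jordan_Normal_Form.Char_Poly"
begin

text \<open>
  Let \<open>M\<close> be a maximal ideal of \<open>S\<close> and \<open>J(S)\<close> the intersection of its conjugates.
  An element \<open>b\<close> lies in the graded radical iff \<open>(c b)\<^sub>1 \<in> J(S)\<close> for all \<open>c\<close>; such elements
  are nilpotent modulo \<open>J(S) A\<close> (two of the \<open>|G| + 1\<close> partial products of \<open>|G|\<close> homogeneous
  factors have the same degree), and \<open>J(S) A\<close> lies in the Jacobson radical because \<open>1 - z\<close> has
  right-multiplication matrix congruent to the identity. Conversely, an element \<open>b\<close> of the Jacobson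
  radical satisfies a polynomial over \<open>V\<close> that is nonzero modulo the maximal ideal, hence is
  nilpotent modulo \<open>M\<close>; the trace of right multiplication by \<open>b\<close> is \<open>tr(b\<^sub>1)\<close>, so
  \<open>tr(s b\<^sub>1) \<in> M\<close> for all \<open>s \<in> S\<close>. The trace form of \<open>S / J(S)\<close> is the inertia order times
  the trace form of the residue extensions. By Artin's theorem, applied to \<open>K / F\<close> and (thanks to
  separability) to the residue extension, defectlessness says that the inertia order is the
  ramification index, which tameness makes invertible; hence \<open>b\<^sub>1 \<in> J(S)\<close>.
\<close>

subsection \<open>Arithmetic modulo an ideal\<close>

text \<open>The valuation ring may have any Krull dimension, so \<open>V\<close> need not be
  noetherian, its maximal ideal need not be principal, and \<open>S\<close> need not be a finite
  \<open>V\<close>-module. What remains finite is the residue extension, so the finiteness arguments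
  take place modulo \<open>M\<close>, by congruences inside \<open>K\<close> rather than in quotient
  rings. Since \<open>M\<close> need not be stable under the group, \<open>M A\<close> need not be a
  two-sided ideal; the matrix of right multiplication supplies a substitute, a ring homomorphism
  from \<open>A\<close> to matrices over \<open>S / M\<close>. The values of \<open>f\<close> need
  not be units, so the identity coefficients of the products of \<open>b\<close> with the basis
  elements carry factors from \<open>f\<close> that cannot be cancelled: the description of the
  graded radical keeps these factors, while the trace sees only the normalized values
  \<open>f \<sigma> id = 1\<close>. The count behind the inertia order is \<open>|G| = r |D|\<close>
  and \<open>|D| = |D / I| |I|\<close>, with decomposition group \<open>D\<close> and inertia group
  \<open>I\<close>: once \<open>|D / I|\<close> is known to be the residue degree, the defectless
  formula for \<open>[K : F] = |G|\<close> leaves \<open>|I| = e\<close>.\<close>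

lemma permutes_less: "p permutes {0..<n::nat} \<Longrightarrow> i < n \<Longrightarrow> p i < n"
  using permutes_in_image[of p "{0..<n}" i] by simp

text \<open>Congruence modulo \<open>I\<close> replaces the ring \<open>R / I\<close>, so that all
  rings stay subsets of one type. With \<open>I = {0}\<close> this is just a subring. Polynomials
  over \<open>R\<close> and over \<open>I\<close> form a pair again, hence the determinant lemmas
  also serve matrices of polynomials.\<close>

locale ideal_pair =
  fixes R I :: "'a::comm_ring_1 set"
  assumes one_R: "1 \<in> R"
    and diff_R: "\<And>x y. x \<in> R \<Longrightarrow> y \<in> R \<Longrightarrow> x - y \<in> R"
    and mult_R: "\<And>x y. x \<in> R \<Longrightarrow> y \<in> R \<Longrightarrow> x * y \<in> R"
    and I_subset: "I \<subseteq> R"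
    and zero_I: "0 \<in> I"
    and diff_I: "\<And>x y. x \<in> I \<Longrightarrow> y \<in> I \<Longrightarrow> x - y \<in> I"
    and mult_I: "\<And>x y. x \<in> R \<Longrightarrow> y \<in> I \<Longrightarrow> x * y \<in> I"
begin

lemma in_R: "x \<in> I \<Longrightarrow> x \<in> R"
  using I_subset by auto

lemma zero_R: "0 \<in> R"
  using in_R zero_I by blast

lemma uminus_R: "x \<in> R \<Longrightarrow> - x \<in> R"
  using diff_R[OF zero_R, of x] by simp

lemma uminus_I: "x \<in> I \<Longrightarrow> - x \<in> I"
  using diff_I[OF zero_I, of x] by simp

lemma add_R: "x \<in> R \<Longrightarrow> y \<in> R \<Longrightarrow> x + y \<in> R"
  using diff_R[of x "- y"] uminus_R[of y] by simp

lemma add_I: "x \<in> I \<Longrightarrow> y \<in> I \<Longrightarrow> x + y \<in> I"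
  using diff_I[of x "- y"] uminus_I[of y] by simp

lemma mult_I2: "x \<in> I \<Longrightarrow> y \<in> R \<Longrightarrow> x * y \<in> I"
  using mult_I[of y x] by (simp add: mult.commute)

lemma sum_R: "(\<And>i. i \<in> X \<Longrightarrow> g i \<in> R) \<Longrightarrow> sum g X \<in> R"
  by (induction X rule: infinite_finite_induct) (auto intro: zero_R add_R)

lemma sum_I: "(\<And>i. i \<in> X \<Longrightarrow> g i \<in> I) \<Longrightarrow> sum g X \<in> I"
  by (induction X rule: infinite_finite_induct) (auto intro: zero_I add_I)

lemma prod_R: "(\<And>i. i \<in> X \<Longrightarrow> g i \<in> R) \<Longrightarrow> prod g X \<in> R"
  by (induction X rule: infinite_finite_induct) (auto intro: one_R mult_R)

lemma power_R: "x \<in> R \<Longrightarrow> x ^ n \<in> R"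
  by (induction n) (auto intro: one_R mult_R)

lemma of_nat_R: "of_nat n \<in> R"
  by (induction n) (auto intro: zero_R one_R add_R)

lemma cong_trans: "x - y \<in> I \<Longrightarrow> y - z \<in> I \<Longrightarrow> x - z \<in> I"
  using add_I[of "x - y" "y - z"] by simp

lemma cong_sym: "x - y \<in> I \<Longrightarrow> y - x \<in> I"
  using uminus_I[of "x - y"] by simp

lemma cong_iff: "x - y \<in> I \<Longrightarrow> x \<in> I \<longleftrightarrow> y \<in> I"
  using diff_I[of x "x - y"] add_I[of "x - y" y] by auto

lemma cong_mult:
  assumes "x - x' \<in> I" "y - y' \<in> I" "x \<in> R" "y' \<in> R"
  shows "x * y - x' * y' \<in> I"
proof -
  have "x * (y - y') + (x - x') * y' \<in> I"
    using assms by (intro add_I mult_I mult_I2) auto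
  then show ?thesis by (simp add: algebra_simps)
qed

lemma cong_sum:
  assumes "\<And>i. i \<in> X \<Longrightarrow> g i - h i \<in> I"
  shows "sum g X - sum h X \<in> I"
  using sum_I[of X "\<lambda>i. g i - h i"] assms by (simp add: sum_subtractf)

lemma cong_prod:
  assumes "\<And>i. i \<in> X \<Longrightarrow> g i - h i \<in> I" "\<And>i. i \<in> X \<Longrightarrow> g i \<in> R" "\<And>i. i \<in> X \<Longrightarrow> h i \<in> R"
  shows "prod g X - prod h X \<in> I"
  using assms
proof (induction X rule: infinite_finite_induct)
  case (insert x X)
  then have "g x * prod g X - h x * prod h X \<in> I"
    by (intro cong_mult prod_R) auto
  with insert show ?case by simp
qed (auto simp: zero_I)

lemma det_R:
  assumes "A \<in> carrier_mat n n" "\<And>i j. i < n \<Longrightarrow> j < n \<Longrightarrow> A $$ (i, j) \<in> R"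
  shows "det A \<in> R"
proof -
  have "signof p \<in> R" for p :: "nat \<Rightarrow> nat"
    using one_R uminus_R by (auto simp: sign_def)
  then show ?thesis
    unfolding det_def'[OF assms(1)] using assms(2)
    by (intro sum_R mult_R prod_R) (auto simp: permutes_less)
qed

lemma det_cong:
  assumes "A \<in> carrier_mat n n" "B \<in> carrier_mat n n"
    and "\<And>i j. i < n \<Longrightarrow> j < n \<Longrightarrow> A $$ (i, j) \<in> R"
    and "\<And>i j. i < n \<Longrightarrow> j < n \<Longrightarrow> A $$ (i, j) - B $$ (i, j) \<in> I"
  shows "det A - det B \<in> I"
proof -
  have sg: "signof p \<in> R" for p :: "nat \<Rightarrow> nat"
    using one_R uminus_R by (auto simp: sign_def)
  have BR: "B $$ (i, j) \<in> R" if "i < n" "j < n" for i j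
    using diff_R[OF assms(3)[OF that] in_R[OF assms(4)[OF that]]] by simp
  show ?thesis
    unfolding det_def'[OF assms(1)] det_def'[OF assms(2)]
    using assms(3,4) BR sg
    by (intro cong_sum cong_mult cong_prod prod_R) (auto simp: permutes_less zero_I)
qed

end

section \<open>Polynomials with coefficients in a subring or an ideal\<close>

definition polys_over :: "'a::zero set \<Rightarrow> 'a poly set" where
  "polys_over A = {p. \<forall>i. coeff p i \<in> A}"

context ideal_pair
begin

lemma ideal_pair_polys: "ideal_pair (polys_over R) (polys_over I)"
proof
  show "1 \<in> polys_over R"
    by (auto simp: polys_over_def zero_R one_R coeff_1 simp del: One_nat_def)
qed (auto simp: polys_over_def diff_R coeff_mult in_R zero_I diff_I intro!: sum_R mult_R sum_I mult_I)

lemma pCons_polys: "a \<in> R \<Longrightarrow> p \<in> polys_over R \<Longrightarrow> pCons a p \<in> polys_over R"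
  by (auto simp: polys_over_def coeff_pCons split: nat.split)

lemma zero_polys: "0 \<in> polys_over R"
  by (auto simp: polys_over_def zero_R)

lemma monom_polys: "a \<in> R \<Longrightarrow> monom a n \<in> polys_over R"
  by (auto simp: polys_over_def zero_R)

lemma poly_R: "p \<in> polys_over R \<Longrightarrow> x \<in> R \<Longrightarrow> poly p x \<in> R"
  unfolding poly_altdef by (intro sum_R mult_R power_R) (auto simp: polys_over_def)

lemma poly_I: "p \<in> polys_over I \<Longrightarrow> x \<in> R \<Longrightarrow> poly p x \<in> I"
  unfolding poly_altdef by (intro sum_I mult_I2 power_R) (auto simp: polys_over_def)

lemma pcompose_polys:
  assumes "p \<in> polys_over R" "q \<in> polys_over R"
  shows "pcompose p q \<in> polys_over R"
  using assms(1)
proof (induction p)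
  case (pCons a p)
  interpret P: ideal_pair "polys_over R" "polys_over I" by (rule ideal_pair_polys)
  have "p \<in> polys_over R" "a \<in> R"
    using pCons.prems by (auto simp: polys_over_def coeff_pCons split: nat.splits)
  then show ?case using pCons.IH assms(2)
    by (auto simp: pcompose_pCons intro!: P.add_R P.mult_R pCons_polys zero_polys)
qed (simp add: zero_polys)

lemma pcompose_polys_I:
  assumes "p \<in> polys_over I" "q \<in> polys_over R"
  shows "pcompose p q \<in> polys_over I"
  using assms(1)
proof (induction p)
  case (pCons a p)
  interpret P: ideal_pair "polys_over R" "polys_over I" by (rule ideal_pair_polys)
  have "p \<in> polys_over I" "a \<in> I"
    using pCons.prems by (auto simp: polys_over_def coeff_pCons split: nat.splits)
  moreover from this have "[:a:] \<in> polys_over I"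
    by (auto simp: polys_over_def coeff_pCons zero_I split: nat.split)
  ultimately show ?case using pCons.IH assms(2)
    by (auto simp: pcompose_pCons intro!: P.add_I P.mult_I)
qed (simp add: polys_over_def zero_I)

text \<open>Long division by a monic divisor never divides by a coefficient, so quotient and
  remainder stay over the subring \<open>R\<close>.\<close>

lemma monic_division:
  assumes "g \<in> polys_over R" "lead_coeff g = 1" "degree g \<ge> 1" "p \<in> polys_over R"
  shows "\<exists>h r. h \<in> polys_over R \<and> r \<in> polys_over R \<and> p = g * h + r \<and> degree r < degree g"
  using assms(4)
proof (induction p rule: measure_induct_rule[of degree])
  case (less p)
  interpret P: ideal_pair "polys_over R" "polys_over I" by (rule ideal_pair_polys)
  show ?case
  proof (cases "degree p < degree g")
    case True
    then show ?thesis using less.prems zero_polys by (intro exI[of _ 0] exI[of _ p]) auto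
  next
    case False
    define c where "c = monom (lead_coeff p) (degree p - degree g)"
    have c: "c \<in> polys_over R"
      using less.prems unfolding c_def by (intro monom_polys) (auto simp: polys_over_def)
    let ?p = "p - g * c"
    have cf: "coeff (g * c) (degree p) = lead_coeff p"
      using False assms(2) by (simp add: c_def mult.commute[of g] coeff_monom_mult)
    have dg: "degree (g * c) \<le> degree p"
      using degree_mult_le[of g c] degree_monom_le[of "lead_coeff p" "degree p - degree g"] False
      unfolding c_def by linarith
    \<comment> \<open>The zero polynomial has degree 0; the positive degree of \<open>p\<close>
      makes the decrease strict even when \<open>p - g * c\<close> is 0.\<close>
    have "degree p \<ge> 1" using False assms(3) by linarith
    have "degree ?p < degree p"
    proof -
      have "degree ?p \<le> degree p" using dg degree_diff_le by blast
      moreover have "degree ?p \<noteq> degree p"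
      proof
        assume e: "degree ?p = degree p"
        have "coeff ?p (degree p) = 0" using cf by simp
        with e have "?p = 0" by (metis leading_coeff_0_iff)
        with e \<open>degree p \<ge> 1\<close> show False by simp
      qed
      ultimately show ?thesis by simp
    qed
    from less.IH[OF this] less.prems assms(1) c obtain h r where
      hr: "h \<in> polys_over R" "r \<in> polys_over R" "?p = g * h + r" "degree r < degree g"
      by (meson P.diff_R P.mult_R)
    have "p = g * (h + c) + r" using hr(3) by (simp add: algebra_simps)
    then show ?thesis using hr c by (intro exI[of _ "h + c"] exI[of _ r]) (auto intro: P.add_R)
  qed
qed

end

text \<open>This says that \<open>R / M\<close> is a field, in the form in which maximality gets
  used. The instances include \<open>UNIV\<close> with \<open>{0}\<close>, where congruence is
  equality, and \<open>S\<close> with \<open>M\<close>; one pair of counting lemmas therefore gives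
  Artin's theorem both for \<open>K / F\<close> and for the residue extension.\<close>

locale residue_pair = ideal_pair R M for R M :: "'a::idom set" +
  assumes one_notin: "1 \<notin> M"
    and inverse_mod: "\<And>x. x \<in> R \<Longrightarrow> x \<notin> M \<Longrightarrow> \<exists>y\<in>R. x * y - 1 \<in> M"
begin

section \<open>Linear algebra and independence of characters over the residue field\<close>

lemma prime:
  assumes "x \<in> R" "y \<in> R" "x * y \<in> M"
  shows "x \<in> M \<or> y \<in> M"
proof (rule ccontr)
  assume "\<not> ?thesis"
  then obtain z where z: "z \<in> R" "x * z - 1 \<in> M" and y: "y \<notin> M"
    using inverse_mod assms(1) by blast
  have "z * (x * y) - (x * z - 1) * y \<in> M"
    by (rule diff_I[OF mult_I[OF z(1) assms(3)] mult_I2[OF z(2) assms(2)]])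
  then have "y \<in> M" by (simp add: algebra_simps)
  with y show False by simp
qed

lemma prod_notin:
  assumes "finite X" "\<And>i. i \<in> X \<Longrightarrow> g i \<in> R" "\<And>i. i \<in> X \<Longrightarrow> g i \<notin> M"
  shows "prod g X \<notin> M"
  using assms by (induction X) (auto simp: one_notin dest!: prime[rotated 2] intro: prod_R)

lemma sum_notin:
  assumes "finite X" "i \<in> X" "g i \<notin> M" "\<And>j. j \<in> X \<Longrightarrow> j \<noteq> i \<Longrightarrow> g j \<in> M"
  shows "sum g X \<notin> M"
proof
  assume "sum g X \<in> M"
  moreover have "sum g (X - {i}) \<in> M" using assms(4) by (intro sum_I) auto
  moreover have "sum g X = g i + sum g (X - {i})" using assms(1,2) by (rule sum.remove)
  ultimately have "g i \<in> M" using diff_I[of "sum g X" "sum g (X - {i})"] by simp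
  with assms(3) show False by simp
qed

text \<open>Gaussian elimination over the field \<open>R / M\<close>, by induction on the equations:
  an equation with a coefficient outside \<open>M\<close> eliminates one unknown, and an equation
  with all coefficients in \<open>M\<close> holds trivially.\<close>

lemma homogeneous_system:
  assumes "finite E" "finite X" "card E < card X"
    and "\<And>e j. e \<in> E \<Longrightarrow> j \<in> X \<Longrightarrow> a e j \<in> R"
  shows "\<exists>x. (\<forall>j\<in>X. x j \<in> R) \<and> (\<exists>j\<in>X. x j \<notin> M) \<and> (\<forall>e\<in>E. (\<Sum>j\<in>X. a e j * x j) \<in> M)"
  using assms
proof (induction E arbitrary: X a rule: finite_induct)
  case empty
  then have "X \<noteq> {}" by auto
  then show ?case using one_R one_notin by (intro exI[of _ "\<lambda>_. 1"]) auto
next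
  case (insert e E)
  show ?case
  proof (cases "\<forall>j\<in>X. a e j \<in> M")
    case True
    have "card E < card X" using insert.prems insert.hyps by simp
    from insert.IH[OF insert.prems(1) this, of a, OF insert.prems(3)] obtain x where
      x: "\<forall>j\<in>X. x j \<in> R" "\<exists>j\<in>X. x j \<notin> M" "\<forall>e\<in>E. (\<Sum>j\<in>X. a e j * x j) \<in> M"
      by auto
    have "(\<Sum>j\<in>X. a e j * x j) \<in> M" using True x(1) by (intro sum_I mult_I2) auto
    with x show ?thesis by (intro exI[of _ x]) auto
  next
    case False
    then obtain k where k: "k \<in> X" "a e k \<notin> M" by auto
    then obtain y where y: "y \<in> R" "a e k * y - 1 \<in> M" using inverse_mod insert.prems(3) by blast
    define X' where "X' = X - {k}"
    have X': "finite X'" "card E < card X'" "k \<notin> X'" "X = insert k X'"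
      using insert.prems insert.hyps k by (auto simp: X'_def)
    \<comment> \<open>Coefficients after substituting for the unknown \<open>k\<close>;
      \<open>y\<close> is the inverse of the pivot modulo \<open>M\<close>.\<close>
    define a' where "a' = (\<lambda>e' j. a e' j - a e' k * y * a e j)"
    have "a' e' j \<in> R" if "e' \<in> E" "j \<in> X'" for e' j
      unfolding a'_def using that insert.prems(3) y k X'(4) by (intro diff_R mult_R) auto
    from insert.IH[OF X'(1,2), of a', OF this] obtain x where
      x: "\<forall>j\<in>X'. x j \<in> R" "\<exists>j\<in>X'. x j \<notin> M" "\<forall>e\<in>E. (\<Sum>j\<in>X'. a' e j * x j) \<in> M"
      by auto
    define t where "t = (\<Sum>j\<in>X'. a e j * x j)"
    have tR: "t \<in> R" unfolding t_def using x insert.prems(3) X' by (intro sum_R mult_R) auto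
    define x' where "x' = x(k := - (y * t))"
    have S: "(\<Sum>j\<in>X. b j * x' j) = - (b k * (y * t)) + (\<Sum>j\<in>X'. b j * x j)" for b
    proof -
      have "(\<Sum>j\<in>X'. b j * x' j) = (\<Sum>j\<in>X'. b j * x j)"
        using X'(3) by (intro sum.cong) (auto simp: x'_def)
      then show ?thesis using X' by (simp add: x'_def)
    qed
    \<comment> \<open>The pivot equation holds only modulo \<open>M\<close>, because
      \<open>y\<close> inverts the pivot only modulo \<open>M\<close>. The other equations keep
      exactly the values of the reduced ones.\<close>
    have "- ((a e k * y - 1) * t) \<in> M" using y tR by (intro uminus_I mult_I2)
    then have "(\<Sum>j\<in>X. a e j * x' j) \<in> M"
      unfolding S t_def[symmetric] by (simp add: algebra_simps)
    moreover have "(\<Sum>j\<in>X. a e' j * x' j) \<in> M" if "e' \<in> E" for e'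
    proof -
      have "(\<Sum>j\<in>X'. a' e' j * x j) = (\<Sum>j\<in>X'. a e' j * x j) - a e' k * y * t"
        unfolding a'_def t_def by (simp add: algebra_simps sum_subtractf sum_distrib_left)
      then have "(\<Sum>j\<in>X. a e' j * x' j) = (\<Sum>j\<in>X'. a' e' j * x j)"
        unfolding S by (simp add: mult.assoc)
      then show ?thesis using x(3) that by simp
    qed
    moreover have "\<forall>j\<in>X. x' j \<in> R" using x X' y tR by (auto simp: x'_def intro!: uminus_R mult_R)
    moreover have "\<exists>j\<in>X. x' j \<notin> M" using x X' by (auto simp: x'_def)
    ultimately show ?thesis by (intro exI[of _ x']) auto
  qed
qed

text \<open>Dedekind's argument for multiplicative maps into \<open>R / M\<close>: subtracting
  \<open>d y\<close> times the relation at \<open>x\<close> from the relation at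
  \<open>y * x\<close> removes \<open>d\<close> and multiplies the coefficient of \<open>c\<close>
  by \<open>c y - d y\<close>. For \<open>y\<close> separating \<open>c\<close> from
  \<open>d\<close> modulo \<open>M\<close>, this factor can be cancelled.\<close>

lemma dedekind_independence:
  assumes "finite C"
    and "\<And>c x. c \<in> C \<Longrightarrow> x \<in> R \<Longrightarrow> c x \<in> R"
    and "\<And>c x y. c \<in> C \<Longrightarrow> x \<in> R \<Longrightarrow> y \<in> R \<Longrightarrow> c (x * y) = c x * c y"
    and "\<And>c. c \<in> C \<Longrightarrow> c 1 = 1"
    and "\<And>c d. c \<in> C \<Longrightarrow> d \<in> C \<Longrightarrow> c \<noteq> d \<Longrightarrow> \<exists>x\<in>R. c x - d x \<notin> M"
    and "\<And>c. c \<in> C \<Longrightarrow> k c \<in> R"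
    and "\<And>x. x \<in> R \<Longrightarrow> (\<Sum>c\<in>C. k c * c x) \<in> M"
  shows "\<forall>c\<in>C. k c \<in> M"
  using assms
proof (induction C arbitrary: k rule: finite_induct)
  case (insert d C)
  have step: "k c * (c y - d y) \<in> M" if "c \<in> C" "y \<in> R" for c y
  proof -
    have "\<forall>c\<in>C. k c * (c y - d y) \<in> M"
    proof (rule insert.IH)
      fix x assume x: "x \<in> R"
      have "(\<Sum>c\<in>insert d C. k c * c (y * x)) - d y * (\<Sum>c\<in>insert d C. k c * c x) \<in> M"
        using insert.prems(1) that x by (intro diff_I mult_I insert.prems(6) mult_R) auto
      also have "(\<Sum>c\<in>insert d C. k c * c (y * x)) - d y * (\<Sum>c\<in>insert d C. k c * c x)
        = (\<Sum>c\<in>insert d C. k c * (c y - d y) * c x)"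
        unfolding sum_distrib_left sum_subtractf[symmetric]
        by (intro sum.cong refl, subst insert.prems(2)) (simp_all add: that x algebra_simps)
      also have "\<dots> = (\<Sum>c\<in>C. k c * (c y - d y) * c x)" using insert.hyps by simp
      finally show "(\<Sum>c\<in>C. k c * (c y - d y) * c x) \<in> M" .
    next
      show "k c * (c y - d y) \<in> R" if "c \<in> C" for c
        using that insert.prems(1)[of c y] insert.prems(1)[of d y] insert.prems(5)[of c] \<open>y \<in> R\<close>
        by (simp add: mult_R diff_R)
      show "\<And>c e. c \<in> C \<Longrightarrow> e \<in> C \<Longrightarrow> c \<noteq> e \<Longrightarrow> \<exists>x\<in>R. c x - e x \<notin> M"
        by (rule insert.prems(4)) auto
    qed (simp_all add: insert.prems(1-3))
    with that show ?thesis by blast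
  qed
  have C: "k c \<in> M" if "c \<in> C" for c
  proof -
    have "c \<noteq> d" using that insert.hyps by auto
    then obtain y where y: "y \<in> R" "c y - d y \<notin> M" using insert.prems(4)[of c d] \<open>c \<in> C\<close> by auto
    have "c y - d y \<in> R" using insert.prems(1) that y by (intro diff_R) auto
    with prime[OF _ _ step[OF that y(1)]] y insert.prems(5) that show ?thesis by auto
  qed
  \<comment> \<open>The eliminated coefficient \<open>k d\<close> is recovered from the relation at
    1.\<close>
  have "(\<Sum>c\<in>insert d C. k c * c 1) \<in> M" by (rule insert.prems) (rule one_R)
  moreover have "(\<Sum>c\<in>insert d C. k c * c 1) = (\<Sum>c\<in>insert d C. k c)"
    by (intro sum.cong refl) (simp add: insert.prems(3))
  ultimately have "k d + (\<Sum>c\<in>C. k c) \<in> M" using insert.hyps by simp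
  moreover have "(\<Sum>c\<in>C. k c) \<in> M" using C by (intro sum_I) auto
  ultimately have "k d \<in> M" using diff_I by fastforce
  with C show ?case by auto
qed auto

text \<open>With more than \<open>n\<close> maps, the \<open>n\<close> equations with coefficients
  \<open>c (b i)\<close> have a solution \<open>k\<close> that is nontrivial modulo
  \<open>M\<close>. Since the \<open>b i\<close> span \<open>R\<close> over \<open>V\<close> modulo
  \<open>M\<close> and the maps fix \<open>V\<close> modulo \<open>M\<close>, the relation extends
  from the \<open>b i\<close> to all of \<open>R\<close>, against independence of
  characters.\<close>

lemma card_incongruent_le:
  assumes "finite C"
    and "\<And>c x. c \<in> C \<Longrightarrow> x \<in> R \<Longrightarrow> c x \<in> R"
    and "\<And>c x y. c \<in> C \<Longrightarrow> x \<in> R \<Longrightarrow> y \<in> R \<Longrightarrow> c (x * y) = c x * c y"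
    and "\<And>c x y. c \<in> C \<Longrightarrow> x \<in> R \<Longrightarrow> y \<in> R \<Longrightarrow> c (x + y) = c x + c y"
    and "\<And>c. c \<in> C \<Longrightarrow> c 1 = 1"
    and "\<And>c x. c \<in> C \<Longrightarrow> x \<in> M \<Longrightarrow> c x \<in> M"
    and "\<And>c d. c \<in> C \<Longrightarrow> d \<in> C \<Longrightarrow> c \<noteq> d \<Longrightarrow> \<exists>x\<in>R. c x - d x \<notin> M"
    and "V \<subseteq> R"
    and "\<And>c v. c \<in> C \<Longrightarrow> v \<in> V \<Longrightarrow> c v - v \<in> M"
    and "\<And>i. i < n \<Longrightarrow> b i \<in> R"
    and "\<And>y. y \<in> R \<Longrightarrow> \<exists>v. (\<forall>i<n. v i \<in> V) \<and> y - (\<Sum>i<n. v i * b i) \<in> M"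
  shows "card C \<le> n"
proof (rule ccontr)
  assume "\<not> ?thesis"
  then have "card {..<n} < card C" by simp
  note hs = homogeneous_system[OF finite_lessThan assms(1) this]
  have "c (b i) \<in> R" if "i \<in> {..<n}" "c \<in> C" for c i using that assms(2,10) by auto
  then have "\<exists>x. (\<forall>j\<in>C. x j \<in> R) \<and> (\<exists>j\<in>C. x j \<notin> M) \<and> (\<forall>e\<in>{..<n}. (\<Sum>j\<in>C. j (b e) * x j) \<in> M)"
    by (rule hs)
  then obtain k where k0: "\<forall>c\<in>C. k c \<in> R" "\<exists>c\<in>C. k c \<notin> M"
    "\<forall>i\<in>{..<n}. (\<Sum>c\<in>C. c (b i) * k c) \<in> M"
    by blast
  then have k: "\<forall>c\<in>C. k c \<in> R" "\<exists>c\<in>C. k c \<notin> M"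
    "\<forall>i<n. (\<Sum>c\<in>C. c (b i) * k c) \<in> M"
    by auto
  have hom_sum: "c (sum g X) = (\<Sum>x\<in>X. c (g x))"
    if "c \<in> C" "\<And>x. x \<in> X \<Longrightarrow> g x \<in> R" for c X and g :: "nat \<Rightarrow> 'a"
  proof -
    have "c 0 = 0" using assms(4)[OF that(1) zero_R zero_R] by (metis add_0 add_cancel_right_left)
    then show ?thesis using that(2)
      by (induction X rule: infinite_finite_induct) (auto simp: assms(4)[OF that(1)] sum_R)
  qed
  have "(\<Sum>c\<in>C. k c * c x) \<in> M" if x: "x \<in> R" for x
  proof -
    obtain v where v: "\<forall>i<n. v i \<in> V" "x - (\<Sum>i<n. v i * b i) \<in> M" using assms(11)[OF x] by blast
    have vR: "v i \<in> R" if "i < n" for i using v that assms(8) by auto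
    have sR: "(\<Sum>i<n. v i * b i) \<in> R" using vR assms(10) by (intro sum_R mult_R) auto
    have c: "c x - (\<Sum>i<n. v i * c (b i)) \<in> M" if "c \<in> C" for c
    proof -
      have "c (x - (\<Sum>i<n. v i * b i)) + c (\<Sum>i<n. v i * b i) = c x"
        using assms(4)[OF that in_R[OF v(2)] sR] by simp
      then have "c x - c (\<Sum>i<n. v i * b i) \<in> M" using assms(6)[OF that v(2)]
        by (metis add_diff_cancel_right')
      moreover have "c (\<Sum>i<n. v i * b i) = (\<Sum>i<n. c (v i) * c (b i))"
        using that vR assms(3,10) by (subst hom_sum) (auto intro: mult_R)
      moreover have "(\<Sum>i<n. c (v i) * c (b i)) - (\<Sum>i<n. v i * c (b i)) \<in> M"
        using assms(2,9,10) that vR v(1) by (intro cong_sum cong_mult) (auto simp: zero_I)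
      ultimately show ?thesis using cong_trans by metis
    qed
    have "(\<Sum>c\<in>C. k c * c x) - (\<Sum>c\<in>C. k c * (\<Sum>i<n. v i * c (b i))) \<in> M"
      using c k assms(2,10) vR by (intro cong_sum cong_mult) (auto simp: zero_I intro!: sum_R mult_R)
    moreover have "(\<Sum>c\<in>C. k c * (\<Sum>i<n. v i * c (b i))) = (\<Sum>i<n. v i * (\<Sum>c\<in>C. c (b i) * k c))"
      unfolding sum_distrib_left by (subst sum.swap) (simp add: algebra_simps)
    moreover have "\<dots> \<in> M" using k(3) vR by (intro sum_I) (auto intro: mult_I)
    ultimately show ?thesis using cong_iff by simp
  qed
  then have "\<forall>c\<in>C. k c \<in> M"
    using k(1) by (intro dedekind_independence[of C k]) (simp_all add: assms(1-3,5,7))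
  with k show False by blast
qed

text \<open>Artin's inequality with averaging by a trace. \<open>D\<close> is a group of maps and
  \<open>C\<close> a transversal for congruence modulo \<open>M\<close>, which need not be closed
  under composition. If \<open>n\<close> exceeded \<open>card C\<close>, the equations with
  coefficients \<open>c (b i)\<close> would have a nontrivial solution; transporting them by
  inverses and summing makes the coefficients traces, which are invariant and hence congruent to
  elements of \<open>V\<close>. Independence of the \<open>b i\<close> then forces the trace to
  vanish modulo \<open>M\<close>.\<close>

lemma card_representatives_ge:
  assumes "finite D"
    and "\<And>c x. c \<in> D \<Longrightarrow> x \<in> R \<Longrightarrow> c x \<in> R"
    and "\<And>c x y. c \<in> D \<Longrightarrow> x \<in> R \<Longrightarrow> y \<in> R \<Longrightarrow> c (x * y) = c x * c y"
    and "\<And>c x y. c \<in> D \<Longrightarrow> x \<in> R \<Longrightarrow> y \<in> R \<Longrightarrow> c (x + y) = c x + c y"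
    and "\<And>c. c \<in> D \<Longrightarrow> c 1 = 1"
    and "\<And>c x. c \<in> D \<Longrightarrow> x \<in> M \<Longrightarrow> c x \<in> M"
    and "\<And>c d. c \<in> D \<Longrightarrow> d \<in> D \<Longrightarrow> c \<circ> d \<in> D"
    and "\<And>c. c \<in> D \<Longrightarrow> \<exists>d\<in>D. c \<circ> d = id \<and> d \<circ> c = id"
    and "C \<subseteq> D" "C \<noteq> {}"
    and "\<And>c d. c \<in> C \<Longrightarrow> d \<in> C \<Longrightarrow> c \<noteq> d \<Longrightarrow> \<exists>x\<in>R. c x - d x \<notin> M"
    and "\<And>d. d \<in> D \<Longrightarrow> \<exists>c\<in>C. \<forall>x\<in>R. d x - c x \<in> M"
    and "V \<subseteq> R"
    and "\<And>x. x \<in> R \<Longrightarrow> (\<And>d. d \<in> D \<Longrightarrow> d x - x \<in> M) \<Longrightarrow> \<exists>v\<in>V. x - v \<in> M"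
    and "\<And>i. i < n \<Longrightarrow> b i \<in> R"
    and "\<And>v. (\<forall>i<n. v i \<in> V) \<Longrightarrow> (\<Sum>i<n. v i * b i) \<in> M \<Longrightarrow> \<forall>i<n. v i \<in> M"
  shows "n \<le> card C"
proof (rule ccontr)
  assume "\<not> ?thesis"
  then have lt: "card C < card {..<n}" by simp
  have fC: "finite C" using assms(1,9) finite_subset by blast
  have CD: "c \<in> D" if "c \<in> C" for c using that assms(9) by blast
  have "c (b i) \<in> R" if "c \<in> C" "i \<in> {..<n}" for c i using that assms(2,15) CD by auto
  then have "\<exists>x. (\<forall>j\<in>{..<n}. x j \<in> R) \<and> (\<exists>j\<in>{..<n}. x j \<notin> M) \<and> (\<forall>e\<in>C. (\<Sum>j<n. e (b j) * x j) \<in> M)"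
    by (rule homogeneous_system[OF fC finite_lessThan lt])
  then
  obtain k where k0: "\<forall>i\<in>{..<n}. k i \<in> R" "\<exists>i\<in>{..<n}. k i \<notin> M"
    "\<forall>c\<in>C. (\<Sum>i<n. c (b i) * k i) \<in> M"
    by blast
  then obtain i0 where i0: "i0 < n" "k i0 \<notin> M" by auto
  have k: "k i \<in> R" if "i < n" for i using that k0(1) by auto
  have hom_sum: "c (sum g X) = (\<Sum>x\<in>X. c (g x))"
    if "c \<in> D" "\<And>x. x \<in> X \<Longrightarrow> g x \<in> R" for c X and g :: "'c \<Rightarrow> 'a"
  proof -
    have "c 0 = 0" using assms(4)[OF that(1) zero_R zero_R] by (metis add_0 add_cancel_right_left)
    then show ?thesis using that(2)
      by (induction X rule: infinite_finite_induct) (auto simp: assms(4)[OF that(1)] sum_R)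
  qed
  have hom_cong: "c x - c y \<in> M" if "c \<in> D" "x \<in> R" "y \<in> R" "x - y \<in> M" for c x y
  proof -
    have "c (x - y) + c y = c x" using assms(4)[OF that(1) in_R[OF that(4)] that(3)] by simp
    then show ?thesis using assms(6)[OF that(1,4)] by (metis add_diff_cancel_right')
  qed
  define rep where "rep d = (SOME c. c \<in> C \<and> (\<forall>x\<in>R. d x - c x \<in> M))" for d
  have rep: "rep d \<in> C" "\<And>x. x \<in> R \<Longrightarrow> d x - rep d x \<in> M" if "d \<in> D" for d
  proof -
    have "rep d \<in> C \<and> (\<forall>x\<in>R. d x - rep d x \<in> M)"
      unfolding rep_def by (rule someI_ex[OF assms(12)[OF that, unfolded Bex_def]])
    then show "rep d \<in> C" "\<And>x. x \<in> R \<Longrightarrow> d x - rep d x \<in> M" by auto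
  qed
  define Tr where "Tr x = (\<Sum>c\<in>C. c x)" for x
  have TrR: "Tr x \<in> R" if "x \<in> R" for x unfolding Tr_def using that assms(2) CD by (intro sum_R) auto
  have inv: "d (Tr x) - Tr x \<in> M" if "d \<in> D" "x \<in> R" for d x
  proof -
    \<comment> \<open>The composite of \<open>d\<close> and \<open>c\<close> may leave
      \<open>C\<close>, but its representative does not; passing to representatives,
      \<open>d\<close> permutes \<open>C\<close>, so that \<open>Tr\<close> is invariant modulo
      \<open>M\<close>.\<close>
    have inj: "inj_on (\<lambda>c. rep (d \<circ> c)) C"
    proof (rule inj_onI, rule ccontr)
      fix c c' assume c: "c \<in> C" "c' \<in> C" "rep (d \<circ> c) = rep (d \<circ> c')" "c \<noteq> c'"
      then obtain y where y: "y \<in> R" "c y - c' y \<notin> M" using assms(11) by blast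
      have "d (c y) - rep (d \<circ> c) y \<in> M" "d (c' y) - rep (d \<circ> c) y \<in> M"
        using rep(2)[OF assms(7)[OF that(1) CD] y(1)] c by fastforce+
      then have e: "d (c y) - d (c' y) \<in> M" using cong_trans cong_sym by blast
      obtain d' where d': "d' \<in> D" "d' \<circ> d = id" using assms(8)[OF \<open>d \<in> D\<close>] by blast
      have "d' (d (c y)) - d' (d (c' y)) \<in> M"
        using hom_cong[OF d'(1) _ _ e] assms(2) that CD c y by blast
      with d'(2) y show False by (metis comp_apply id_apply)
    qed
    have "(\<lambda>c. rep (d \<circ> c)) ` C \<subseteq> C" using rep(1) assms(7) that CD by auto
    then have im: "(\<lambda>c. rep (d \<circ> c)) ` C = C" using inj fC by (simp add: endo_inj_surj)
    have "d (Tr x) = (\<Sum>c\<in>C. d (c x))"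
      unfolding Tr_def using that assms(2) CD by (intro hom_sum) auto
    moreover have "(\<Sum>c\<in>C. d (c x)) - (\<Sum>c\<in>C. rep (d \<circ> c) x) \<in> M"
      using rep(2)[OF assms(7)[OF that(1) CD] that(2)] by (intro cong_sum) auto
    moreover have "(\<Sum>c\<in>C. rep (d \<circ> c) x) = Tr x"
      unfolding Tr_def using sum.reindex[OF inj, of "\<lambda>c. c x"] im by simp
    ultimately show ?thesis by simp
  qed
  have key: "Tr (k i0 * y) \<in> M" if y: "y \<in> R" for y
  proof -
    have ky: "k i * y \<in> R" if "i < n" for i using k[OF that] y by (intro mult_R)
    \<comment> \<open>The equation to use is the one of the representative \<open>c'\<close> of the
      inverse \<open>d\<close> of \<open>c\<close>: applying \<open>c\<close> then frees
      \<open>b i\<close> of its automorphism and moves it to the coefficient.\<close>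
    have eqD: "(\<Sum>i<n. b i * c (k i * y)) \<in> M" if "c \<in> C" for c
    proof -
      obtain d where d: "d \<in> D" "c \<circ> d = id" "d \<circ> c = id" using assms(8) CD \<open>c \<in> C\<close> by blast
      obtain c' where c': "c' \<in> C" "\<forall>x\<in>R. d x - c' x \<in> M" using assms(12)[OF d(1)] by blast
      have "(\<Sum>i<n. d (b i) * (k i * y)) - (\<Sum>i<n. c' (b i) * (k i * y)) \<in> M"
        using c' assms(2,15) d(1) k y by (intro cong_sum cong_mult) (auto simp: zero_I intro: mult_R)
      moreover have "(\<Sum>i<n. c' (b i) * k i) * y \<in> M" using k0(3) c'(1) y by (intro mult_I2) auto
      then have "(\<Sum>i<n. c' (b i) * (k i * y)) \<in> M" by (simp add: sum_distrib_right mult.assoc)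
      ultimately have "(\<Sum>i<n. d (b i) * (k i * y)) \<in> M" using cong_iff by blast
      then have "c (\<Sum>i<n. d (b i) * (k i * y)) \<in> M" using assms(6) CD that by blast
      moreover have "c (\<Sum>i<n. d (b i) * (k i * y)) = (\<Sum>i<n. c (d (b i) * (k i * y)))"
        using CD that assms(2,15) d k y by (intro hom_sum mult_R) auto
      moreover have "\<dots> = (\<Sum>i<n. c (d (b i)) * c (k i * y))"
        using CD that assms(2,15) d ky by (intro sum.cong refl) (simp add: assms(3))
      moreover have "c (d z) = z" for z using d(2) by (metis comp_apply id_apply)
      ultimately show ?thesis by simp
    qed
    have "(\<Sum>c\<in>C. \<Sum>i<n. b i * c (k i * y)) \<in> M" by (rule sum_I) (rule eqD)
    then have M1: "(\<Sum>i<n. b i * Tr (k i * y)) \<in> M"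
      unfolding Tr_def sum_distrib_left by (subst sum.swap)
    have "\<exists>v\<in>V. Tr (k i * y) - v \<in> M" if "i < n" for i
      using inv ky[OF that] by (intro assms(14) TrR) auto
    then obtain v where v: "\<And>i. i < n \<Longrightarrow> v i \<in> V" "\<And>i. i < n \<Longrightarrow> Tr (k i * y) - v i \<in> M"
      by metis
    have "(\<Sum>i<n. Tr (k i * y) * b i) - (\<Sum>i<n. v i * b i) \<in> M"
      using v TrR[OF ky] assms(15) by (intro cong_sum cong_mult) (auto simp: zero_I)
    with M1 have "(\<Sum>i<n. v i * b i) \<in> M" using cong_iff by (simp add: mult.commute)
    then have "v i0 \<in> M" using assms(16) v(1) i0(1) by blast
    then show ?thesis using v(2)[OF i0(1)] cong_iff by blast
  qed
  \<comment> \<open>As \<open>k i0\<close> is invertible modulo \<open>M\<close>, the products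
    \<open>k i0 * y\<close> reach every residue, so \<open>Tr\<close> vanishes modulo
    \<open>M\<close> on all of \<open>R\<close>.\<close>
  obtain z where z: "z \<in> R" "k i0 * z - 1 \<in> M" using inverse_mod k i0 by blast
  have Tr0: "Tr x \<in> M" if x: "x \<in> R" for x
  proof -
    have "x * (k i0 * z - 1) \<in> M" using x z by (intro mult_I)
    then have e: "k i0 * (z * x) - x \<in> M" by (simp add: algebra_simps)
    have "Tr (k i0 * (z * x)) - Tr x \<in> M"
      unfolding Tr_def
    proof (rule cong_sum)
      show "c (k i0 * (z * x)) - c x \<in> M" if "c \<in> C" for c
        by (rule hom_cong[OF CD[OF that] _ x e]) (use x z k i0 in \<open>auto intro: mult_R\<close>)
    qed
    moreover have "Tr (k i0 * (z * x)) \<in> M" using x z by (intro key mult_R)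
    ultimately show ?thesis using cong_iff by blast
  qed
  \<comment> \<open>A vanishing trace is a relation between the characters in \<open>C\<close> with
    all coefficients equal to 1.\<close>
  have "\<forall>c\<in>C. (1::'a) \<in> M"
  proof (rule dedekind_independence[of C "\<lambda>_. 1"])
    show "\<And>x. x \<in> R \<Longrightarrow> (\<Sum>c\<in>C. 1 * c x) \<in> M" using Tr0 by (simp add: Tr_def)
    show "\<And>c d. c \<in> C \<Longrightarrow> d \<in> C \<Longrightarrow> c \<noteq> d \<Longrightarrow> \<exists>x\<in>R. c x - d x \<notin> M" by (rule assms(11))
  qed (simp_all add: fC CD assms(2,3,5) one_R)
  with assms(10) one_notin show False by blast
qed

text \<open>Over the field \<open>R / M\<close> the lowest terms of \<open>u\<close> and
  \<open>h\<close> multiply to the lowest term of \<open>u * h\<close>, and the highest to the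
  highest. As \<open>u * h\<close> is a monomial there, both lie in degree \<open>k\<close>, so the
  lowest and the highest surviving term of \<open>u\<close> coincide; the highest is its leading
  term, as \<open>u\<close> is monic.\<close>

lemma monic_factor_of_monom_mod:
  assumes u: "u \<in> polys_over R" "lead_coeff u = 1" and h: "h \<in> polys_over R"
    and uh: "u * h - monom 1 k \<in> polys_over M"
  shows "u - monom 1 (degree u) \<in> polys_over M"
proof -
  interpret P: ideal_pair "polys_over R" "polys_over M" by (rule ideal_pair_polys)
  have uR: "coeff u i \<in> R" and hR: "coeff h i \<in> R" for i using u h by (auto simp: polys_over_def)
  have uh': "coeff (u * h) i - coeff (monom 1 k) i \<in> M" for i
    using uh by (auto simp: polys_over_def)
  have only: "i = k" if "coeff (u * h) i \<notin> M" for i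
    using uh'[of i] that by (auto split: if_splits)
  have "\<exists>j. coeff h j \<notin> M"
  proof (rule ccontr)
    assume "\<not> ?thesis"
    then have "u * h \<in> polys_over M" using u(1) by (intro P.mult_I) (auto simp: polys_over_def)
    then have "coeff (u * h) k \<in> M" by (auto simp: polys_over_def)
    with uh'[of k] one_notin show False using cong_iff by auto
  qed
  define l where "l = (LEAST j. coeff h j \<notin> M)"
  define i where "i = (LEAST j. coeff u j \<notin> M)"
  define t where "t = Max {j. coeff h j \<notin> M}"
  have fin: "finite {j. coeff h j \<notin> M}"
    by (rule finite_subset[of _ "{..degree h}"]) (use zero_I in \<open>auto intro: le_degree\<close>)
  have l: "coeff h l \<notin> M" "\<And>j. j < l \<Longrightarrow> coeff h j \<in> M"
    unfolding l_def using LeastI_ex[OF \<open>\<exists>j. coeff h j \<notin> M\<close>] by - (assumption, drule not_less_Least, blast)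
  have t: "coeff h t \<notin> M" "\<And>j. j > t \<Longrightarrow> coeff h j \<in> M"
    using Max_in[OF fin] Max_ge[OF fin] \<open>\<exists>j. coeff h j \<notin> M\<close> unfolding t_def by fastforce+
  have u1: "coeff u (degree u) \<notin> M" using u(2) one_notin by simp
  have i: "coeff u i \<notin> M" "\<And>j. j < i \<Longrightarrow> coeff u j \<in> M"
    unfolding i_def using LeastI[of "\<lambda>j. coeff u j \<notin> M", OF u1] by - (assumption, drule not_less_Least, blast)
  have il: "i \<le> degree u" unfolding i_def using u1 by (rule Least_le)
  have lt: "l \<le> t" using l(2) t(1) by (meson not_le)
  have "coeff (u * h) (i + l) \<notin> M"
    unfolding coeff_mult
  proof (rule sum_notin[of _ i])
    show "coeff u i * coeff h (i + l - i) \<notin> M" using prime[OF uR hR] i l by auto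
    fix j assume "j \<in> {..i + l}" "j \<noteq> i"
    then consider "j < i" | "i + l - j < l" by fastforce
    then show "coeff u j * coeff h (i + l - j) \<in> M"
      using i l uR hR by cases (auto intro: mult_I mult_I2)
  qed auto
  then have 1: "i + l = k" by (rule only)
  have "coeff (u * h) (degree u + t) \<notin> M"
    unfolding coeff_mult
  proof (rule sum_notin[of _ "degree u"])
    show "coeff u (degree u) * coeff h (degree u + t - degree u) \<notin> M" using u(2) t by auto
    fix j assume "j \<in> {..degree u + t}" "j \<noteq> degree u"
    then consider "j > degree u" | "degree u + t - j > t" by fastforce
    then show "coeff u j * coeff h (degree u + t - j) \<in> M"
      using t uR hR by cases (auto intro: mult_I mult_I2 simp: coeff_eq_0 zero_I)
  qed auto
  then have "degree u + t = k" by (rule only)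
  with 1 il lt have "i = degree u" by linarith
  with i(2) have "coeff (u - monom 1 (degree u)) j \<in> M" for j
    using u(2) by (cases j "degree u" rule: linorder_cases) (auto simp: zero_I coeff_eq_0)
  then show ?thesis by (auto simp: polys_over_def)
qed

end

subsection \<open>Traces of nilpotent matrices\<close>

lemma coeff_prod_linear:
  fixes a :: "nat \<Rightarrow> 'a::comm_ring_1"
  shows "coeff (\<Prod>i<n. [:- a i, 1:]) n = 1 \<and> degree (\<Prod>i<n. [:- a i, 1:]) \<le> n
    \<and> (n > 0 \<longrightarrow> coeff (\<Prod>i<n. [:- a i, 1:]) (n - 1) = - (\<Sum>i<n. a i))"
proof (induction n)
  case (Suc n)
  let ?P = "\<Prod>i<n. [:- a i, 1:]"
  have "coeff ?P (Suc n) = 0" using Suc by (intro coeff_eq_0) auto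
  moreover have "degree (?P * [:- a n, 1:]) \<le> Suc n"
    using degree_mult_le[of ?P "[:- a n, 1:]"] Suc by (auto intro: order_trans)
  ultimately show ?case using Suc by (cases n) (auto simp: mult.commute[of ?P])
qed simp

text \<open>A permutation other than \<open>id\<close> moves at least two indices, so its Leibniz
  term contains at most \<open>n - 2\<close> entries of positive degree; only the diagonal product
  contributes in degree \<open>n - 1\<close>.\<close>

lemma coeff_char_poly_trace:
  fixes A :: "'a::idom mat"
  assumes A: "A \<in> carrier_mat n n" and n: "n > 0"
  shows "coeff (char_poly A) (n - 1) = - (\<Sum>i<n. A $$ (i, i))"
proof -
  let ?B = "char_poly_matrix A"
  have B: "?B \<in> carrier_mat n n" using A by simp
  have Bij: "?B $$ (i, j) = (if i = j then [:- (A $$ (i, j)), 1:] else [:- (A $$ (i, j)):])"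
    if "i < n" "j < n" for i j
    using A that by (auto simp: char_poly_matrix_def)
  let ?t = "\<lambda>p. signof p * (\<Prod>i = 0..<n. ?B $$ (i, p i))"
  have small: "coeff (?t p) (n - 1) = 0" if p: "p permutes {0..<n}" "p \<noteq> id" for p
  proof -
    obtain i where i: "i < n" "p i \<noteq> i" using p
      by (metis atLeastLessThan_iff order_refl permutes_natset_le)
    define j where "j = p i"
    have j: "j < n" "j \<noteq> i" "p j \<noteq> j" using i p permutes_less[OF p(1)] permutes_inj[OF p(1)]
      by (auto simp: j_def dest: injD)
    have "degree (\<Prod>k = 0..<n. ?B $$ (k, p k)) \<le> (\<Sum>k = 0..<n. degree (?B $$ (k, p k)))"
      using degree_prod_sum_le[of "{0..<n}" "\<lambda>k. ?B $$ (k, p k)"] by (simp add: o_def)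
    also have "\<dots> \<le> (\<Sum>k = 0..<n. if k \<in> {i, j} then 0 else 1)"
      using i j permutes_less[OF p(1)] by (intro sum_mono) (auto simp: Bij)
    also have "\<dots> = card ({0..<n} - {i, j})"
      by (subst sum.If_cases) (auto intro!: arg_cong[where f = card])
    also have "\<dots> < n - 1" using i j by (subst card_Diff_subset) auto
    finally show ?thesis by (cases p rule: sign_cases) (auto intro: coeff_eq_0)
  qed
  have "char_poly A = (\<Sum>p \<in> {p. p permutes {0..<n}}. ?t p)"
    unfolding char_poly_def by (rule det_def'[OF B])
  then have "coeff (char_poly A) (n - 1) = (\<Sum>p \<in> {p. p permutes {0..<n}}. coeff (?t p) (n - 1))"
    by (simp add: coeff_sum)
  also have "\<dots> = (\<Sum>p \<in> {id}. coeff (?t p) (n - 1))"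
  proof (rule sum.mono_neutral_right)
    show "\<forall>p\<in>{p. p permutes {0..<n}} - {id}. coeff (?t p) (n - 1) = 0" using small by blast
  qed (auto simp: finite_permutations permutes_id)
  also have "\<dots> = coeff (\<Prod>i<n. [:- (A $$ (i, i)), 1:]) (n - 1)"
    by (simp add: Bij atLeast0LessThan)
  also have "\<dots> = - (\<Sum>i<n. A $$ (i, i))"
    using coeff_prod_linear[of "\<lambda>i. A $$ (i, i)" n] n by simp
  finally show ?thesis .
qed

lemma (in ideal_pair) char_poly_polys:
  assumes A: "A \<in> carrier_mat n n" and R: "\<And>i j. i < n \<Longrightarrow> j < n \<Longrightarrow> A $$ (i, j) \<in> R"
  shows "char_poly A \<in> polys_over R"
proof -
  interpret P: ideal_pair "polys_over R" "polys_over I" by (rule ideal_pair_polys)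
  show ?thesis unfolding char_poly_def
    by (rule P.det_R[of _ n])
      (use A R in \<open>auto simp: char_poly_matrix_def one_R P.one_R intro!: pCons_polys zero_polys uminus_R zero_R\<close>)
qed

text \<open>\<open>W\<close> is the geometric sum of the products of powers of the variable and of
  \<open>A\<close> of total exponent \<open>m - 1\<close>, built by the recursion "variable times
  old sum plus \<open>A ^\<^sub>m m\<close>". Determinants then show that \<open>char_poly A\<close>
  divides the determinant of the right-hand side.\<close>

lemma (in ideal_pair) geometric_char_poly_matrix:
  fixes A :: "'a mat"
  assumes A: "A \<in> carrier_mat n n" and R: "\<And>i j. i < n \<Longrightarrow> j < n \<Longrightarrow> A $$ (i, j) \<in> R"
  shows "\<exists>W \<in> carrier_mat n n. W * char_poly_matrix A
    = monom 1 m \<cdot>\<^sub>m 1\<^sub>m n - map_mat (\<lambda>a. [:a:]) (A ^\<^sub>m m)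
    \<and> (\<forall>i<n. \<forall>j<n. (A ^\<^sub>m m) $$ (i, j) \<in> R \<and> W $$ (i, j) \<in> polys_over R)"
proof (induction m)
  case 0
  have "(0\<^sub>m n n :: 'a poly mat) * char_poly_matrix A = 0\<^sub>m n n"
    using A by (intro left_mult_zero_mat) auto
  moreover have "(0\<^sub>m n n :: 'a poly mat) = monom 1 0 \<cdot>\<^sub>m 1\<^sub>m n - map_mat (\<lambda>a. [:a:]) (A ^\<^sub>m 0)"
    using A by (intro eq_matI) (auto simp: monom_0)
  ultimately have "0\<^sub>m n n * char_poly_matrix A = monom 1 0 \<cdot>\<^sub>m 1\<^sub>m n - map_mat (\<lambda>a. [:a:]) (A ^\<^sub>m 0)"
    by (rule trans)
  moreover have "\<forall>i<n. \<forall>j<n. (A ^\<^sub>m 0) $$ (i, j) \<in> R \<and> (0\<^sub>m n n :: 'a poly mat) $$ (i, j) \<in> polys_over R"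
    using A by (auto simp: zero_polys zero_R one_R)
  ultimately show ?case by (intro bexI[of _ "0\<^sub>m n n"]) (rule conjI, assumption+, rule zero_carrier_mat)
next
  case (Suc m)
  let ?c = "map_mat (\<lambda>a. [:a:])"
  let ?X = "[:0, 1:] :: 'a poly"
  let ?B = "char_poly_matrix A"
  from Suc obtain W where W: "W \<in> carrier_mat n n"
    "W * ?B = monom 1 m \<cdot>\<^sub>m 1\<^sub>m n - ?c (A ^\<^sub>m m)"
    "\<forall>i<n. \<forall>j<n. (A ^\<^sub>m m) $$ (i, j) \<in> R \<and> W $$ (i, j) \<in> polys_over R"
    by blast
  have Am: "A ^\<^sub>m m \<in> carrier_mat n n" using A by simp
  then have cAm: "?c (A ^\<^sub>m m) \<in> carrier_mat n n" by simp
  have B: "?B \<in> carrier_mat n n" "?B = ?X \<cdot>\<^sub>m 1\<^sub>m n - ?c A"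
    using A by (auto simp: char_poly_matrix_def intro!: eq_matI)
  let ?W = "?X \<cdot>\<^sub>m W + ?c (A ^\<^sub>m m)"
  have "?W * ?B = (?X \<cdot>\<^sub>m W) * ?B + ?c (A ^\<^sub>m m) * ?B"
    using W(1) cAm B(1) by (intro add_mult_distrib_mat) auto
  also have "(?X \<cdot>\<^sub>m W) * ?B = ?X \<cdot>\<^sub>m (W * ?B)" using W(1) B(1) by (intro mult_smult_assoc_mat) auto
  also have "?c (A ^\<^sub>m m) * ?B = ?c (A ^\<^sub>m m) * (?X \<cdot>\<^sub>m 1\<^sub>m n) - ?c (A ^\<^sub>m m) * ?c A"
    unfolding B(2) using A cAm by (intro mult_minus_distrib_mat) auto
  also have "?c (A ^\<^sub>m m) * (?X \<cdot>\<^sub>m 1\<^sub>m n) = ?X \<cdot>\<^sub>m (?c (A ^\<^sub>m m) * 1\<^sub>m n)"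
    using cAm by (intro mult_smult_distrib) auto
  also have "?c (A ^\<^sub>m m) * 1\<^sub>m n = ?c (A ^\<^sub>m m)" using cAm by (rule right_mult_one_mat)
  also have "?c (A ^\<^sub>m m) * ?c A = ?c (A ^\<^sub>m Suc m)"
    using map_poly_mult(1)[OF Am A] by simp
  also have "?X \<cdot>\<^sub>m (W * ?B) + (?X \<cdot>\<^sub>m ?c (A ^\<^sub>m m) - ?c (A ^\<^sub>m Suc m))
    = monom 1 (Suc m) \<cdot>\<^sub>m 1\<^sub>m n - ?c (A ^\<^sub>m Suc m)"
    unfolding W(2) using A Am by (intro eq_matI) (auto simp: monom_Suc)
  finally have eq: "?W * ?B = monom 1 (Suc m) \<cdot>\<^sub>m 1\<^sub>m n - ?c (A ^\<^sub>m Suc m)" .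
  have mem: "(A ^\<^sub>m Suc m) $$ (i, j) \<in> R \<and> ?W $$ (i, j) \<in> polys_over R"
    if "i < n" "j < n" for i j
  proof -
    interpret P: ideal_pair "polys_over R" "polys_over I" by (rule ideal_pair_polys)
    have AW: "(A ^\<^sub>m m) $$ (i, j) \<in> R" "W $$ (i, j) \<in> polys_over R" if "i < n" "j < n" for i j
      using W(3) that by auto
    have "(A ^\<^sub>m m * A) $$ (i, j) = (\<Sum>k = 0..<n. (A ^\<^sub>m m) $$ (i, k) * A $$ (k, j))"
      using A Am that by (auto simp: scalar_prod_def)
    also have "\<dots> \<in> R" using AW R that by (intro sum_R mult_R) auto
    finally have "(A ^\<^sub>m Suc m) $$ (i, j) \<in> R" by simp
    moreover have "?W $$ (i, j) = ?X * W $$ (i, j) + [:(A ^\<^sub>m m) $$ (i, j):]"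
      using that carrier_matD[OF W(1)] carrier_matD[OF Am] by simp
    moreover have "\<dots> \<in> polys_over R"
      using AW that by (intro P.add_R P.mult_R pCons_polys zero_polys zero_R one_R) auto
    ultimately show ?thesis by simp
  qed
  have "?W \<in> carrier_mat n n" using W(1) cAm by auto
  then show ?case using eq mem by (intro bexI[of _ ?W] conjI allI impI) blast+
qed

text \<open>If \<open>A ^\<^sub>m m\<close> vanishes modulo \<open>M\<close>, the determinant of the
  geometric identity becomes a power of the variable, so its monic factor \<open>char_poly A\<close>
  is a monomial modulo \<open>M\<close>, and its subleading coefficient, minus the trace, lies in
  \<open>M\<close>. Eigenvalues and quotient fields are avoided.\<close>

lemma (in residue_pair) trace_of_nilpotent_mod:
  assumes A: "A \<in> carrier_mat n n" and n: "n > 0"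
    and R: "\<And>i j. i < n \<Longrightarrow> j < n \<Longrightarrow> A $$ (i, j) \<in> R"
    and nil: "\<And>i j. i < n \<Longrightarrow> j < n \<Longrightarrow> (A ^\<^sub>m m) $$ (i, j) \<in> M"
  shows "(\<Sum>i<n. A $$ (i, i)) \<in> M"
proof -
  interpret P: ideal_pair "polys_over R" "polys_over M" by (rule ideal_pair_polys)
  let ?B = "char_poly_matrix A" and ?D = "monom 1 m \<cdot>\<^sub>m 1\<^sub>m n - map_mat (\<lambda>a. [:a:]) (A ^\<^sub>m m)"
  obtain W where W: "W \<in> carrier_mat n n" "W * ?B = ?D"
    "\<forall>i<n. \<forall>j<n. W $$ (i, j) \<in> polys_over R"
    using geometric_char_poly_matrix[OF A R, of m] by blast
  have Am: "A ^\<^sub>m m \<in> carrier_mat n n" using A by simp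
  have c0: "[:a:] \<in> polys_over M" if "a \<in> M" for a
    using that by (auto simp: polys_over_def coeff_pCons zero_I split: nat.split)
  have "det ?D - det (monom 1 m \<cdot>\<^sub>m 1\<^sub>m n) \<in> polys_over M"
  proof (rule P.det_cong[of _ n])
    fix i j assume ij: "i < n" "j < n"
    show "?D $$ (i, j) \<in> polys_over R"
      using ij A Am pCons_polys[OF in_R[OF nil[OF ij]] zero_polys] monom_polys[OF one_R, of m]
        pCons_polys[OF uminus_R[OF in_R[OF nil[OF ij]]] zero_polys]
      by (auto intro: P.diff_R P.uminus_R)
    show "?D $$ (i, j) - (monom 1 m \<cdot>\<^sub>m 1\<^sub>m n) $$ (i, j) \<in> polys_over M"
      using ij A Am c0[OF nil[OF ij]] P.uminus_I[OF c0[OF nil[OF ij]]] by auto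
  qed (use A Am in auto)
  moreover have "det (monom 1 m \<cdot>\<^sub>m 1\<^sub>m n :: 'a poly mat) = monom 1 (m * n)"
    by (simp add: monom_power)
  moreover have "det ?D = det W * char_poly A"
    unfolding W(2)[symmetric] char_poly_def using W(1) A by (intro det_mult) auto
  ultimately have "char_poly A * det W - monom 1 (m * n) \<in> polys_over M" by (simp add: mult.commute)
  moreover have "det W \<in> polys_over R" using W by (intro P.det_R[of _ n]) auto
  moreover have "char_poly A \<in> polys_over R" using A R by (intro char_poly_polys[of _ n]) auto
  ultimately have "char_poly A - monom 1 (degree (char_poly A)) \<in> polys_over M"
    using degree_monic_char_poly[OF A] by (intro monic_factor_of_monom_mod[of _ "det W" "m * n"]) auto
  then have "coeff (char_poly A - monom 1 n) (n - 1) \<in> M"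
    using degree_monic_char_poly[OF A] by (auto simp: polys_over_def)
  then have "- (\<Sum>i<n. A $$ (i, i)) \<in> M"
    using coeff_char_poly_trace[OF A n] n by (cases n) auto
  then show ?thesis using uminus_I by fastforce
qed

subsection \<open>Integral closure and maximal ideals\<close>

definition span_over :: "'k::field set \<Rightarrow> 'i set \<Rightarrow> ('i \<Rightarrow> 'k) \<Rightarrow> 'k set" where
  "span_over V I v = {\<Sum>i\<in>I. c i * v i | c. \<forall>i\<in>I. c i \<in> V}"

lemma subring_ideal_pair: "subring_of V \<Longrightarrow> ideal_pair V {0}"
  by unfold_locales (auto simp: subring_of_def)

text \<open>The determinant trick in eigenvalue form: multiplication by \<open>x\<close> acts on the
  generators through a matrix over \<open>V\<close>, so the vector of generators, nonzero because of
  \<open>v k\<close>, is an eigenvector for \<open>x\<close>, and \<open>x\<close> is a root of a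
  monic polynomial over \<open>V\<close>.\<close>

lemma integral_if_stable_module:
  assumes V: "subring_of V" and I: "finite I" "k \<in> I" "v k \<noteq> 0"
    and st: "\<And>i. i \<in> I \<Longrightarrow> x * v i \<in> span_over V I v"
  shows "x \<in> integral_closure V"
proof -
  interpret ideal_pair V "{0}" using V by (rule subring_ideal_pair)
  have "\<forall>i\<in>I. \<exists>c. (\<forall>j\<in>I. c j \<in> V) \<and> x * v i = (\<Sum>j\<in>I. c j * v j)"
    using st unfolding span_over_def by blast
  then obtain c where c: "\<And>i j. i \<in> I \<Longrightarrow> j \<in> I \<Longrightarrow> c i j \<in> V"
    "\<And>i. i \<in> I \<Longrightarrow> x * v i = (\<Sum>j\<in>I. c i j * v j)" by metis
  define n where "n = card I"
  obtain e where e: "bij_betw e {0..<n} I"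
    using ex_bij_betw_nat_finite[OF I(1)] unfolding n_def by blast
  have eI: "e i \<in> I" if "i < n" for i using e that by (auto simp: bij_betw_def)
  define A where "A = mat n n (\<lambda>(i, j). c (e i) (e j))"
  define w where "w = vec n (\<lambda>i. v (e i))"
  have A: "A \<in> carrier_mat n n" by (simp add: A_def)
  have "A *\<^sub>v w = x \<cdot>\<^sub>v w"
  proof (rule eq_vecI)
    fix i assume "i < dim_vec (x \<cdot>\<^sub>v w)"
    then have i: "i < n" by (simp add: w_def)
    have "(A *\<^sub>v w) $ i = (\<Sum>j = 0..<n. c (e i) (e j) * v (e j))"
      using i by (simp add: A_def w_def scalar_prod_def)
    also have "\<dots> = (\<Sum>j\<in>I. c (e i) j * v j)" by (rule sum.reindex_bij_betw[OF e])
    also have "\<dots> = (x \<cdot>\<^sub>v w) $ i" using c(2)[OF eI[OF i]] i by (simp add: w_def)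
    finally show "(A *\<^sub>v w) $ i = (x \<cdot>\<^sub>v w) $ i" .
  qed (simp add: A_def w_def)
  moreover have "w \<noteq> 0\<^sub>v n"
  proof -
    obtain i where "i < n" "e i = k" using e I(2) by (auto simp: bij_betw_def)
    then show ?thesis using I(3) by (auto simp: w_def dest: arg_cong[where f = "\<lambda>u. u $ i"])
  qed
  ultimately have "eigenvalue A x"
    using A unfolding eigenvalue_def eigenvector_def by (intro exI[of _ w]) (auto simp: w_def)
  then have "poly (char_poly A) x = 0" using eigenvalue_root_char_poly[OF A] by simp
  moreover have "char_poly A \<in> polys_over V"
    using c(1) eI by (intro char_poly_polys[OF A]) (auto simp: A_def)
  ultimately show ?thesis using degree_monic_char_poly[OF A]
    unfolding integral_closure_def polys_over_def by auto
qed

context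
  fixes V :: "'k::field set"
  assumes V: "subring_of V"
begin

interpretation ideal_pair V "{0}" using V by (rule subring_ideal_pair)

lemma span_over_sum:
  assumes "\<And>j. j \<in> J \<Longrightarrow> g j \<in> span_over V I v"
  shows "sum g J \<in> span_over V I v"
proof -
  have z: "0 \<in> span_over V I v"
    unfolding span_over_def using zero_R by (auto intro!: exI[of _ "\<lambda>_. 0"])
  have "x + y \<in> span_over V I v" if xy: "x \<in> span_over V I v" "y \<in> span_over V I v" for x y
  proof -
    obtain c d where "\<forall>i\<in>I. c i \<in> V" "x = (\<Sum>i\<in>I. c i * v i)"
      "\<forall>i\<in>I. d i \<in> V" "y = (\<Sum>i\<in>I. d i * v i)"
      using xy unfolding span_over_def by blast
    then show ?thesis unfolding span_over_def
      by (auto intro!: exI[of _ "\<lambda>i. c i + d i"] add_R simp: sum.distrib distrib_right)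
  qed
  with z show ?thesis using assms by (induction J rule: infinite_finite_induct) auto
qed

lemma span_over_mult:
  assumes "a \<in> V" "x \<in> span_over V I v"
  shows "a * x \<in> span_over V I v"
proof -
  obtain c where "\<forall>i\<in>I. c i \<in> V" "x = (\<Sum>i\<in>I. c i * v i)"
    using assms unfolding span_over_def by blast
  then show ?thesis using assms(1) unfolding span_over_def
    by (auto intro!: exI[of _ "\<lambda>i. a * c i"] mult_R simp: sum_distrib_left mult.assoc)
qed

lemma span_over_base: "finite I \<Longrightarrow> i \<in> I \<Longrightarrow> v i \<in> span_over V I v"
  unfolding span_over_def
  by (auto intro!: exI[of _ "\<lambda>j. if j = i then 1 else 0"] simp: one_R zero_R sum.delta if_distrib[of "\<lambda>x. x * _"] cong: if_cong)

lemma span_over_stable: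
  assumes "\<And>i. i \<in> I \<Longrightarrow> x * v i \<in> span_over V I v" "y \<in> span_over V I v"
  shows "x * y \<in> span_over V I v"
proof -
  obtain c where c: "\<forall>i\<in>I. c i \<in> V" "y = (\<Sum>i\<in>I. c i * v i)"
    using assms(2) unfolding span_over_def by blast
  then have "x * y = (\<Sum>i\<in>I. c i * (x * v i))" by (simp add: sum_distrib_left mult_ac)
  moreover have "(\<Sum>i\<in>I. c i * (x * v i)) \<in> span_over V I v"
    using c(1) assms(1) by (intro span_over_sum) (simp add: span_over_mult)
  ultimately show ?thesis by simp
qed

text \<open>Only the top power has to be rewritten by the integral equation. The spectator factor
  \<open>z\<close> is a power of the other element when sums and products of two integral elements
  are treated.\<close>

lemma integral_power_step:
  assumes p: "lead_coeff p = 1" "\<And>i. coeff p i \<in> V" "poly p x = 0" and "i < degree p"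
    and w: "\<And>k. k < degree p \<Longrightarrow> x ^ k * z \<in> span_over V I v"
  shows "x * (x ^ i * z) \<in> span_over V I v"
proof (cases "Suc i < degree p")
  case True
  then show ?thesis using w[of "Suc i"] by (simp add: mult_ac)
next
  case False
  then have i: "Suc i = degree p" using assms(4) by simp
  have "0 = (\<Sum>k\<le>degree p. coeff p k * x ^ k)" using p(3) by (simp add: poly_altdef)
  also have "\<dots> = (\<Sum>k<degree p. coeff p k * x ^ k) + x ^ degree p"
    using p(1) by (simp add: lessThan_Suc_atMost[symmetric])
  finally have xi: "x ^ Suc i = - (\<Sum>k<degree p. coeff p k * x ^ k)" unfolding i
    by (simp add: eq_neg_iff_add_eq_0 add.commute)
  have "x * (x ^ i * z) = x ^ Suc i * z" by simp
  also have "\<dots> = (\<Sum>k<degree p. (- coeff p k) * (x ^ k * z))"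
    unfolding xi by (simp add: sum_distrib_right sum_negf mult.assoc)
  also have "\<dots> \<in> span_over V I v"
    using w p(2) by (intro span_over_sum) (simp only: lessThan_iff span_over_mult uminus_R)
  finally show ?thesis .
qed

lemma subset_integral_closure: "V \<subseteq> integral_closure V"
  unfolding integral_closure_def
  by (auto intro!: exI[of _ "[:- _, 1:]"] simp: coeff_pCons zero_R one_R uminus_R split: nat.splits)

text \<open>The products \<open>x ^ i * y ^ j\<close> with exponents below the degrees of the two
  equations span a module stable under \<open>x\<close> and \<open>y\<close>, hence under
  \<open>x + y\<close> and \<open>x * y\<close>.\<close>

lemma subring_integral_closure: "subring_of (integral_closure V)"
proof -
  let ?S = "integral_closure V"
  have *: "x + y \<in> ?S \<and> x * y \<in> ?S" if xy: "x \<in> ?S" "y \<in> ?S" for x y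
  proof -
    obtain p where p: "lead_coeff p = 1" "\<And>i. coeff p i \<in> V" "poly p x = 0"
      using xy unfolding integral_closure_def by blast
    obtain q where q: "lead_coeff q = 1" "\<And>i. coeff q i \<in> V" "poly q y = 0"
      using xy unfolding integral_closure_def by blast
    have dp: "degree p > 0" using p by (cases "degree p = 0") (auto elim!: degree_eq_zeroE)
    have dq: "degree q > 0" using q by (cases "degree q = 0") (auto elim!: degree_eq_zeroE)
    define I where "I = {..<degree p} \<times> {..<degree q}"
    define v where "v = (\<lambda>(i, j). x ^ i * y ^ j)"
    have fI: "finite I" by (simp add: I_def)
    have k: "(0, 0) \<in> I" "v (0, 0) \<noteq> 0" using dp dq by (auto simp: I_def v_def)
    have base: "x ^ i * y ^ j \<in> span_over V I v" if "i < degree p" "j < degree q" for i j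
      using span_over_base[OF fI, of "(i, j)" v] that by (simp add: I_def v_def)
    have xv: "x * v i \<in> span_over V I v" if "i \<in> I" for i
      using that integral_power_step[OF p, of "fst i" "y ^ snd i" I v] base
      by (auto simp: I_def v_def)
    have yv: "y * v i \<in> span_over V I v" if "i \<in> I" for i
      using that integral_power_step[OF q, of "snd i" "x ^ fst i" I v] base
      by (auto simp: I_def v_def mult_ac)
    have "(x + y) * v i \<in> span_over V I v" if "i \<in> I" for i
      using span_over_sum[of "{True, False}" "\<lambda>b. if b then x * v i else y * v i" I v] xv yv that
      by (auto simp: distrib_right)
    moreover have "(x * y) * v i \<in> span_over V I v" if "i \<in> I" for i
      using span_over_stable[of I x v "y * v i", OF xv yv[OF that]] by (simp add: mult.assoc)
    ultimately show ?thesis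
      using integral_if_stable_module[where v = v, OF V fI k] by blast
  qed
  have "-1 \<in> ?S" using subset_integral_closure uminus_R[OF one_R] by blast
  then have "x - y \<in> ?S" if "x \<in> ?S" "y \<in> ?S" for x y
    using *[of x "-1 * y"] *[of "-1" y] that by auto
  with * show ?thesis unfolding subring_of_def
    using subset_integral_closure zero_R one_R by blast
qed

end

lemma residue_pair_max_ideal:
  assumes S: "subring_of S" and M: "max_ideal_of S M"
  shows "residue_pair S M"
proof -
  interpret ideal_pair S M
    using S M by unfold_locales (auto simp: subring_of_def max_ideal_of_def ideal_of_def)
  have one: "1 \<notin> M" using M mult_I[of _ 1] in_R unfolding max_ideal_of_def by fastforce
  have "\<exists>y\<in>S. x * y - 1 \<in> M" if x: "x \<in> S" "x \<notin> M" for x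
  proof -
    let ?I = "{m + x * s | m s. m \<in> M \<and> s \<in> S}"
    have id: "ideal_of S ?I"
      unfolding ideal_of_def
    proof (intro conjI ballI)
      show "?I \<subseteq> S" using x in_R by (auto intro!: add_R mult_R)
      show "0 \<in> ?I" using zero_I zero_R by force
      show "a + b \<in> ?I" if ab: "a \<in> ?I" "b \<in> ?I" for a b
      proof -
        obtain m s m' s' where "a = m + x * s" "b = m' + x * s'" "m \<in> M" "m' \<in> M" "s \<in> S" "s' \<in> S"
          using ab by blast
        then have "a + b = (m + m') + x * (s + s')" "m + m' \<in> M" "s + s' \<in> S"
          by (auto simp: algebra_simps intro: add_I add_R)
        then show ?thesis by blast
      qed
      show "a - b \<in> ?I" if ab: "a \<in> ?I" "b \<in> ?I" for a b
      proof -
        obtain m s m' s' where "a = m + x * s" "b = m' + x * s'" "m \<in> M" "m' \<in> M" "s \<in> S" "s' \<in> S"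
          using ab by blast
        then have "a - b = (m - m') + x * (s - s')" "m - m' \<in> M" "s - s' \<in> S"
          by (auto simp: algebra_simps intro: diff_I diff_R)
        then show ?thesis by blast
      qed
      show "c * a \<in> ?I" if ca: "c \<in> S" "a \<in> ?I" for a c
      proof -
        obtain m s where "a = m + x * s" "m \<in> M" "s \<in> S"
          using ca by blast
        then have "c * a = c * m + x * (c * s)" "c * m \<in> M" "c * s \<in> S"
          using that(1) by (auto simp: algebra_simps intro: mult_I mult_R)
        then show ?thesis by blast
      qed
    qed
    have MI: "M \<subseteq> ?I" using zero_R by force
    have xI: "x \<in> ?I" using zero_I one_R by force
    have "?I = S"
    proof (rule ccontr)
      assume "?I \<noteq> S"
      then have "?I = M" using M id MI unfolding max_ideal_of_def by simp
      then show False using xI x(2) by simp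
    qed
    then have "1 \<in> ?I" using one_R by simp
    then obtain m s where "1 = m + x * s" "m \<in> M" "s \<in> S" by blast
    then have "x * s - 1 = - m" by (metis add_diff_cancel_right' minus_diff_eq)
    then show ?thesis using uminus_I[OF \<open>m \<in> M\<close>] by (intro bexI[OF _ \<open>s \<in> S\<close>]) simp
  qed
  with one show ?thesis by unfold_locales auto
qed

lemma max_ideal_if_residue_pair:
  assumes "residue_pair S M" "subring_of S"
  shows "max_ideal_of S M"
proof -
  interpret residue_pair S M by fact
  have "I = M" if I: "ideal_of S I" "M \<subseteq> I" "I \<noteq> S" for I
  proof (rule ccontr)
    assume "I \<noteq> M"
    then obtain x where x: "x \<in> I" "x \<notin> M" using I by blast
    then have "x \<in> S" using I unfolding ideal_of_def by blast
    then obtain y where y: "y \<in> S" "x * y - 1 \<in> M" using inverse_mod x by blast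
    have "y * x - (x * y - 1) \<in> I" using I x y unfolding ideal_of_def by blast
    then have "1 \<in> I" by (simp add: mult.commute)
    then have "a \<in> I" if "a \<in> S" for a using I(1) that unfolding ideal_of_def by fastforce
    then show False using I unfolding ideal_of_def by blast
  qed
  moreover have "ideal_of S M"
    unfolding ideal_of_def by (simp add: I_subset zero_I add_I diff_I mult_I)
  moreover have "M \<noteq> S" using one_notin one_R by auto
  ultimately show ?thesis unfolding max_ideal_of_def by simp
qed

text \<open>Properness of ideals is expressed as the avoidance of \<open>u\<close>, which will be the unit.\<close>

lemma exists_maximal_avoiding:
  assumes "P I\<^sub>0" "u \<notin> I\<^sub>0"
    and "\<And>C. C \<noteq> {} \<Longrightarrow> (\<And>I. I \<in> C \<Longrightarrow> P I) \<Longrightarrow> (\<And>I J. I \<in> C \<Longrightarrow> J \<in> C \<Longrightarrow> I \<subseteq> J \<or> J \<subseteq> I) \<Longrightarrow> P (\<Union>C)"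
  obtains I where "P I" "I\<^sub>0 \<subseteq> I" "u \<notin> I" "\<And>J. P J \<Longrightarrow> I \<subseteq> J \<Longrightarrow> u \<notin> J \<Longrightarrow> J = I"
proof -
  let ?A = "{I. P I \<and> I\<^sub>0 \<subseteq> I \<and> u \<notin> I}"
  have "\<exists>I\<in>?A. \<forall>J\<in>?A. I \<subseteq> J \<longrightarrow> J = I"
  proof (rule subset_Zorn_nonempty)
    show "?A \<noteq> {}" using assms(1,2) by blast
    fix C assume C: "C \<noteq> {}" "subset.chain ?A C"
    have CA: "C \<subseteq> ?A" and lin: "\<And>I J. I \<in> C \<Longrightarrow> J \<in> C \<Longrightarrow> I \<subseteq> J \<or> J \<subseteq> I"
      using C(2) unfolding subset_chain_def by auto
    have "P (\<Union>C)" by (rule assms(3)[OF C(1) _ lin]) (use CA in auto)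
    moreover have "I\<^sub>0 \<subseteq> \<Union>C" "u \<notin> \<Union>C" using C(1) CA by fastforce+
    ultimately show "\<Union>C \<in> ?A" by simp
  qed
  then obtain I where I: "I \<in> ?A" "\<forall>J\<in>?A. I \<subseteq> J \<longrightarrow> J = I" by blast
  show ?thesis
  proof (rule that)
    show "J = I" if "P J" "I \<subseteq> J" "u \<notin> J" for J using that I by auto
  qed (use I(1) in auto)
qed

lemma exists_max_ideal:
  assumes S: "subring_of S"
  shows "\<exists>M. max_ideal_of S M"
proof -
  obtain M where M: "ideal_of S M" "1 \<notin> M" "\<And>J. ideal_of S J \<Longrightarrow> M \<subseteq> J \<Longrightarrow> 1 \<notin> J \<Longrightarrow> J = M"
  proof (rule exists_maximal_avoiding[of "ideal_of S" "{0}" "1 :: 'a"])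
    show "ideal_of S {0}" using S by (auto simp: ideal_of_def subring_of_def)
    fix C assume C: "C \<noteq> {}" "\<And>I. I \<in> C \<Longrightarrow> ideal_of S I"
      "\<And>I J. I \<in> C \<Longrightarrow> J \<in> C \<Longrightarrow> I \<subseteq> J \<or> J \<subseteq> I"
    have "x + y \<in> \<Union>C \<and> x - y \<in> \<Union>C" if xy: "x \<in> \<Union>C" "y \<in> \<Union>C" for x y
    proof -
      obtain I J where "I \<in> C" "x \<in> I" "J \<in> C" "y \<in> J" using xy by blast
      then obtain I where "I \<in> C" "x \<in> I" "y \<in> I" using C(3)[of I J] by auto
      then show ?thesis using C(2)[of I] unfolding ideal_of_def by blast
    qed
    moreover have "\<Union>C \<subseteq> S" "0 \<in> \<Union>C" "\<forall>a\<in>S. \<forall>x\<in>\<Union>C. a * x \<in> \<Union>C"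
      using C(1) C(2)[unfolded ideal_of_def] by fastforce+
    ultimately show "ideal_of S (\<Union>C)" unfolding ideal_of_def by simp
  qed auto
  have "J = S" if "ideal_of S J" "1 \<in> J" for J
  proof -
    have "a \<in> J" if "a \<in> S" for a
      using \<open>ideal_of S J\<close> \<open>1 \<in> J\<close> that unfolding ideal_of_def by fastforce
    then show ?thesis using that(1) unfolding ideal_of_def by blast
  qed
  moreover have "1 \<in> S" using S by (simp add: subring_of_def)
  ultimately show ?thesis unfolding max_ideal_of_def using M by metis
qed

subsection \<open>The Galois action on the integral closure\<close>

locale valued_galois =
  fixes V F :: "'k::field set"
  assumes val: "valuation_domain_with_qf V F"
    and galois: "finite_galois F"
begin

abbreviation "S \<equiv> integral_closure V"
abbreviation "G \<equiv> gal F"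
abbreviation "mV \<equiv> local_max_ideal V"

lemma subring_V: "subring_of V" and VF: "V \<subseteq> F" and subfield_F: "subfield_of F"
  and val_V: "x \<in> F \<Longrightarrow> x \<noteq> 0 \<Longrightarrow> x \<in> V \<or> inverse x \<in> V"
  using val unfolding valuation_domain_with_qf_def by auto

lemma subring_S: "subring_of S" and VS: "V \<subseteq> S"
  using subring_integral_closure[OF subring_V] subset_integral_closure[OF subring_V] by auto

sublocale K: residue_pair UNIV "{0::'k}"
proof unfold_locales
  show "\<exists>y\<in>UNIV. x * y - 1 \<in> {0}" if "x \<notin> {0}" for x :: 'k
    using that by (intro bexI[of _ "inverse x"]) auto
qed auto

lemma V_unit_iff: "x \<in> V \<Longrightarrow> x \<notin> mV \<longleftrightarrow> (\<exists>y\<in>V. x * y = 1)"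
  unfolding local_max_ideal_def units_of_sr_def
  by (auto simp: field_simps inverse_eq_divide dest: inverse_unique intro!: bexI[of _ "inverse x"])

sublocale V: residue_pair V mV
proof -
  interpret ideal_pair V "{0}" using subring_V by (rule subring_ideal_pair)
  have sub: "mV \<subseteq> V" by (auto simp: local_max_ideal_def)
  have mult: "x * y \<in> mV" if "x \<in> V" "y \<in> mV" for x y
  proof (rule ccontr)
    have y: "y \<in> V" using that sub by auto
    have xy: "x * y \<in> V" using that(1) y by (rule mult_R)
    assume "x * y \<notin> mV"
    then obtain z where "z \<in> V" "x * y * z = 1" using V_unit_iff[OF xy] by blast
    then have "y * (x * z) = 1" "x * z \<in> V" using that by (auto simp: mult_ac intro: mult_R)
    then show False using V_unit_iff[OF y] that(2) by blast
  qed
  have zero: "0 \<in> mV" using zero_R by (simp add: local_max_ideal_def units_of_sr_def)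
  \<comment> \<open>This is where the valuation enters: one of \<open>x / y\<close> and
    \<open>y / x\<close> lies in \<open>V\<close>, so \<open>x - y\<close> is a
    \<open>V\<close>-multiple of \<open>y\<close> or of \<open>x\<close>.\<close>
  have diff: "x - y \<in> mV" if xy: "x \<in> mV" "y \<in> mV" for x y
  proof (cases "x = 0 \<or> y = 0")
    case True
    then show ?thesis using xy zero mult[of "-1" y] uminus_R[OF one_R] by auto
  next
    case False
    then have xy': "x \<in> V" "y \<in> V" "x / y \<in> F"
      using xy sub VF subfield_F unfolding subfield_of_def subring_of_def by (auto simp: divide_inverse subset_iff)
    then consider "x / y \<in> V" | "y / x \<in> V" using val_V[of "x / y"] False by auto
    then show ?thesis
    proof cases
      case 1
      then have "(x / y - 1) * y \<in> mV" using xy by (intro mult diff_R one_R)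
      then show ?thesis using False by (simp add: left_diff_distrib)
    next
      case 2
      then have "(1 - y / x) * x \<in> mV" using xy by (intro mult diff_R one_R)
      then show ?thesis using False by (simp add: left_diff_distrib)
    qed
  qed
  show "residue_pair V mV"
  proof unfold_locales
    show "1 \<notin> mV" using V_unit_iff[OF one_R] one_R by auto
    show "\<exists>y\<in>V. x * y - 1 \<in> mV" if "x \<in> V" "x \<notin> mV" for x
      using V_unit_iff[OF that(1)] that(2) zero by force
  qed (use sub zero diff mult one_R diff_R mult_R in auto)
qed

text \<open>Valuation rings are integrally closed: if \<open>x\<close> is not in \<open>V\<close>,
  its inverse \<open>y\<close> is, and multiplying the integral equation of degree
  \<open>Suc n\<close> by \<open>y ^ n\<close> expresses \<open>x\<close> by elements of
  \<open>V\<close>.\<close>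

lemma S_inter_F: "x \<in> S \<Longrightarrow> x \<in> F \<Longrightarrow> x \<in> V"
proof (rule ccontr)
  assume x: "x \<in> S" "x \<in> F" "x \<notin> V"
  then have nz: "x \<noteq> 0" using V.zero_R by auto
  define y where "y = inverse x"
  have y: "y \<in> V" using val_V[OF x(2) nz] x(3) by (simp add: y_def)
  have xy: "x * y = 1" using nz by (simp add: y_def)
  obtain p where p: "lead_coeff p = 1" "\<And>i. coeff p i \<in> V" "poly p x = 0"
    using x(1) unfolding integral_closure_def by blast
  have d: "degree p > 0" using p by (cases "degree p = 0") (auto elim!: degree_eq_zeroE)
  then obtain n where n: "degree p = Suc n" using gr0_implies_Suc by blast
  have "0 = (\<Sum>k\<le>n. coeff p k * x ^ k) + x ^ Suc n" using p(1,3) n by (simp add: poly_altdef)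
  then have "0 = ((\<Sum>k\<le>n. coeff p k * x ^ k) + x ^ Suc n) * y ^ n" by simp
  also have "\<dots> = (\<Sum>k\<le>n. coeff p k * (x ^ k * y ^ n)) + x * (x * y) ^ n"
    by (simp add: distrib_right sum_distrib_right mult.assoc power_mult_distrib)
  also have "(\<Sum>k\<le>n. coeff p k * (x ^ k * y ^ n)) = (\<Sum>k\<le>n. coeff p k * y ^ (n - k))"
  proof (intro sum.cong refl)
    fix k assume "k \<in> {..n}"
    then have "y ^ n = y ^ k * y ^ (n - k)" by (simp flip: power_add)
    then have "x ^ k * y ^ n = (x * y) ^ k * y ^ (n - k)" by (simp add: power_mult_distrib)
    then show "coeff p k * (x ^ k * y ^ n) = coeff p k * y ^ (n - k)" using xy by simp
  qed
  finally have "x = - (\<Sum>k\<le>n. coeff p k * y ^ (n - k))"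
    using xy by (simp add: eq_neg_iff_add_eq_0 add.commute)
  moreover have "(\<Sum>k\<le>n. coeff p k * y ^ (n - k)) \<in> V"
    using p(2) y by (intro V.sum_R V.mult_R V.power_R)
  ultimately show False using x(3) V.uminus_R by blast
qed

definition ginv :: "('k \<Rightarrow> 'k) \<Rightarrow> 'k \<Rightarrow> 'k" where "ginv \<sigma> = inv_into UNIV \<sigma>"

context
  fixes \<sigma> assumes \<sigma>: "\<sigma> \<in> G"
begin

lemma gal_hom: "\<sigma> (x + y) = \<sigma> x + \<sigma> y" "\<sigma> (x * y) = \<sigma> x * \<sigma> y" "\<sigma> 1 = 1" "bij \<sigma>"
  using \<sigma> by (auto simp: gal_def field_aut_def)

lemma gal_fix: "x \<in> F \<Longrightarrow> \<sigma> x = x"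
  using \<sigma> by (auto simp: gal_def)

lemma gal_comm_ring_hom: "comm_ring_hom \<sigma>"
proof -
  have "\<sigma> 0 = 0" using gal_hom(1)[of 0 0] by (metis add_0 add_cancel_right_left)
  then show ?thesis by unfold_locales (auto simp: gal_hom)
qed

interpretation comm_ring_hom \<sigma> by (rule gal_comm_ring_hom)

lemma gal_0: "\<sigma> 0 = 0" and gal_diff: "\<sigma> (x - y) = \<sigma> x - \<sigma> y"
  and gal_uminus: "\<sigma> (- x) = - \<sigma> x"
  and gal_sum: "\<sigma> (sum g X) = (\<Sum>i\<in>X. \<sigma> (g i))"
  and gal_prod: "\<sigma> (prod g X) = (\<Prod>i\<in>X. \<sigma> (g i))"
  and gal_power: "\<sigma> (x ^ n) = \<sigma> x ^ n"
  by (simp_all add: hom_distribs)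

lemma ginv_left: "ginv \<sigma> (\<sigma> x) = x" and ginv_right: "\<sigma> (ginv \<sigma> x) = x"
  using gal_hom(4) by (simp_all add: ginv_def bij_is_inj bij_is_surj surj_f_inv_f)

lemma ginv_comp: "ginv \<sigma> \<circ> \<sigma> = id" "\<sigma> \<circ> ginv \<sigma> = id"
  by (auto simp: ginv_left ginv_right)

lemma gal_inj: "\<sigma> x = \<sigma> y \<longleftrightarrow> x = y"
  using gal_hom(4) by (auto dest: bij_is_inj injD)

lemma ginv_gal: "ginv \<sigma> \<in> G"
proof -
  have "bij (ginv \<sigma>)" unfolding ginv_def using gal_hom(4) by (rule bij_imp_bij_inv)
  moreover have "ginv \<sigma> x = x" if "x \<in> F" for x using ginv_left[of x] gal_fix[OF that] by simp
  moreover have "ginv \<sigma> (x + y) = ginv \<sigma> x + ginv \<sigma> y" "ginv \<sigma> (x * y) = ginv \<sigma> x * ginv \<sigma> y"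
    "ginv \<sigma> 1 = 1" for x y
    using gal_inj ginv_right gal_hom(1-3) by metis+
  ultimately show ?thesis by (auto simp: gal_def field_aut_def)
qed

lemma gal_S: assumes x: "x \<in> S" shows "\<sigma> x \<in> S"
proof -
  obtain p where p: "lead_coeff p = 1" "\<And>i. coeff p i \<in> V" "poly p x = 0"
    using x unfolding integral_closure_def by blast
  have "poly p (\<sigma> x) = \<sigma> (poly p x)"
    unfolding poly_altdef gal_sum
    using gal_fix[OF subsetD[OF VF p(2)]] by (simp add: gal_hom gal_power)
  then show ?thesis using p gal_0 unfolding integral_closure_def by auto
qed

end

lemma gal_id: "id \<in> G" by (auto simp: gal_def field_aut_def)

lemma gal_comp: "\<sigma> \<in> G \<Longrightarrow> \<tau> \<in> G \<Longrightarrow> \<sigma> \<circ> \<tau> \<in> G"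
  by (auto simp: gal_def field_aut_def intro: bij_comp)

lemma ginv_ginv: "\<sigma> \<in> G \<Longrightarrow> ginv (ginv \<sigma>) = \<sigma>"
  by (rule ext, rule iffD1[OF gal_inj[OF ginv_gal]])
    (assumption, simp only: ginv_right[OF ginv_gal] ginv_left)

lemma gal_comp_cancel: "\<sigma> \<in> G \<Longrightarrow> ginv \<sigma> \<circ> (\<sigma> \<circ> \<tau>) = \<tau>" "\<sigma> \<in> G \<Longrightarrow> \<sigma> \<circ> (ginv \<sigma> \<circ> \<tau>) = \<tau>"
  by (auto simp: ginv_left ginv_right)

lemma fixed_F: "(\<And>\<sigma>. \<sigma> \<in> G \<Longrightarrow> \<sigma> x = x) \<Longrightarrow> x \<in> F"
  using galois unfolding finite_galois_def by blast

lemma fixed_V: "x \<in> S \<Longrightarrow> (\<And>\<sigma>. \<sigma> \<in> G \<Longrightarrow> \<sigma> x = x) \<Longrightarrow> x \<in> V"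
  using S_inter_F fixed_F by blast

text \<open>Dedekind's and Artin's inequalities, read off from the counting lemmas for the zero
  ideal of \<open>K\<close>, where every automorphism is its own congruence class.\<close>

lemma card_gal:
  assumes "field_degree F n"
  shows "finite G" "card G = n"
proof -
  obtain b where b: "\<And>c. (\<forall>i<n. c i \<in> F) \<Longrightarrow> (\<Sum>i<n. c i * b i) = 0 \<Longrightarrow> \<forall>i<n. c i = 0"
    "\<And>y. \<exists>c. (\<forall>i<n. c i \<in> F) \<and> y = (\<Sum>i<n. c i * b i)"
    using assms unfolding field_degree_def by metis
  have diff: "\<exists>x\<in>UNIV. c x - d x \<notin> {0}" if "c \<noteq> d" for c d :: "'k \<Rightarrow> 'k"
    using that by auto
  \<comment> \<open>The bound is proved for finite subsets first, because the finiteness of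
    \<open>G\<close> is itself one of its consequences.\<close>
  have le: "card C \<le> n" if "finite C" "C \<subseteq> G" for C
  proof (rule K.card_incongruent_le[OF that(1), of F n b])
    show "\<exists>v. (\<forall>i<n. v i \<in> F) \<and> y - (\<Sum>i<n. v i * b i) \<in> {0}" for y
      using b(2)[of y] by auto
  qed (use that diff in \<open>auto simp: gal_hom gal_0 gal_fix subset_iff\<close>)
  show fin: "finite G"
  proof (rule ccontr)
    assume "infinite G"
    then obtain C where "C \<subseteq> G" "finite C" "card C = Suc n"
      using infinite_arbitrarily_large by metis
    with le show False by fastforce
  qed
  have "n \<le> card G"
  proof (rule K.card_representatives_ge[OF fin, of G F n b])
    show "\<exists>d\<in>G. c \<circ> d = id \<and> d \<circ> c = id" if "c \<in> G" for c
      using ginv_gal[OF that] ginv_comp[OF that] by blast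
    show "\<exists>v\<in>F. x - v \<in> {0}" if "\<And>d. d \<in> G \<Longrightarrow> d x - x \<in> {0}" for x
      using that fixed_F[of x] by auto
    show "G \<noteq> {}" using gal_id by auto
    show "\<exists>c\<in>G. \<forall>x\<in>UNIV. d x - c x \<in> {0}" if "d \<in> G" for d using that by auto
    show "\<forall>i<n. v i \<in> {0}" if "\<forall>i<n. v i \<in> F" "(\<Sum>i<n. v i * b i) \<in> {0}" for v
      using b(1)[of v] that by auto
  qed (use diff gal_comp in \<open>auto simp: gal_hom gal_0\<close>)
  with le[OF fin] show "card G = n" by simp
qed

lemma finite_G: "finite G"
  using galois card_gal unfolding finite_galois_def by blast

lemma bij_left_mult: "\<sigma> \<in> G \<Longrightarrow> bij_betw (\<lambda>\<tau>. \<sigma> \<circ> \<tau>) G G"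
  by (rule bij_betwI[where g = "\<lambda>\<tau>. ginv \<sigma> \<circ> \<tau>"])
    (auto simp: gal_comp ginv_gal gal_comp_cancel)

definition trace :: "'k \<Rightarrow> 'k" where "trace x = (\<Sum>\<sigma>\<in>G. \<sigma> x)"

definition gal_poly :: "'k \<Rightarrow> 'k poly" where "gal_poly x = (\<Prod>\<sigma>\<in>G. [:- \<sigma> x, 1:])"

sublocale S0: ideal_pair S "{0}"
  using subring_S by (rule subring_ideal_pair)

lemma norm_V: "x \<in> S \<Longrightarrow> (\<Prod>\<sigma>\<in>G. \<sigma> x) \<in> V"
proof (rule fixed_V)
  assume "x \<in> S"
  then show "(\<Prod>\<sigma>\<in>G. \<sigma> x) \<in> S" by (intro S0.prod_R) (rule gal_S)
  fix \<sigma> assume "\<sigma> \<in> G"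
  then show "\<sigma> (\<Prod>\<sigma>\<in>G. \<sigma> x) = (\<Prod>\<sigma>\<in>G. \<sigma> x)"
    using prod.reindex_bij_betw[OF bij_left_mult, of \<sigma> "\<lambda>\<tau>. \<tau> x"]
    by (simp add: gal_prod)
qed

text \<open>Left multiplication permutes \<open>G\<close>, so the coefficients are fixed by every
  automorphism; being integral as well, they lie in \<open>V\<close>.\<close>

lemma gal_poly_V: assumes x: "x \<in> S" shows "gal_poly x \<in> polys_over V"
proof -
  interpret P: ideal_pair "polys_over S" "polys_over {0}" by (rule S0.ideal_pair_polys)
  have S: "gal_poly x \<in> polys_over S"
    unfolding gal_poly_def using x
    by (intro P.prod_R S0.pCons_polys S0.zero_polys S0.one_R S0.uminus_R) (rule gal_S)
  have "\<sigma> (coeff (gal_poly x) i) = coeff (gal_poly x) i" if \<sigma>: "\<sigma> \<in> G" for \<sigma> i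
  proof -
    interpret comm_ring_hom \<sigma> using \<sigma> by (rule gal_comm_ring_hom)
    interpret mp: map_poly_comm_ring_hom \<sigma> ..
    have "map_poly \<sigma> (gal_poly x) = (\<Prod>\<tau>\<in>G. [:- \<sigma> (\<tau> x), 1:])"
      unfolding gal_poly_def using \<sigma>
      by (subst mp.hom_prod) (simp add: map_poly_pCons gal_0 gal_uminus gal_hom)
    also have "\<dots> = gal_poly x"
      unfolding gal_poly_def
      using prod.reindex_bij_betw[OF bij_left_mult[OF \<sigma>], of "\<lambda>\<tau>. [:- \<tau> x, 1:]"] by simp
    finally show ?thesis using coeff_map_poly[of \<sigma> "gal_poly x" i] gal_0[OF \<sigma>] by simp
  qed
  with S show ?thesis unfolding polys_over_def using fixed_V by auto
qed

end

subsection \<open>Decomposition and inertia groups\<close>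

lemma card_eq_image_times_fiber:
  assumes "finite A" "\<And>x. x \<in> A \<Longrightarrow> card {y \<in> A. g y = g x} = k"
  shows "card A = card (g ` A) * k"
proof -
  have "card A = (\<Sum>z\<in>g ` A. card {y \<in> A. g y = z})"
    using sum.image_gen[OF assms(1), of "\<lambda>_. 1 :: nat" g] by simp
  also have "\<dots> = (\<Sum>z\<in>g ` A. k)" by (intro sum.cong refl) (auto simp: assms(2))
  finally show ?thesis by simp
qed

text \<open>Serves to recover the root \<open>x\<close> from the subleading coefficient of a power
  of \<open>[:- x, 1:]\<close> whose exponent is invertible.\<close>

lemma coeff_linear_power_pred:
  fixes a :: "'a::comm_ring_1"
  shows "coeff ([:a, 1:] ^ Suc n) n = of_nat (Suc n) * a"
proof (induction n)
  case (Suc n)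
  have "coeff ([:a, 1:] ^ Suc (Suc n)) (Suc n) = a * coeff ([:a, 1:] ^ Suc n) (Suc n) + coeff ([:a, 1:] ^ Suc n) n"
    by simp
  also have "coeff ([:a, 1:] ^ Suc n) (Suc n) = 1" by (rule coeff_linear_power)
  finally show ?case using Suc by (simp add: algebra_simps)
qed simp

text \<open>A single maximal ideal is fixed. The others turn out to be its conjugates, so that
  conditions at all of them are expressed by \<open>\<sigma> x \<in> M\<close> with varying
  \<open>\<sigma>\<close>.\<close>

locale valued_galois_max = valued_galois V F for V F :: "'k::field set" +
  fixes M :: "'k set"
  assumes max_M: "max_ideal_of (integral_closure V) M"
begin

sublocale M: residue_pair S M
  using subring_S max_M by (rule residue_pair_max_ideal)

text \<open>Lying over, by a norm argument: if \<open>x\<close> in \<open>mV\<close> were invertible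
  modulo \<open>M\<close>, then \<open>m = 1 - x * s\<close> would lie in \<open>M\<close> for some
  \<open>s\<close>. The norm of \<open>m\<close> then lies in \<open>V\<close> and in
  \<open>M\<close>, yet it is 1 modulo \<open>mV\<close>, hence a unit of \<open>V\<close>.\<close>

lemma mV_M: "mV \<subseteq> M"
proof
  fix x assume x: "x \<in> mV"
  have xV: "x \<in> V" using x by (rule V.in_R)
  show "x \<in> M"
  proof (rule ccontr)
    assume "x \<notin> M"
    then obtain s where s: "s \<in> S" "x * s - 1 \<in> M" using M.inverse_mod xV VS by blast
    have x0: "x \<noteq> 0" using \<open>x \<notin> M\<close> M.zero_I by auto
    define m where "m = 1 - x * s"
    have mM: "m \<in> M" using M.uminus_I[OF s(2)] by (simp add: m_def)
    have \<sigma>m: "\<sigma> m = 1 - x * \<sigma> s" if "\<sigma> \<in> G" for \<sigma>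
      using that gal_fix[OF that, of x] xV VF by (auto simp: m_def gal_diff gal_hom)
    \<comment> \<open>Automorphisms fix \<open>x\<close>, so each conjugate of \<open>m\<close> is 1
      minus an \<open>S\<close>-multiple of \<open>x\<close>, and this form survives
      products.\<close>
    have "\<exists>w\<in>S. (\<Prod>\<sigma>\<in>X. \<sigma> m) = 1 + x * w" if "X \<subseteq> G" for X
      using finite_subset[OF that finite_G] that
    proof (induction X)
      case (insert \<sigma> X)
      then obtain w where w: "w \<in> S" "(\<Prod>\<sigma>\<in>X. \<sigma> m) = 1 + x * w" by auto
      have "(\<Prod>\<sigma>\<in>insert \<sigma> X. \<sigma> m) = 1 + x * (w - \<sigma> s * (1 + x * w))"
        using insert.hyps insert.prems w(2) \<sigma>m[of \<sigma>]
        by (simp add: right_diff_distrib left_diff_distrib mult.assoc)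
      moreover have "\<sigma> s \<in> S" using insert.prems s gal_S by auto
      then have "w - \<sigma> s * (1 + x * w) \<in> S"
        using w xV VS by (auto intro!: M.diff_R M.mult_R M.add_R M.one_R)
      ultimately show ?case by blast
    qed (auto intro!: bexI[of _ 0] M.zero_R)
    then obtain w where w: "w \<in> S" "(\<Prod>\<sigma>\<in>G. \<sigma> m) = 1 + x * w" by blast
    have nV: "(\<Prod>\<sigma>\<in>G. \<sigma> m) \<in> V" using norm_V M.in_R[OF mM] by blast
    have "(\<Prod>\<sigma>\<in>G. \<sigma> m) = m * (\<Prod>\<sigma>\<in>G - {id}. \<sigma> m)"
      using prod.remove[OF finite_G gal_id, of "\<lambda>\<sigma>. \<sigma> m"] by simp
    moreover have "(\<Prod>\<sigma>\<in>G - {id}. \<sigma> m) \<in> S"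
      by (rule M.prod_R) (use gal_S M.in_R[OF mM] in auto)
    ultimately have nM: "(\<Prod>\<sigma>\<in>G. \<sigma> m) \<in> M" using mM M.mult_I2 by simp
    \<comment> \<open>Solving for \<open>w\<close> puts it into \<open>F\<close>; being integral it
      lies in \<open>V\<close>, so that \<open>x * w\<close> is in \<open>mV\<close>.\<close>
    have "w = ((\<Prod>\<sigma>\<in>G. \<sigma> m) - 1) * inverse x" using w(2) x0 by simp
    moreover have "(\<Prod>\<sigma>\<in>G. \<sigma> m) - 1 \<in> F" "inverse x \<in> F"
      using nV V.one_R V.diff_R VF xV subfield_F unfolding subfield_of_def by auto
    ultimately have "w \<in> F" using subfield_F unfolding subfield_of_def subring_of_def by simp
    then have "w \<in> V" using w(1) S_inter_F by blast
    then have "x * w \<in> mV" by (rule V.mult_I2[OF x])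
    then have "(\<Prod>\<sigma>\<in>G. \<sigma> m) \<notin> mV"
      using V.diff_I[of "1 + x * w" "x * w"] V.one_notin w(2) by auto
    then obtain y where "y \<in> V" "(\<Prod>\<sigma>\<in>G. \<sigma> m) * y = 1" using V_unit_iff[OF nV] by blast
    then have "1 \<in> M" using M.mult_I2[OF nM, of y] VS by auto
    then show False using M.one_notin by simp
  qed
qed

lemma V_M_iff: "x \<in> V \<Longrightarrow> x \<in> M \<longleftrightarrow> x \<in> mV"
proof -
  assume x: "x \<in> V"
  have "x \<in> mV" if "x \<in> M"
  proof (rule ccontr)
    assume "x \<notin> mV"
    then obtain y where "y \<in> V" "x * y = 1" using V_unit_iff[OF x] by blast
    then show False using M.mult_I2[OF that, of y] VS M.one_notin by auto
  qed
  then show ?thesis using mV_M by blast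
qed

text \<open>Primality of \<open>M\<close> keeps the norm of \<open>x\<close> outside
  \<open>M\<close>, hence outside \<open>mV\<close>; it is a unit of \<open>V\<close> and a multiple
  of \<open>x\<close>.\<close>

lemma unit_S:
  assumes x: "x \<in> S" "\<And>\<sigma>. \<sigma> \<in> G \<Longrightarrow> \<sigma> x \<notin> M"
  shows "\<exists>y\<in>S. x * y = 1"
proof -
  have "(\<Prod>\<sigma>\<in>G. \<sigma> x) \<notin> M" by (rule M.prod_notin[OF finite_G]) (use x gal_S in auto)
  then have "(\<Prod>\<sigma>\<in>G. \<sigma> x) \<notin> mV" using mV_M by blast
  then obtain y where y: "y \<in> V" "(\<Prod>\<sigma>\<in>G. \<sigma> x) * y = 1" using V_unit_iff[OF norm_V[OF x(1)]] by blast
  have "(\<Prod>\<sigma>\<in>G. \<sigma> x) = x * (\<Prod>\<sigma>\<in>G - {id}. \<sigma> x)"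
    using prod.remove[OF finite_G gal_id, of "\<lambda>\<sigma>. \<sigma> x"] by simp
  then have "x * ((\<Prod>\<sigma>\<in>G - {id}. \<sigma> x) * y) = 1" using y by (simp add: mult.assoc)
  moreover have "(\<Prod>\<sigma>\<in>G - {id}. \<sigma> x) \<in> S" by (rule M.prod_R) (use gal_S x in auto)
  ultimately show ?thesis using y(1) VS M.mult_R by blast
qed

section \<open>The Jacobson radical of \<open>S\<close>\<close>

definition JS :: "'k set" where "JS = {x \<in> S. \<forall>\<sigma>\<in>G. \<sigma> x \<in> M}"

sublocale J: ideal_pair S JS
proof unfold_locales
  fix x y assume x: "x \<in> S" and y: "y \<in> JS"
  have "\<sigma> (x * y) \<in> M" if "\<sigma> \<in> G" for \<sigma>
    using y that M.mult_I[OF gal_S[OF that x], of "\<sigma> y"] by (simp add: JS_def gal_hom(2)[OF that])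
  then show "x * y \<in> JS" using x y by (simp add: JS_def M.mult_R)
qed (auto simp: JS_def M.one_R M.diff_R M.mult_R M.zero_R M.zero_I gal_0 gal_diff M.diff_I)

lemma JS_gal: "x \<in> JS \<Longrightarrow> \<sigma> \<in> G \<Longrightarrow> \<sigma> x \<in> JS"
proof -
  assume x: "x \<in> JS" and \<sigma>: "\<sigma> \<in> G"
  have "\<tau> (\<sigma> x) \<in> M" if "\<tau> \<in> G" for \<tau>
    using x gal_comp[OF that \<sigma>] by (auto simp: JS_def dest: bspec[of _ _ "\<tau> \<circ> \<sigma>"])
  then show ?thesis using gal_S[OF \<sigma>] x by (simp add: JS_def)
qed

lemma unit_one_minus_JS: "x \<in> JS \<Longrightarrow> \<exists>y\<in>S. (1 - x) * y = 1"
proof (rule unit_S)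
  assume x: "x \<in> JS"
  show "1 - x \<in> S" using J.in_R[OF x] by (intro M.diff_R M.one_R)
  show "\<sigma> (1 - x) \<notin> M" if "\<sigma> \<in> G" for \<sigma>
  proof
    assume "\<sigma> (1 - x) \<in> M"
    then have "(1 - \<sigma> x) + \<sigma> x \<in> M"
      using x that by (intro M.add_I) (auto simp: JS_def gal_diff gal_hom)
    then show False using M.one_notin by simp
  qed
qed

section \<open>The decomposition group of \<open>M\<close> and the conjugates of
  \<open>M\<close>\<close>

definition dec :: "('k \<Rightarrow> 'k) set" where "dec = {\<sigma> \<in> G. \<forall>x\<in>S. \<sigma> x \<in> M \<longrightarrow> x \<in> M}"

lemma dec_G: "\<sigma> \<in> dec \<Longrightarrow> \<sigma> \<in> G" by (simp add: dec_def)

lemma gal_inverse_mod: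
  assumes "\<sigma> \<in> G" "x \<in> S" "\<sigma> x \<notin> M"
  shows "\<exists>y\<in>S. \<sigma> (x * y - 1) \<in> M"
proof -
  obtain z where z: "z \<in> S" "\<sigma> x * z - 1 \<in> M" using M.inverse_mod gal_S assms by blast
  have "\<sigma> (x * ginv \<sigma> z - 1) = \<sigma> x * z - 1"
    using assms(1) by (simp add: gal_diff gal_hom ginv_right)
  then show ?thesis using z gal_S[OF ginv_gal[OF assms(1)]] by (intro bexI[of _ "ginv \<sigma> z"]) auto
qed

text \<open>The definition of \<open>dec\<close> only asks that the preimage of \<open>M\<close>
  under \<open>\<sigma>\<close> be contained in \<open>M\<close>. Equality follows since that
  preimage is maximal: if \<open>x\<close> in \<open>M\<close> were outside it, \<open>x\<close>
  would have an inverse modulo it, hence modulo \<open>M\<close>.\<close>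

lemma dec_M_iff: assumes "\<sigma> \<in> dec" "x \<in> S" shows "\<sigma> x \<in> M \<longleftrightarrow> x \<in> M"
proof
  assume x: "x \<in> M"
  show "\<sigma> x \<in> M"
  proof (rule ccontr)
    assume "\<sigma> x \<notin> M"
    then obtain y where y: "y \<in> S" "\<sigma> (x * y - 1) \<in> M"
      using gal_inverse_mod[OF dec_G[OF assms(1)] assms(2)] by blast
    then have "x * y - 1 \<in> M" using assms unfolding dec_def by (auto intro!: M.diff_R M.mult_R M.one_R)
    then have "x * y - (x * y - 1) \<in> M" by (rule M.diff_I[OF M.mult_I2[OF x y(1)]])
    then show False using M.one_notin by simp
  qed
qed (use assms in \<open>auto simp: dec_def\<close>)

lemma dec_id: "id \<in> dec" by (auto simp: dec_def gal_id)

lemma dec_comp: "\<sigma> \<in> dec \<Longrightarrow> \<tau> \<in> dec \<Longrightarrow> \<sigma> \<circ> \<tau> \<in> dec"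
proof -
  assume \<sigma>: "\<sigma> \<in> dec" and \<tau>: "\<tau> \<in> dec"
  have "x \<in> M" if "x \<in> S" "\<sigma> (\<tau> x) \<in> M" for x
    using that \<sigma> \<tau> gal_S[OF dec_G[OF \<tau>] that(1)] by (simp add: dec_def)
  then show ?thesis using gal_comp[OF dec_G[OF \<sigma>] dec_G[OF \<tau>]] by (simp add: dec_def)
qed

lemma dec_ginv: assumes "\<sigma> \<in> dec" shows "ginv \<sigma> \<in> dec"
proof -
  have \<sigma>: "\<sigma> \<in> G" using assms by (rule dec_G)
  have "x \<in> M" if "x \<in> S" "ginv \<sigma> x \<in> M" for x
    using dec_M_iff[OF assms, of "ginv \<sigma> x"] that gal_S[OF ginv_gal[OF \<sigma>]] ginv_right[OF \<sigma>] by auto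
  then show ?thesis using ginv_gal[OF \<sigma>] by (simp add: dec_def)
qed

lemma finite_dec: "finite dec" using finite_G by (simp add: dec_def)

text \<open>Chinese remaindering: \<open>\<epsilon>\<close> is 1 at \<open>M\<close> and 0 at every
  other conjugate of \<open>M\<close>, as a product of elements that each do this for one
  \<open>\<sigma>\<close> outside \<open>dec\<close>.\<close>

lemma exists_local_idempotent:
  "\<exists>\<epsilon>\<in>S. \<epsilon> - 1 \<in> M \<and> (\<forall>\<sigma>\<in>G - dec. \<sigma> \<epsilon> \<in> M)"
proof -
  have "\<exists>u\<in>S. u - 1 \<in> M \<and> \<sigma> u \<in> M" if \<sigma>: "\<sigma> \<in> G - dec" for \<sigma>
  proof -
    obtain u where u: "u \<in> S" "\<sigma> u \<in> M" "u \<notin> M" using \<sigma> by (auto simp: dec_def)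
    obtain y where y: "y \<in> S" "u * y - 1 \<in> M" using M.inverse_mod u by blast
    have "\<sigma> (u * y) \<in> M" using \<sigma> u(2) gal_S y(1) by (auto simp: gal_hom intro: M.mult_I2)
    then show ?thesis using y u(1) M.mult_R by blast
  qed
  then obtain u where u: "\<And>\<sigma>. \<sigma> \<in> G - dec \<Longrightarrow> u \<sigma> \<in> S \<and> u \<sigma> - 1 \<in> M \<and> \<sigma> (u \<sigma>) \<in> M"
    by metis
  define e where "e = (\<Prod>\<sigma>\<in>G - dec. u \<sigma>)"
  have "e \<in> S" unfolding e_def by (rule M.prod_R) (use u in auto)
  moreover have "e - (\<Prod>\<sigma>\<in>G - dec. 1) \<in> M"
    unfolding e_def by (rule M.cong_prod) (use u M.one_R in auto)
  moreover have "\<sigma> e \<in> M" if \<sigma>: "\<sigma> \<in> G - dec" for \<sigma>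
  proof -
    have "e = u \<sigma> * (\<Prod>\<sigma>\<in>G - dec - {\<sigma>}. u \<sigma>)"
      unfolding e_def using \<sigma> finite_G by (intro prod.remove) auto
    moreover have "(\<Prod>\<sigma>\<in>G - dec - {\<sigma>}. u \<sigma>) \<in> S" by (rule M.prod_R) (use u in auto)
    ultimately show ?thesis using u[OF \<sigma>] \<sigma> gal_S by (auto simp: gal_hom intro: M.mult_I2)
  qed
  ultimately show ?thesis by auto
qed

text \<open>The preimage of \<open>M\<close> under \<open>\<sigma>\<close> within \<open>S\<close>,
  which is the image of \<open>M\<close> under the inverse of \<open>\<sigma>\<close>; preimages
  keep \<open>ginv\<close> out of the membership conditions.\<close>

definition conj_max :: "('k \<Rightarrow> 'k) \<Rightarrow> 'k set" where "conj_max \<sigma> = {x \<in> S. \<sigma> x \<in> M}"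

lemma conj_max_residue_pair: "\<sigma> \<in> G \<Longrightarrow> residue_pair S (conj_max \<sigma>)"
proof unfold_locales
  fix x assume "\<sigma> \<in> G" "x \<in> S" "x \<notin> conj_max \<sigma>"
  then show "\<exists>y\<in>S. x * y - 1 \<in> conj_max \<sigma>"
    using gal_inverse_mod[of \<sigma> x] by (auto simp: conj_max_def M.diff_R M.mult_R M.one_R)
next
  fix x y assume \<sigma>: "\<sigma> \<in> G" and x: "x \<in> S" and y: "y \<in> conj_max \<sigma>"
  have "\<sigma> (x * y) \<in> M"
    using y M.mult_I[OF gal_S[OF \<sigma> x], of "\<sigma> y"] by (simp add: conj_max_def gal_hom(2)[OF \<sigma>])
  then show "x * y \<in> conj_max \<sigma>" using x y by (simp add: conj_max_def M.mult_R)
qed (auto simp: conj_max_def M.one_R M.diff_R M.mult_R M.zero_R M.zero_I gal_0 gal_diff gal_hom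
    M.diff_I M.one_notin)

text \<open>If \<open>M'\<close> differed from all conjugates, each conjugate would contain an
  element congruent to 1 modulo \<open>M'\<close>. One minus their product then lies in
  \<open>M'\<close>, but is 1 modulo every conjugate and so a unit by the norm criterion.\<close>

lemma max_ideals_conjugate:
  assumes M': "max_ideal_of S M'"
  shows "\<exists>\<sigma>\<in>G. M' = conj_max \<sigma>"
proof (rule ccontr)
  assume neg: "\<not> ?thesis"
  interpret N: residue_pair S M' using subring_S M' by (rule residue_pair_max_ideal)
  have "\<exists>w\<in>S. \<sigma> w \<in> M \<and> w - 1 \<in> M'" if \<sigma>: "\<sigma> \<in> G" for \<sigma>
  proof -
    have mx: "max_ideal_of S (conj_max \<sigma>)"
      using conj_max_residue_pair[OF \<sigma>] subring_S by (rule max_ideal_if_residue_pair)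
    have "\<not> M' \<subseteq> conj_max \<sigma>"
      using mx M' neg \<sigma> unfolding max_ideal_of_def by blast
    then obtain u where u: "u \<in> M'" "u \<in> S" "\<sigma> u \<notin> M" using N.in_R by (auto simp: conj_max_def)
    then obtain z where z: "z \<in> S" "\<sigma> (u * z - 1) \<in> M" using gal_inverse_mod \<sigma> by blast
    have "\<sigma> (1 - u * z) \<in> M" using M.uminus_I[OF z(2)] \<sigma> by (simp add: gal_diff)
    moreover have "(1 - u * z) - 1 \<in> M'" using N.uminus_I[OF N.mult_I2[OF u(1) z(1)]] by simp
    ultimately show ?thesis using u z by (intro bexI[of _ "1 - u * z"]) (auto intro!: M.diff_R M.mult_R M.one_R)
  qed
  then obtain w where w: "\<And>\<sigma>. \<sigma> \<in> G \<Longrightarrow> w \<sigma> \<in> S \<and> \<sigma> (w \<sigma>) \<in> M \<and> w \<sigma> - 1 \<in> M'"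
    by metis
  define x where "x = 1 - (\<Prod>\<sigma>\<in>G. w \<sigma>)"
  have pS: "(\<Prod>\<sigma>\<in>G. w \<sigma>) \<in> S" by (rule M.prod_R) (use w in auto)
  then have xS: "x \<in> S" unfolding x_def by (intro M.diff_R M.one_R)
  have "(\<Prod>\<sigma>\<in>G. w \<sigma>) - (\<Prod>\<sigma>\<in>G. 1) \<in> M'" by (rule N.cong_prod) (use w M.one_R in auto)
  then have xM': "x \<in> M'" using N.uminus_I[of "(\<Prod>\<sigma>\<in>G. w \<sigma>) - 1"] by (simp add: x_def)
  have "\<sigma> x \<notin> M" if \<sigma>: "\<sigma> \<in> G" for \<sigma>
  proof
    have "(\<Prod>\<sigma>\<in>G. w \<sigma>) = w \<sigma> * (\<Prod>\<sigma>\<in>G - {\<sigma>}. w \<sigma>)"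
      using \<sigma> finite_G by (intro prod.remove) auto
    moreover have "(\<Prod>\<sigma>\<in>G - {\<sigma>}. w \<sigma>) \<in> S" by (rule M.prod_R) (use w in auto)
    ultimately have p: "\<sigma> (\<Prod>\<sigma>\<in>G. w \<sigma>) \<in> M" using w[OF \<sigma>] \<sigma> gal_S by (auto simp: gal_hom intro: M.mult_I2)
    assume "\<sigma> x \<in> M"
    then have "\<sigma> x + \<sigma> (\<Prod>\<sigma>\<in>G. w \<sigma>) \<in> M" using p by (rule M.add_I)
    then show False using \<sigma> M.one_notin by (simp add: x_def gal_diff gal_hom)
  qed
  then obtain y where "y \<in> S" "x * y = 1" using unit_S[OF xS] by blast
  then show False using N.mult_I2[OF xM'] N.one_notin by metis
qed

lemma conj_max_eq_iff:
  assumes \<sigma>: "\<sigma> \<in> G" and \<tau>: "\<tau> \<in> G"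
  shows "conj_max \<tau> = conj_max \<sigma> \<longleftrightarrow> \<tau> \<circ> ginv \<sigma> \<in> dec"
proof
  assume e: "conj_max \<tau> = conj_max \<sigma>"
  have "x \<in> M" if "x \<in> S" "\<tau> (ginv \<sigma> x) \<in> M" for x
  proof -
    have "ginv \<sigma> x \<in> conj_max \<tau>" using that gal_S[OF ginv_gal[OF \<sigma>]] by (auto simp: conj_max_def)
    then have "ginv \<sigma> x \<in> conj_max \<sigma>" using e by simp
    then show ?thesis using ginv_right[OF \<sigma>] by (simp add: conj_max_def)
  qed
  then show "\<tau> \<circ> ginv \<sigma> \<in> dec" using gal_comp[OF \<tau> ginv_gal[OF \<sigma>]] by (auto simp: dec_def)
next
  assume d: "\<tau> \<circ> ginv \<sigma> \<in> dec"
  have "\<tau> x \<in> M \<longleftrightarrow> \<sigma> x \<in> M" if "x \<in> S" for x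
    using dec_M_iff[OF d gal_S[OF \<sigma> that]] by (simp add: ginv_left[OF \<sigma>])
  then show "conj_max \<tau> = conj_max \<sigma>" by (auto simp: conj_max_def)
qed

text \<open>Orbit and stabilizer: the fibers of \<open>conj_max\<close> are the right cosets of
  \<open>dec\<close>, and its image consists of all maximal ideals.\<close>

lemma card_gal_dec: "card G = num_max_ideals S * card dec"
proof -
  have im: "conj_max ` G = {M'. max_ideal_of S M'}"
    using max_ideals_conjugate max_ideal_if_residue_pair[OF conj_max_residue_pair subring_S] by auto
  have "card {\<tau> \<in> G. conj_max \<tau> = conj_max \<sigma>} = card dec" if \<sigma>: "\<sigma> \<in> G" for \<sigma>
  proof -
    have comp: "(\<delta> \<circ> \<sigma>) \<circ> ginv \<sigma> = \<delta>" "(\<delta> \<circ> ginv \<sigma>) \<circ> \<sigma> = \<delta>" for \<delta> :: "'k \<Rightarrow> 'k"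
      by (auto simp: fun_eq_iff ginv_left[OF \<sigma>] ginv_right[OF \<sigma>])
    have "bij_betw (\<lambda>\<delta>. \<delta> \<circ> \<sigma>) dec {\<tau> \<in> G. conj_max \<tau> = conj_max \<sigma>}"
    proof (rule bij_betwI[where g = "\<lambda>\<tau>. \<tau> \<circ> ginv \<sigma>"])
      show "(\<lambda>\<delta>. \<delta> \<circ> \<sigma>) \<in> dec \<rightarrow> {\<tau> \<in> G. conj_max \<tau> = conj_max \<sigma>}"
        using gal_comp[OF dec_G \<sigma>] by (auto simp: conj_max_eq_iff[OF \<sigma>] comp)
      show "(\<lambda>\<tau>. \<tau> \<circ> ginv \<sigma>) \<in> {\<tau> \<in> G. conj_max \<tau> = conj_max \<sigma>} \<rightarrow> dec"
        by (auto simp: conj_max_eq_iff[OF \<sigma>])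
    qed (simp_all add: comp)
    then show ?thesis by (simp add: bij_betw_same_card)
  qed
  then have "card G = card (conj_max ` G) * card dec"
    by (intro card_eq_image_times_fiber finite_G)
  then show ?thesis by (simp add: im num_max_ideals_def)
qed

section \<open>The inertia group and the action on the residue field\<close>

definition cong_M :: "('k \<Rightarrow> 'k) \<Rightarrow> ('k \<Rightarrow> 'k) \<Rightarrow> bool" where
  "cong_M \<sigma> \<tau> \<longleftrightarrow> (\<forall>x\<in>S. \<sigma> x - \<tau> x \<in> M)"

definition inertia :: "('k \<Rightarrow> 'k) set" where "inertia = {\<sigma> \<in> dec. cong_M \<sigma> id}"

text \<open>The predicate under the choice depends only on the congruence class of
  \<open>\<sigma>\<close>, so congruent automorphisms receive the very same representative, and the
  image of \<open>rep\<close> is a transversal of \<open>dec\<close> modulo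
  \<open>inertia\<close>.\<close>

definition rep :: "('k \<Rightarrow> 'k) \<Rightarrow> ('k \<Rightarrow> 'k)" where
  "rep \<sigma> = (SOME \<tau>. \<tau> \<in> dec \<and> cong_M \<sigma> \<tau>)"

definition reps :: "('k \<Rightarrow> 'k) set" where "reps = rep ` dec"

lemma cong_M_refl: "cong_M \<sigma> \<sigma>" by (simp add: cong_M_def M.zero_I)

lemma cong_M_sym: "cong_M \<sigma> \<tau> \<Longrightarrow> cong_M \<tau> \<sigma>"
  unfolding cong_M_def using M.cong_sym by blast

lemma cong_M_trans: "cong_M \<sigma> \<tau> \<Longrightarrow> cong_M \<tau> \<rho> \<Longrightarrow> cong_M \<sigma> \<rho>"
  unfolding cong_M_def using M.cong_trans by blast

lemma rep: assumes "\<sigma> \<in> dec" shows "rep \<sigma> \<in> dec" "cong_M \<sigma> (rep \<sigma>)"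
  using someI[of "\<lambda>\<tau>. \<tau> \<in> dec \<and> cong_M \<sigma> \<tau>" \<sigma>] assms cong_M_refl unfolding rep_def by auto

lemma rep_eq_iff: assumes "\<sigma> \<in> dec" "\<tau> \<in> dec" shows "rep \<sigma> = rep \<tau> \<longleftrightarrow> cong_M \<sigma> \<tau>"
proof
  assume "rep \<sigma> = rep \<tau>"
  then show "cong_M \<sigma> \<tau>" using rep assms cong_M_sym cong_M_trans by metis
next
  assume c: "cong_M \<sigma> \<tau>"
  have "(\<lambda>\<rho>. \<rho> \<in> dec \<and> cong_M \<sigma> \<rho>) = (\<lambda>\<rho>. \<rho> \<in> dec \<and> cong_M \<tau> \<rho>)"
    using c cong_M_sym cong_M_trans by blast
  then show "rep \<sigma> = rep \<tau>" unfolding rep_def by simp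
qed

lemma dec_cong:
  assumes "\<sigma> \<in> dec" "x \<in> S" "y \<in> S" "x - y \<in> M"
  shows "\<sigma> x - \<sigma> y \<in> M"
  using dec_M_iff[OF assms(1) M.diff_R[OF assms(2,3)]] assms(4) gal_diff[OF dec_G[OF assms(1)]] by simp

lemma card_class: assumes \<sigma>: "\<sigma> \<in> dec" shows "card {\<tau> \<in> dec. rep \<tau> = rep \<sigma>} = card inertia"
proof -
  have g: "\<sigma> \<in> G" using \<sigma> by (rule dec_G)
  have "bij_betw (\<lambda>\<delta>. \<sigma> \<circ> \<delta>) inertia {\<tau> \<in> dec. rep \<tau> = rep \<sigma>}"
  proof (rule bij_betwI[where g = "\<lambda>\<tau>. ginv \<sigma> \<circ> \<tau>"])
    show "(\<lambda>\<delta>. \<sigma> \<circ> \<delta>) \<in> inertia \<rightarrow> {\<tau> \<in> dec. rep \<tau> = rep \<sigma>}"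
    proof
      fix \<delta> assume \<delta>: "\<delta> \<in> inertia"
      then have d: "\<delta> \<in> dec" by (simp add: inertia_def)
      have "\<sigma> (\<delta> x) - \<sigma> x \<in> M" if "x \<in> S" for x
        using dec_cong[OF \<sigma> gal_S[OF dec_G[OF d] that] that] \<delta> that by (simp add: inertia_def cong_M_def)
      then have "cong_M (\<sigma> \<circ> \<delta>) \<sigma>" by (simp add: cong_M_def)
      then show "\<sigma> \<circ> \<delta> \<in> {\<tau> \<in> dec. rep \<tau> = rep \<sigma>}" using rep_eq_iff dec_comp \<sigma> d by simp
    qed
    show "(\<lambda>\<tau>. ginv \<sigma> \<circ> \<tau>) \<in> {\<tau> \<in> dec. rep \<tau> = rep \<sigma>} \<rightarrow> inertia"
    proof
      fix \<tau> assume \<tau>: "\<tau> \<in> {\<tau> \<in> dec. rep \<tau> = rep \<sigma>}"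
      then have d: "\<tau> \<in> dec" "cong_M \<tau> \<sigma>" using rep_eq_iff \<sigma> by auto
      have "ginv \<sigma> (\<tau> x) - x \<in> M" if "x \<in> S" for x
        using dec_cong[OF dec_ginv[OF \<sigma>] gal_S[OF dec_G[OF d(1)] that] gal_S[OF g that]] d(2) that
        by (simp add: cong_M_def ginv_left[OF g])
      then show "ginv \<sigma> \<circ> \<tau> \<in> inertia"
        using dec_comp[OF dec_ginv[OF \<sigma>] d(1)] by (simp add: inertia_def cong_M_def)
    qed
  qed (auto simp: fun_eq_iff ginv_left[OF g] ginv_right[OF g])
  then show ?thesis by (simp add: bij_betw_same_card)
qed

lemma card_dec: "card dec = card reps * card inertia"
  unfolding reps_def by (intro card_eq_image_times_fiber finite_dec card_class)

lemma reps_dec: "reps \<subseteq> dec" unfolding reps_def using rep by auto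

lemma finite_reps: "finite reps" using reps_dec finite_dec finite_subset by blast

lemma rep_rep: "\<sigma> \<in> reps \<Longrightarrow> rep \<sigma> = \<sigma>"
  unfolding reps_def using rep rep_eq_iff cong_M_sym by blast

lemma reps_incongruent:
  assumes "\<sigma> \<in> reps" "\<tau> \<in> reps" "\<sigma> \<noteq> \<tau>" shows "\<exists>x\<in>S. \<sigma> x - \<tau> x \<notin> M"
  using rep_eq_iff[of \<sigma> \<tau>] rep_rep assms reps_dec unfolding cong_M_def by (metis subsetD)

text \<open>Modulo \<open>M\<close> the trace of an element lying in all maximal ideals other than \<open>M\<close> is
  \<open>card inertia\<close> times its trace over the residue extension.\<close>

lemma exists_trace_notin:
  assumes t: "of_nat (card inertia) \<notin> M"
  shows "\<exists>s\<in>S. (\<forall>\<sigma>\<in>G - dec. \<sigma> s \<in> M) \<and> trace s \<notin> M"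
proof (rule ccontr)
  assume neg: "\<not> ?thesis"
  obtain \<epsilon> where \<epsilon>: "\<epsilon> \<in> S" "\<epsilon> - 1 \<in> M" "\<And>\<sigma>. \<sigma> \<in> G - dec \<Longrightarrow> \<sigma> \<epsilon> \<in> M"
    using exists_local_idempotent by blast
  have key: "(\<Sum>c\<in>reps. of_nat (card inertia) * c x) \<in> M" if x: "x \<in> S" for x
  proof -
    have x\<epsilon>: "x * \<epsilon> \<in> S" using x \<epsilon> by (intro M.mult_R)
    have out: "\<sigma> (x * \<epsilon>) \<in> M" if "\<sigma> \<in> G - dec" for \<sigma>
      using that \<epsilon>(3)[OF that] gal_S[of \<sigma> x] x by (auto simp: gal_hom intro: M.mult_I)
    then have "trace (x * \<epsilon>) \<in> M" using neg x\<epsilon> by blast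
    moreover have "trace (x * \<epsilon>) = (\<Sum>\<sigma>\<in>dec. \<sigma> (x * \<epsilon>)) + (\<Sum>\<sigma>\<in>G - dec. \<sigma> (x * \<epsilon>))"
      unfolding trace_def using dec_G finite_G by (subst sum.subset_diff[of dec]) auto
    moreover have "(\<Sum>\<sigma>\<in>G - dec. \<sigma> (x * \<epsilon>)) \<in> M" by (rule M.sum_I) (rule out)
    ultimately have "(\<Sum>\<sigma>\<in>dec. \<sigma> (x * \<epsilon>)) \<in> M" using M.diff_I by fastforce
    moreover have "x * (\<epsilon> - 1) \<in> M" using x \<epsilon> by (intro M.mult_I)
    then have "x * \<epsilon> - x \<in> M" by (simp add: algebra_simps)
    then have "(\<Sum>\<sigma>\<in>dec. \<sigma> (x * \<epsilon>)) - (\<Sum>\<sigma>\<in>dec. \<sigma> x) \<in> M"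
      by (intro M.cong_sum) (rule dec_cong[OF _ x\<epsilon> x])
    moreover have "(\<Sum>\<sigma>\<in>dec. \<sigma> x) - (\<Sum>\<sigma>\<in>dec. rep \<sigma> x) \<in> M"
      by (rule M.cong_sum) (use rep(2) x in \<open>auto simp: cong_M_def\<close>)
    moreover have "(\<Sum>\<sigma>\<in>dec. rep \<sigma> x) = (\<Sum>c\<in>reps. of_nat (card inertia) * c x)"
    proof -
      have "(\<Sum>\<sigma>\<in>dec. rep \<sigma> x) = (\<Sum>c\<in>reps. \<Sum>\<sigma>\<in>{\<sigma> \<in> dec. rep \<sigma> = c}. rep \<sigma> x)"
        unfolding reps_def by (rule sum.image_gen[OF finite_dec])
      also have "\<dots> = (\<Sum>c\<in>reps. of_nat (card {\<sigma> \<in> dec. rep \<sigma> = c}) * c x)"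
        by (intro sum.cong refl) simp
      also have "\<dots> = (\<Sum>c\<in>reps. of_nat (card inertia) * c x)"
        by (intro sum.cong refl) (auto simp: reps_def card_class)
      finally show ?thesis .
    qed
    ultimately show ?thesis using M.cong_iff by metis
  qed
  \<comment> \<open>The assumed vanishing of all traces is a relation between incongruent characters
    with constant coefficient \<open>card inertia\<close>.\<close>
  have "\<forall>c\<in>reps. of_nat (card inertia) \<in> M"
  proof (rule M.dedekind_independence[OF finite_reps _ _ _ reps_incongruent _ key])
    fix c assume "c \<in> reps"
    then have g: "c \<in> G" using reps_dec dec_G by auto
    show "c x \<in> S" if "x \<in> S" for x using that by (rule gal_S[OF g])
    show "c (x * y) = c x * c y" for x y by (rule gal_hom[OF g])
    show "c 1 = 1" by (rule gal_hom[OF g])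
  qed (auto simp: M.of_nat_R)
  moreover have "rep id \<in> reps" using dec_id by (simp add: reps_def)
  ultimately show False using t by blast
qed

text \<open>Nondegeneracy of the trace form modulo \<open>JS\<close>. If \<open>\<sigma> y\<close>
  is outside \<open>M\<close>, some multiple \<open>y * z\<close> is carried by
  \<open>\<sigma>\<close> to an element \<open>a\<close> that is 1 modulo \<open>M\<close>.
  Multiplying a test element \<open>s\<close> of nonzero trace, concentrated at \<open>M\<close>, by
  \<open>a\<close> does not change its trace modulo \<open>M\<close>, whereas \<open>a * s\<close>
  is conjugate to a multiple of \<open>y\<close>.\<close>

lemma trace_form_radical:
  assumes t: "of_nat (card inertia) \<notin> M"
    and y: "y \<in> S" "\<And>s. s \<in> S \<Longrightarrow> trace (s * y) \<in> M"
  shows "y \<in> JS"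
proof (rule ccontr)
  assume "y \<notin> JS"
  then obtain \<sigma> where \<sigma>: "\<sigma> \<in> G" "\<sigma> y \<notin> M" using y(1) by (auto simp: JS_def)
  obtain s where s: "s \<in> S" "\<And>\<sigma>. \<sigma> \<in> G - dec \<Longrightarrow> \<sigma> s \<in> M" "trace s \<notin> M"
    using exists_trace_notin[OF t] by blast
  obtain z where z: "z \<in> S" "\<sigma> (y * z - 1) \<in> M" using gal_inverse_mod[OF \<sigma>(1) y(1) \<sigma>(2)] by blast
  define a where "a = \<sigma> (y * z)"
  have a: "a \<in> S" "a - 1 \<in> M"
    unfolding a_def using z \<sigma> gal_S[OF \<sigma>(1) M.mult_R[OF y(1) z(1)]] by (auto simp: gal_diff gal_hom)
  \<comment> \<open>\<open>a\<close> is known to be 1 only at \<open>M\<close> itself; at the other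
    conjugates both terms vanish because \<open>s\<close> does.\<close>
  have "(\<Sum>\<tau>\<in>G. \<tau> (a * s)) - (\<Sum>\<tau>\<in>G. \<tau> s) \<in> M"
  proof (rule M.cong_sum)
    fix \<tau> assume \<tau>: "\<tau> \<in> G"
    have as: "a * s \<in> S" using a s by (intro M.mult_R)
    show "\<tau> (a * s) - \<tau> s \<in> M"
    proof (cases "\<tau> \<in> dec")
      case True
      have "(a - 1) * s \<in> M" using a s by (intro M.mult_I2)
      then have "a * s - s \<in> M" by (simp add: algebra_simps)
      then show ?thesis by (rule dec_cong[OF True as s(1)])
    next
      case False
      then have "\<tau> s \<in> M" using s(2) \<tau> by auto
      then show ?thesis using gal_S[OF \<tau> a(1)] \<tau> by (auto simp: gal_hom intro: M.diff_I M.mult_I)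
    qed
  qed
  moreover have "(\<Sum>\<tau>\<in>G. \<tau> (a * s)) \<in> M"
  proof -
    \<comment> \<open>Traces are invariant under \<open>\<sigma>\<close>, so the hypothesis on
      multiples of \<open>y\<close> applies to \<open>a * s\<close>.\<close>
    have "a * s = \<sigma> ((z * ginv \<sigma> s) * y)" using \<sigma> by (simp add: a_def gal_hom ginv_right mult_ac)
    then have "(\<Sum>\<tau>\<in>G. \<tau> (a * s)) = (\<Sum>\<tau>\<in>G. (\<tau> \<circ> \<sigma>) ((z * ginv \<sigma> s) * y))" by simp
    also have "bij_betw (\<lambda>\<tau>. \<tau> \<circ> \<sigma>) G G"
      using \<sigma>(1) by (intro bij_betwI[where g = "\<lambda>\<tau>. \<tau> \<circ> ginv \<sigma>"])
        (auto simp: gal_comp ginv_gal fun_eq_iff ginv_left ginv_right)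
    then have "(\<Sum>\<tau>\<in>G. (\<tau> \<circ> \<sigma>) ((z * ginv \<sigma> s) * y)) = (\<Sum>\<tau>\<in>G. \<tau> ((z * ginv \<sigma> s) * y))"
      by (rule sum.reindex_bij_betw)
    also have "\<dots> \<in> M"
      using y(2)[of "z * ginv \<sigma> s"] z s gal_S[OF ginv_gal[OF \<sigma>(1)]] by (simp add: trace_def M.mult_R)
    finally show ?thesis .
  qed
  ultimately show False using s(3) M.cong_iff unfolding trace_def by blast
qed

end

subsection \<open>The residue extension\<close>

context valued_galois_max
begin

section \<open>The localization at \<open>M\<close> and its residue field\<close>

abbreviation "W \<equiv> localization S M"

definition mW :: "'k set" where "mW = {a / b | a b. a \<in> M \<and> b \<in> S \<and> b \<notin> M}"

lemma notin_M_nonzero: "b \<notin> M \<Longrightarrow> b \<noteq> 0"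
  using M.zero_I by auto

lemma notin_M_mult: "b \<in> S \<Longrightarrow> d \<in> S \<Longrightarrow> b \<notin> M \<Longrightarrow> d \<notin> M \<Longrightarrow> b * d \<notin> M"
  using M.prime by blast

lemma S_W: "x \<in> S \<Longrightarrow> x \<in> W"
  unfolding localization_def using M.one_R M.one_notin by force

lemma M_mW: "x \<in> M \<Longrightarrow> x \<in> mW"
  unfolding mW_def using M.one_R M.one_notin by force

lemma mW_S: "x \<in> S \<Longrightarrow> x \<in> mW \<Longrightarrow> x \<in> M"
proof -
  assume x: "x \<in> S" "x \<in> mW"
  then obtain a b where ab: "x = a / b" "a \<in> M" "b \<in> S" "b \<notin> M" unfolding mW_def by blast
  then have "x * b = a" using notin_M_nonzero by simp
  then show ?thesis using M.prime[of x b] ab x by auto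
qed

lemma W_ideal_pair: "ideal_pair W mW"
proof
  show "1 \<in> W" using M.one_R by (rule S_W)
  show "0 \<in> mW" using M.zero_I by (rule M_mW)
  show "mW \<subseteq> W" unfolding mW_def localization_def using M.in_R by blast
  show "x - y \<in> W" if xy: "x \<in> W" "y \<in> W" for x y
  proof -
    obtain a b c d where *: "x = a / b" "y = c / d" "a \<in> S" "b \<in> S" "b \<notin> M" "c \<in> S" "d \<in> S" "d \<notin> M"
      using xy unfolding localization_def by blast
    then have "x - y = (a * d - c * b) / (b * d)" by (simp add: diff_frac_eq notin_M_nonzero)
    moreover have "a * d - c * b \<in> S" "b * d \<in> S" "b * d \<notin> M"
      using * notin_M_mult by (auto intro: M.diff_R M.mult_R)
    ultimately show ?thesis unfolding localization_def by blast
  qed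
  show "x - y \<in> mW" if xy: "x \<in> mW" "y \<in> mW" for x y
  proof -
    obtain a b c d where *: "x = a / b" "y = c / d" "a \<in> M" "b \<in> S" "b \<notin> M" "c \<in> M" "d \<in> S" "d \<notin> M"
      using xy unfolding mW_def by blast
    then have "x - y = (a * d - c * b) / (b * d)" by (simp add: diff_frac_eq notin_M_nonzero)
    moreover have "a * d - c * b \<in> M" "b * d \<in> S" "b * d \<notin> M"
      using * notin_M_mult by (auto intro: M.diff_I M.mult_R M.mult_I2)
    ultimately show ?thesis unfolding mW_def by blast
  qed
  show "x * y \<in> W" if xy: "x \<in> W" "y \<in> W" for x y
  proof -
    obtain a b c d where *: "x = a / b" "y = c / d" "a \<in> S" "b \<in> S" "b \<notin> M" "c \<in> S" "d \<in> S" "d \<notin> M"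
      using xy unfolding localization_def by blast
    then have "x * y = (a * c) / (b * d)" by simp
    moreover have "a * c \<in> S" "b * d \<in> S" "b * d \<notin> M"
      using * notin_M_mult by (auto intro: M.mult_R)
    ultimately show ?thesis unfolding localization_def by blast
  qed
  show "x * y \<in> mW" if xy: "x \<in> W" "y \<in> mW" for x y
  proof -
    obtain a b where *: "x = a / b" "a \<in> S" "b \<in> S" "b \<notin> M"
      using xy unfolding localization_def by blast
    obtain c d where **: "y = c / d" "c \<in> M" "d \<in> S" "d \<notin> M"
      using xy unfolding mW_def by blast
    have "x * y = (a * c) / (b * d)" using * ** by simp
    moreover have "a * c \<in> M" "b * d \<in> S" "b * d \<notin> M"
      using * ** notin_M_mult by (auto intro: M.mult_R M.mult_I)
    ultimately show ?thesis unfolding mW_def by blast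
  qed
qed

lemma local_max_ideal_W: "local_max_ideal W = mW"
proof
  interpret W: ideal_pair W mW by (rule W_ideal_pair)
  show "local_max_ideal W \<subseteq> mW"
  proof
    fix x assume x: "x \<in> local_max_ideal W"
    then obtain a b where ab: "x = a / b" "a \<in> S" "b \<in> S" "b \<notin> M"
      unfolding local_max_ideal_def localization_def by blast
    have "a \<in> M"
    proof (rule ccontr)
      assume a: "a \<notin> M"
      then have "inverse x = b / a" "x \<noteq> 0" using ab notin_M_nonzero by auto
      moreover from this have "inverse x \<in> W" using ab a unfolding localization_def by blast
      ultimately show False using x unfolding local_max_ideal_def units_of_sr_def by simp
    qed
    then show "x \<in> mW" using ab unfolding mW_def by blast
  qed
  show "mW \<subseteq> local_max_ideal W"
  proof
    fix x assume x: "x \<in> mW"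
    have "False" if "x \<noteq> 0" "inverse x \<in> W"
      using W.mult_I2[OF x that(2)] that(1) mW_S[OF M.one_R] M.one_notin by simp
    then show "x \<in> local_max_ideal W"
      using W.in_R[OF x] unfolding local_max_ideal_def units_of_sr_def by auto
  qed
qed

text \<open>A fraction \<open>a / c\<close> has the same residue as \<open>a * z\<close> with
  \<open>z\<close> inverse to \<open>c\<close> modulo \<open>M\<close>, and \<open>mW\<close> meets
  \<open>S\<close> in \<open>M\<close>. The hypotheses on \<open>W\<close> thus become congruences
  in \<open>S\<close>, where the Galois group acts.\<close>

lemma residue_basis_in_S:
  assumes "residue_degree V W n"
  shows "\<exists>b. (\<forall>i<n. b i \<in> S) \<and>
    (\<forall>c. (\<forall>i<n. c i \<in> V) \<longrightarrow> (\<Sum>i<n. c i * b i) \<in> M \<longrightarrow> (\<forall>i<n. c i \<in> mV)) \<and>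
    (\<forall>y\<in>S. \<exists>c. (\<forall>i<n. c i \<in> V) \<and> y - (\<Sum>i<n. c i * b i) \<in> M)"
proof -
  interpret W: ideal_pair W mW by (rule W_ideal_pair)
  obtain b where b: "\<And>i. i < n \<Longrightarrow> b i \<in> W"
    "\<And>c. (\<forall>i<n. c i \<in> V) \<Longrightarrow> (\<Sum>i<n. c i * b i) \<in> mW \<Longrightarrow> \<forall>i<n. c i \<in> mV"
    "\<And>y. y \<in> W \<Longrightarrow> \<exists>c. (\<forall>i<n. c i \<in> V) \<and> y - (\<Sum>i<n. c i * b i) \<in> mW"
    using assms unfolding residue_degree_def local_max_ideal_W by blast
  have "\<exists>s\<in>S. x - s \<in> mW" if x: "x \<in> W" for x
  proof -
    obtain a c where ac: "x = a / c" "a \<in> S" "c \<in> S" "c \<notin> M"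
      using x unfolding localization_def by blast
    obtain z where z: "z \<in> S" "c * z - 1 \<in> M" using M.inverse_mod ac by blast
    have "x - a * z = (- (a * (c * z - 1))) / c"
      using ac notin_M_nonzero by (simp add: field_simps)
    moreover have "- (a * (c * z - 1)) \<in> M" using ac z by (intro M.uminus_I M.mult_I)
    ultimately have "x - a * z \<in> mW" unfolding mW_def using ac by blast
    then show ?thesis using ac z M.mult_R by blast
  qed
  then have "\<forall>i. \<exists>s. i < n \<longrightarrow> s \<in> S \<and> b i - s \<in> mW" using b(1) by blast
  then obtain s where s: "\<And>i. i < n \<Longrightarrow> s i \<in> S \<and> b i - s i \<in> mW" by metis
  have VW: "v \<in> W" if "v \<in> V" for v using that VS S_W by auto
  have sum_cong: "(\<Sum>i<n. c i * b i) - (\<Sum>i<n. c i * s i) \<in> mW" if "\<forall>i<n. c i \<in> V" for c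
    using that s VW S_W by (intro W.cong_sum W.cong_mult) (auto simp: W.zero_I)
  have sum_S: "(\<Sum>i<n. c i * s i) \<in> S" if "\<forall>i<n. c i \<in> V" for c
    using that s VS by (intro M.sum_R M.mult_R) auto
  show ?thesis
  proof (rule exI[of _ s], intro conjI allI impI ballI)
    show "\<And>i. i < n \<Longrightarrow> s i \<in> S" using s by simp
    show "c i \<in> mV" if c: "\<forall>i<n. c i \<in> V" "(\<Sum>i<n. c i * s i) \<in> M" and "i < n" for c i
      using \<open>i < n\<close> b(2)[OF c(1)] W.cong_iff[OF sum_cong[OF c(1)]] M_mW[OF c(2)] by blast
    show "\<exists>c. (\<forall>i<n. c i \<in> V) \<and> y - (\<Sum>i<n. c i * s i) \<in> M" if y: "y \<in> S" for y
    proof -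
      obtain c where c: "\<forall>i<n. c i \<in> V" "y - (\<Sum>i<n. c i * b i) \<in> mW" using b(3) S_W[OF y] by blast
      have "y - (\<Sum>i<n. c i * s i) \<in> mW" using W.cong_trans[OF c(2) sum_cong[OF c(1)]] .
      then show ?thesis using c(1) mW_S[OF M.diff_R[OF y sum_S[OF c(1)]]] by blast
    qed
  qed
qed

text \<open>The sum over the maximal ideals \<open>N\<close> of \<open>\<epsilon> * x\<close> moved
  from \<open>M\<close> to \<open>N\<close>. Under \<open>\<sigma>\<close> only the summand at
  \<open>conj_max \<sigma>\<close> survives modulo \<open>M\<close>. The choice of the moving
  automorphism is immaterial there, since \<open>dec\<close> fixes the residue of
  \<open>x\<close>.\<close>

lemma exists_simultaneous_lift:
  assumes x: "x \<in> S" "\<forall>\<delta>\<in>dec. \<delta> x - x \<in> M"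
  shows "\<exists>a\<in>S. \<forall>\<sigma>\<in>G. \<sigma> a - x \<in> M"
proof -
  obtain \<epsilon> where \<epsilon>: "\<epsilon> \<in> S" "\<epsilon> - 1 \<in> M" "\<And>\<sigma>. \<sigma> \<in> G - dec \<Longrightarrow> \<sigma> \<epsilon> \<in> M"
    using exists_local_idempotent by blast
  have "\<forall>N\<in>conj_max ` G. \<exists>\<rho>\<in>G. conj_max \<rho> = N" by blast
  then obtain \<rho> where \<rho>: "\<And>N. N \<in> conj_max ` G \<Longrightarrow> \<rho> N \<in> G \<and> conj_max (\<rho> N) = N" by metis
  have x\<epsilon>: "\<epsilon> * x \<in> S" using x \<epsilon> by (intro M.mult_R)
  define a where "a = (\<Sum>N\<in>conj_max ` G. ginv (\<rho> N) (\<epsilon> * x))"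
  have "a \<in> S" unfolding a_def by (rule M.sum_R) (use \<rho> gal_S[OF ginv_gal x\<epsilon>] in auto)
  moreover have "\<sigma> a - x \<in> M" if \<sigma>: "\<sigma> \<in> G" for \<sigma>
  proof -
    let ?N = "conj_max \<sigma>"
    have N: "?N \<in> conj_max ` G" using \<sigma> by blast
    have "\<sigma> a = (\<Sum>N\<in>conj_max ` G. \<sigma> (ginv (\<rho> N) (\<epsilon> * x)))" unfolding a_def using \<sigma> by (rule gal_sum)
    also have "\<dots> = \<sigma> (ginv (\<rho> ?N) (\<epsilon> * x)) + (\<Sum>N\<in>conj_max ` G - {?N}. \<sigma> (ginv (\<rho> N) (\<epsilon> * x)))"
      using finite_G N by (intro sum.remove) auto
    finally have eq: "\<sigma> a - x = (\<sigma> (ginv (\<rho> ?N) (\<epsilon> * x)) - x) + (\<Sum>N\<in>conj_max ` G - {?N}. \<sigma> (ginv (\<rho> N) (\<epsilon> * x)))"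
      by simp
    \<comment> \<open>\<open>\<sigma>\<close> and the chosen \<open>\<rho> ?N\<close> have the same
      preimage of \<open>M\<close>, so they differ by an element of the decomposition group.\<close>
    have d: "\<sigma> \<circ> ginv (\<rho> ?N) \<in> dec" using conj_max_eq_iff[of "\<rho> ?N" \<sigma>] \<rho>[OF N] \<sigma> by simp
    have "(\<epsilon> - 1) * x \<in> M" using x \<epsilon> by (intro M.mult_I2)
    then have "\<epsilon> * x - x \<in> M" by (simp add: algebra_simps)
    then have "(\<sigma> \<circ> ginv (\<rho> ?N)) (\<epsilon> * x) - (\<sigma> \<circ> ginv (\<rho> ?N)) x \<in> M" by (rule dec_cong[OF d x\<epsilon> x(1)])
    then have 1: "\<sigma> (ginv (\<rho> ?N) (\<epsilon> * x)) - x \<in> M" using M.cong_trans[OF _ bspec[OF x(2) d]] by simp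
    have "\<sigma> (ginv (\<rho> N) (\<epsilon> * x)) \<in> M" if N': "N \<in> conj_max ` G - {?N}" for N
    proof -
      have \<rho>N: "\<rho> N \<in> G" "conj_max (\<rho> N) \<noteq> conj_max \<sigma>" using \<rho>[of N] N' by auto
      have g: "\<sigma> \<circ> ginv (\<rho> N) \<in> G" using \<sigma> \<rho>N by (intro gal_comp ginv_gal)
      have "\<sigma> \<circ> ginv (\<rho> N) \<notin> dec" using conj_max_eq_iff[OF \<rho>N(1) \<sigma>] \<rho>N(2) by simp
      then have "(\<sigma> \<circ> ginv (\<rho> N)) \<epsilon> \<in> M" using \<epsilon>(3) g by blast
      then have "(\<sigma> \<circ> ginv (\<rho> N)) (\<epsilon> * x) \<in> M"
        using gal_hom(2)[OF g, of \<epsilon> x] M.mult_I2[OF _ gal_S[OF g x(1)]] by simp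
      then show ?thesis by simp
    qed
    then have "(\<Sum>N\<in>conj_max ` G - {?N}. \<sigma> (ginv (\<rho> N) (\<epsilon> * x))) \<in> M" by (rule M.sum_I)
    with 1 show ?thesis unfolding eq by (rule M.add_I)
  qed
  ultimately show ?thesis by blast
qed

lemma pcompose_linear_power: "pcompose ([:- x, 1:] ^ n) [:x, 1:] = monom (1::'k) n"
proof (induction n)
  case (Suc n)
  have "pcompose [:- x, 1:] [:x, 1:] = [:0, 1:]" by (simp add: pcompose_pCons)
  then show ?case using Suc by (simp only: power_Suc pcompose_mult) (simp add: monom_Suc)
qed simp

lemma pcompose_monom_linear: "pcompose (monom (1::'k) n) [:- x, 1:] = [:- x, 1:] ^ n"
  by (induction n) (auto simp: monom_Suc pcompose_pCons)

text \<open>A unit leading coefficient could be scaled to 1, against the minimality of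
  \<open>d\<close>; so it lies in \<open>mV\<close>, and removing the leading term leaves a
  polynomial of the same kind.\<close>

lemma minimal_poly_remainder:
  assumes x: "x \<in> S"
    and min: "\<And>p. p \<in> polys_over V \<Longrightarrow> lead_coeff p = 1 \<Longrightarrow> poly p x \<in> M \<Longrightarrow> d \<le> degree p"
    and r: "r \<in> polys_over V" "degree r < d" "poly r x \<in> M"
  shows "r \<in> polys_over mV"
  using r
proof (induction r rule: measure_induct_rule[of degree])
  case (less r)
  interpret P: ideal_pair "polys_over V" "polys_over mV" by (rule V.ideal_pair_polys)
  let ?l = "lead_coeff r"
  have lV: "?l \<in> V" using less.prems by (auto simp: polys_over_def)
  have l: "?l \<in> mV"
  proof (rule ccontr)
    assume "?l \<notin> mV"
    then obtain u where u: "u \<in> V" "?l * u = 1" using V_unit_iff[OF lV] by blast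
    let ?p = "Polynomial.smult u r"
    have "u \<noteq> 0" using u(2) by (metis mult_zero_right zero_neq_one)
    have "?p \<in> polys_over V" using u less.prems by (auto simp: polys_over_def V.mult_R)
    moreover have "lead_coeff ?p = 1" using u \<open>u \<noteq> 0\<close> by (simp add: mult.commute)
    moreover have "poly ?p x \<in> M" using less.prems(3) u(1) VS by (auto intro: M.mult_I)
    ultimately have "d \<le> degree ?p" by (rule min)
    then show False using less.prems(2) \<open>u \<noteq> 0\<close> by simp
  qed
  have ml: "monom ?l (degree r) \<in> polys_over mV" using l V.zero_I by (auto simp: polys_over_def)
  show ?case
  proof (cases "degree r = 0")
    case True
    then have "r = monom ?l (degree r)" by (auto elim!: degree_eq_zeroE simp: monom_0)
    then show ?thesis using ml by simp
  next
    case False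
    let ?r = "r - monom ?l (degree r)"
    have "degree ?r \<le> degree r" by (intro degree_diff_le degree_monom_le order_refl)
    moreover have "coeff ?r (degree r) = 0" by simp
    ultimately have dr: "degree ?r < degree r" using False
      by (metis degree_0 le_neq_implies_less leading_coeff_0_iff not_gr_zero)
    have "?r \<in> polys_over V" using less.prems(1) P.in_R[OF ml] by (rule P.diff_R)
    moreover have "poly ?r x \<in> M"
      using less.prems(3) l mV_M M.power_R[OF x]
      by (auto simp: poly_monom intro!: M.diff_I M.mult_I2)
    ultimately have "?r \<in> polys_over mV" using less.IH[OF dr] dr less.prems(2) by auto
    then have "?r + monom ?l (degree r) \<in> polys_over mV" using ml by (rule P.add_I)
    then show ?thesis by simp
  qed
qed

text \<open>A residue fixed by \<open>dec\<close> comes from \<open>V\<close>. The lift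
  \<open>a\<close> of \<open>x\<close> has all conjugates congruent to \<open>x\<close>, so its
  characteristic polynomial over \<open>V\<close> is \<open>[:- x, 1:] ^ n\<close> modulo
  \<open>M\<close>; the minimal polynomial of the residue divides it and is
  \<open>[:- x, 1:] ^ i\<close>. Separability makes \<open>i\<close> invertible, and then the
  subleading coefficient, an element of \<open>V\<close>, determines \<open>x\<close> modulo
  \<open>M\<close>.\<close>

lemma separable_fixed_residue:
  assumes sep: "residue_separable V W"
    and x: "x \<in> S" "\<forall>\<delta>\<in>dec. \<delta> x - x \<in> M"
  shows "\<exists>v\<in>V. x - v \<in> M"
proof -
  interpret PV: ideal_pair "polys_over V" "polys_over mV" by (rule V.ideal_pair_polys)
  interpret PS: ideal_pair "polys_over S" "polys_over M" by (rule M.ideal_pair_polys)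
  have VSp: "p \<in> polys_over S" if "p \<in> polys_over V" for p using that VS by (auto simp: polys_over_def)
  have mVMp: "p \<in> polys_over M" if "p \<in> polys_over mV" for p using that mV_M by (auto simp: polys_over_def)
  have lin: "[:- x, 1:] \<in> polys_over S" "[:x, 1:] \<in> polys_over S"
    using x(1) by (auto intro!: M.pCons_polys M.zero_polys M.one_R M.uminus_R)
  obtain q where q: "residue_irreducible V q" "poly q x \<in> mW" "\<exists>i. coeff (pderiv q) i \<notin> mV"
    using sep S_W[OF x(1)] unfolding residue_separable_def local_max_ideal_W by blast
  have q1: "lead_coeff q = 1" "q \<in> polys_over V" using q(1) by (auto simp: residue_irreducible_def polys_over_def)
  have qx: "poly q x \<in> M" using q(2) M.poly_R[OF VSp[OF q1(2)] x(1)] mW_S by blast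
  let ?Q = "\<lambda>p. p \<in> polys_over V \<and> lead_coeff p = 1 \<and> poly p x \<in> M"
  obtain g where g: "?Q g" "\<And>p. ?Q p \<Longrightarrow> degree g \<le> degree p"
    using ex_has_least_nat[of ?Q q degree] q1 qx by blast
  have dg: "degree g \<ge> 1"
  proof (rule ccontr)
    assume "\<not> ?thesis"
    then have "degree g = 0" by simp
    then have "poly g x = 1" using g(1) by (auto elim!: degree_eq_zeroE)
    then show False using g(1) M.one_notin by simp
  qed
  have rem: "r \<in> polys_over mV" if "r \<in> polys_over V" "degree r < degree g" "poly r x \<in> M" for r
    using minimal_poly_remainder[OF x(1) _ that] g(2) by blast
  have remM: "poly r x \<in> M" if "p = g * h + r" "h \<in> polys_over V" "poly p x \<in> M" for p h r
  proof -
    have "poly g x * poly h x \<in> M" using g(1) M.poly_R[OF VSp[OF that(2)] x(1)] by (intro M.mult_I2) auto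
    then have "poly p x - poly g x * poly h x \<in> M" using that(3) by (intro M.diff_I)
    then show ?thesis using that(1) by simp
  qed
  \<comment> \<open>\<open>q\<close> is \<open>g * h\<close> modulo \<open>mV\<close> with
    \<open>h\<close> monic, so residue irreducibility of \<open>q\<close> forces
    \<open>h = 1\<close>.\<close>
  have qg: "q - g \<in> polys_over mV"
  proof -
    obtain h r where hr: "h \<in> polys_over V" "r \<in> polys_over V" "q = g * h + r" "degree r < degree g"
      using V.monic_division[of g q] g(1) dg q1 by blast
    have r: "r \<in> polys_over mV" using rem hr remM[OF hr(3,1) qx] by blast
    have "degree r < degree q" using g(2)[of q] q1 qx hr(4) by simp
    moreover have "g * h = q - r" using hr(3) by simp
    ultimately have "degree (g * h) = degree q" "coeff (g * h) (degree q) = 1"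
      using q1(1) by (simp_all add: coeff_eq_0 degree_add_eq_left[of "- r" q, simplified])
    then have "lead_coeff (g * h) = 1" by simp
    then have lh: "lead_coeff h = 1" using g(1) by (simp add: lead_coeff_mult)
    have "degree h = 0"
    proof (rule ccontr)
      assume "degree h \<noteq> 0"
      then have "\<exists>q' r'. lead_coeff q' = 1 \<and> lead_coeff r' = 1 \<and> (\<forall>i. coeff q' i \<in> V) \<and>
           (\<forall>i. coeff r' i \<in> V) \<and> degree q' \<ge> 1 \<and> degree r' \<ge> 1 \<and>
           (\<forall>i. coeff (q - q' * r') i \<in> mV)"
        using g(1) dg lh hr(1,3) r by (intro exI[of _ g] exI[of _ h]) (auto simp: polys_over_def)
      then show False using q(1) unfolding residue_irreducible_def by blast
    qed
    then have "h = 1" using lh by (auto elim!: degree_eq_zeroE simp: one_pCons)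
    then show ?thesis using hr(3) r by simp
  qed
  obtain a where a: "a \<in> S" "\<And>\<sigma>. \<sigma> \<in> G \<Longrightarrow> \<sigma> a - x \<in> M" using exists_simultaneous_lift[OF x] by blast
  define n where "n = card G"
  have n: "n > 0" unfolding n_def using finite_G gal_id by (auto simp: card_gt_0_iff)
  have P: "gal_poly a - [:- x, 1:] ^ n \<in> polys_over M"
  proof -
    have "gal_poly a - (\<Prod>\<sigma>\<in>G. [:- x, 1:]) \<in> polys_over M"
      unfolding gal_poly_def
    proof (rule PS.cong_prod)
      fix \<sigma> assume \<sigma>: "\<sigma> \<in> G"
      show "[:- \<sigma> a, 1:] - [:- x, 1:] \<in> polys_over M"
        using M.cong_sym[OF a(2)[OF \<sigma>]] by (auto simp: polys_over_def coeff_pCons M.zero_I split: nat.split)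
      show "[:- \<sigma> a, 1:] \<in> polys_over S"
        using gal_S[OF \<sigma> a(1)] by (intro M.pCons_polys M.zero_polys M.one_R M.uminus_R)
    qed (rule lin)
    then show ?thesis by (simp add: n_def)
  qed
  have "poly (gal_poly a - [:- x, 1:] ^ n) x \<in> M" using M.poly_I[OF P x(1)] .
  then have Px: "poly (gal_poly a) x \<in> M" using n by (simp add: power_0_left)
  obtain h r where hr: "h \<in> polys_over V" "r \<in> polys_over V" "gal_poly a = g * h + r" "degree r < degree g"
    using V.monic_division[of g "gal_poly a"] g(1) dg gal_poly_V[OF a(1)] by blast
  have r: "r \<in> polys_over mV" using rem hr remM[OF hr(3,1) Px] by blast
  have "(gal_poly a - [:- x, 1:] ^ n) - r \<in> polys_over M" using P mVMp[OF r] by (rule PS.diff_I)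
  then have "g * h - [:- x, 1:] ^ n \<in> polys_over M" using hr(3) by simp
  \<comment> \<open>Shifting the variable by \<open>x\<close> turns the power of
    \<open>[:- x, 1:]\<close> into a monomial, whose monic factors are monomials modulo
    \<open>M\<close>; the shift is undone afterwards.\<close>
  from M.pcompose_polys_I[OF this lin(2)]
  have 1: "pcompose g [:x, 1:] * pcompose h [:x, 1:] - monom 1 n \<in> polys_over M"
    by (simp only: pcompose_diff pcompose_mult pcompose_linear_power)
  define i where "i = degree g"
  have "lead_coeff (pcompose g [:x, 1:]) = 1" "degree (pcompose g [:x, 1:]) = i"
    using g(1) lead_coeff_comp[of "[:x, 1:]" g] by (simp_all add: i_def)
  then have "pcompose g [:x, 1:] - monom 1 i \<in> polys_over M"
    using M.monic_factor_of_monom_mod[OF _ _ _ 1] M.pcompose_polys[OF VSp lin(2)] g(1) hr(1) by auto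
  from M.pcompose_polys_I[OF this lin(1)]
  have "pcompose g (pcompose [:x, 1:] [:- x, 1:]) - [:- x, 1:] ^ i \<in> polys_over M"
    by (simp only: pcompose_diff pcompose_monom_linear pcompose_assoc)
  then have "g - [:- x, 1:] ^ i \<in> polys_over M" by (simp add: pcompose_pCons pcompose_idR)
  from PS.add_I[OF mVMp[OF qg] this]
  have qi: "q - [:- x, 1:] ^ i \<in> polys_over M" by simp
  obtain k where k: "i = Suc k" using dg by (cases i) (auto simp: i_def)
  \<comment> \<open>Otherwise the derivative of \<open>[:- x, 1:] ^ i\<close>, and with it that of
    \<open>q\<close>, would vanish modulo \<open>M\<close>.\<close>
  have iM: "of_nat i \<notin> M"
  proof
    assume i: "of_nat i \<in> M"
    obtain j where j: "coeff (pderiv q) j \<notin> mV" using q(3) by blast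
    have "coeff (pderiv q) j \<in> V"
      using q1(2) by (auto simp: coeff_pderiv polys_over_def simp del: of_nat_Suc intro: V.mult_R V.of_nat_R)
    then have jM: "coeff (pderiv q) j \<notin> M" using j V_M_iff by simp
    have "pderiv ([:- x, 1:] ^ i) = Polynomial.smult (of_nat i) ([:- x, 1:] ^ k)"
      unfolding k pderiv_power_Suc by (simp add: pderiv_pCons)
    then have 2: "coeff (pderiv ([:- x, 1:] ^ i)) j \<in> M"
      using i PS.power_R[OF lin(1), of k] by (auto simp: polys_over_def intro: M.mult_I2)
    have "coeff (pderiv (q - [:- x, 1:] ^ i)) j \<in> M"
      using qi by (auto simp: coeff_pderiv polys_over_def simp del: of_nat_Suc coeff_diff intro: M.mult_I M.of_nat_R)
    then have "coeff (pderiv q) j - coeff (pderiv ([:- x, 1:] ^ i)) j \<in> M" by (simp add: pderiv_diff)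
    then show False using 2 jM M.cong_iff by blast
  qed
  then have "of_nat i \<notin> mV" using mV_M by blast
  then obtain u where u: "u \<in> V" "of_nat i * u = 1" using V_unit_iff[OF V.of_nat_R] by blast
  \<comment> \<open>With \<open>i = Suc k\<close> this is the subleading coefficient, congruent to
    \<open>- of_nat i * x\<close>.\<close>
  define w where "w = coeff q k"
  have w: "w \<in> V" using q1(2) by (auto simp: w_def polys_over_def)
  have "coeff (q - [:- x, 1:] ^ i) k \<in> M" using qi by (auto simp: polys_over_def)
  then have "w + of_nat i * x \<in> M"
    using coeff_linear_power_pred[of "- x" k] by (simp add: w_def k)
  then have "u * (w + of_nat i * x) \<in> M" using u(1) VS by (intro M.mult_I) auto
  moreover have "u * (w + of_nat i * x) = (of_nat i * u) * x - (- (u * w))"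
    by (simp add: algebra_simps)
  then have "u * (w + of_nat i * x) = x - (- (u * w))" unfolding u(2) by simp
  ultimately have "x - (- (u * w)) \<in> M" by simp
  moreover have "- (u * w) \<in> V" using u(1) w by (intro V.uminus_R V.mult_R)
  ultimately show ?thesis by blast
qed

text \<open>The two counting lemmas, applied to \<open>dec\<close> acting on \<open>S / M\<close>,
  give \<open>card reps = n\<close>; separability provides that residues fixed by \<open>dec\<close>
  come from \<open>V\<close>. The assumed degree \<open>e * n * num_max_ideals S\<close> equals
  \<open>card G\<close>, which is \<open>num_max_ideals S * card reps * card inertia\<close>, and
  cancellation leaves \<open>e\<close>.\<close>

lemma card_inertia:
  assumes sep: "residue_separable V W" and rd: "residue_degree V W n"
    and fd: "field_degree F (e * n * num_max_ideals S)"
  shows "card inertia = e"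
proof -
  obtain b where b0: "\<forall>i<n. b i \<in> S"
    "\<forall>c. (\<forall>i<n. c i \<in> V) \<longrightarrow> (\<Sum>i<n. c i * b i) \<in> M \<longrightarrow> (\<forall>i<n. c i \<in> mV)"
    "\<forall>y\<in>S. \<exists>c. (\<forall>i<n. c i \<in> V) \<and> y - (\<Sum>i<n. c i * b i) \<in> M"
    using residue_basis_in_S[OF rd] by auto
  note b = b0(1)[rule_format] b0(2) b0(3)[rule_format]
  have rG: "c \<in> G" if "c \<in> reps" for c using that reps_dec dec_G by blast
  have Vfix: "c v - v \<in> M" if "c \<in> G" "v \<in> V" for c v
    using gal_fix[OF that(1)] that(2) VF M.zero_I by auto
  have decM: "c x \<in> M" if "c \<in> dec" "x \<in> M" for c x using dec_M_iff[OF that(1) M.in_R[OF that(2)]] that(2) by simp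
  have "card reps \<le> n"
  proof (rule M.card_incongruent_le[OF finite_reps, of V n b])
    show "\<exists>x\<in>S. c x - d x \<notin> M" if "c \<in> reps" "d \<in> reps" "c \<noteq> d" for c d
      using that by (rule reps_incongruent)
    show "c x \<in> S" if "c \<in> reps" "x \<in> S" for c x using gal_S[OF rG[OF that(1)] that(2)] .
    show "c (x * y) = c x * c y" "c (x + y) = c x + c y" "c 1 = 1" if "c \<in> reps" for c x y
      using gal_hom[OF rG[OF that]] by auto
    show "c x \<in> M" if "c \<in> reps" "x \<in> M" for c x using decM that reps_dec by blast
    show "c v - v \<in> M" if "c \<in> reps" "v \<in> V" for c v using Vfix[OF rG[OF that(1)] that(2)] .
    show "\<exists>v. (\<forall>i<n. v i \<in> V) \<and> y - (\<Sum>i<n. v i * b i) \<in> M" if "y \<in> S" for y using b(3)[OF that] .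
  qed (use VS b(1) in auto)
  moreover have "n \<le> card reps"
  proof (rule M.card_representatives_ge[OF finite_dec, of reps V n b])
    show "\<exists>x\<in>S. c x - d x \<notin> M" if "c \<in> reps" "d \<in> reps" "c \<noteq> d" for c d
      using that by (rule reps_incongruent)
    show "c x \<in> S" if "c \<in> dec" "x \<in> S" for c x using gal_S[OF dec_G[OF that(1)] that(2)] .
    show "c (x * y) = c x * c y" "c (x + y) = c x + c y" "c 1 = 1" if "c \<in> dec" for c x y
      using gal_hom[OF dec_G[OF that]] by auto
    show "c x \<in> M" if "c \<in> dec" "x \<in> M" for c x using decM[OF that] .
    show "c \<circ> d \<in> dec" if "c \<in> dec" "d \<in> dec" for c d using that by (rule dec_comp)
    show "\<exists>d\<in>dec. c \<circ> d = id \<and> d \<circ> c = id" if "c \<in> dec" for c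
      using dec_ginv[OF that] ginv_comp[OF dec_G[OF that]] by blast
    show "reps \<noteq> {}" using dec_id by (auto simp: reps_def)
    show "\<exists>c\<in>reps. \<forall>x\<in>S. d x - c x \<in> M" if "d \<in> dec" for d
      using rep(2)[OF that] that by (auto simp: reps_def cong_M_def)
    show "\<exists>v\<in>V. x - v \<in> M" if "x \<in> S" "\<And>d. d \<in> dec \<Longrightarrow> d x - x \<in> M" for x
      using separable_fixed_residue[OF sep that(1)] that(2) by blast
    show "\<forall>i<n. v i \<in> M" if "\<forall>i<n. v i \<in> V" "(\<Sum>i<n. v i * b i) \<in> M" for v
      using b0(2) that mV_M by blast
  qed (use VS b(1) reps_dec in auto)
  ultimately have "card reps = n" by simp
  then have "e * n * num_max_ideals S = num_max_ideals S * (n * card inertia)"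
    using card_gal_dec card_dec card_gal(2)[OF fd] by simp
  \<comment> \<open>The product is the order of a finite group; its positivity permits the
    cancellation.\<close>
  moreover have "e * n * num_max_ideals S > 0"
    using card_gal(2)[OF fd] finite_G gal_id by (metis card_gt_0_iff empty_iff)
  ultimately show ?thesis by simp
qed

text \<open>Division with remainder by the residue characteristic \<open>p\<close>: if
  \<open>card inertia\<close> vanished in the residue field, so would its remainder, which is
  smaller than \<open>p\<close> and hence 0. Then \<open>p\<close> divides the ramification index,
  against tameness.\<close>

lemma card_inertia_notin:
  assumes "tamely_ramified V F" "defectless V F"
  shows "of_nat (card inertia) \<notin> M"
proof
  assume "of_nat (card inertia) \<in> M"
  then have m: "of_nat (card inertia) \<in> mV" using V_M_iff[OF V.of_nat_R] by blast
  obtain n where n: "residue_degree V W n" "field_degree F (ram_index F W * n * num_max_ideals S)"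
    using assms(2) max_M unfolding defectless_def by metis
  have t: "residue_separable V W" "\<not> residue_char V dvd ram_index F W"
    using assms(1) max_M unfolding tamely_ramified_def by auto
  have e: "card inertia = ram_index F W" using card_inertia[OF t(1) n] .
  have "id \<in> inertia" using dec_id by (simp add: inertia_def cong_M_refl)
  moreover have "finite inertia" using finite_dec by (simp add: inertia_def)
  ultimately have pos: "card inertia > 0" by (auto simp: card_gt_0_iff)
  let ?P = "\<lambda>n. n > 0 \<and> of_nat n \<in> mV"
  \<comment> \<open>This witness excludes the default value 0 of
    \<open>residue_char\<close>.\<close>
  have ex: "?P (card inertia)" using pos m by simp
  then have "\<exists>n>0. of_nat n \<in> mV" by blast
  then have rc: "residue_char V = (LEAST n. ?P n)" unfolding residue_char_def by (rule if_P)
  define p where "p = residue_char V"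
  have p: "?P p" unfolding p_def rc using ex by (rule LeastI)
  have least: "\<not> ?P k" if "k < p" for k using that unfolding p_def rc by (rule not_less_Least)
  define k where "k = card inertia mod p"
  have "of_nat (card inertia) - of_nat (card inertia div p) * of_nat p \<in> mV"
    using m p by (intro V.diff_I V.mult_I V.of_nat_R) auto
  moreover have "(of_nat (card inertia) :: 'k) = of_nat (card inertia div p) * of_nat p + of_nat k"
    unfolding k_def of_nat_mult[symmetric] of_nat_add[symmetric] by simp
  ultimately have "of_nat k \<in> mV" by simp
  moreover have "k < p" unfolding k_def using p by simp
  ultimately have "k = 0" using least[of k] by auto
  then show False using t(2) e unfolding k_def p_def by (simp add: mod_eq_0_iff_dvd)
qed

end

subsection \<open>The Jacobson radical\<close>

context ring
begin

lemma left_idealI: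
  assumes "I \<subseteq> carrier R" "\<zero> \<in> I" "\<And>x y. x \<in> I \<Longrightarrow> y \<in> I \<Longrightarrow> x \<oplus> y \<in> I"
    and mult: "\<And>a x. a \<in> carrier R \<Longrightarrow> x \<in> I \<Longrightarrow> a \<otimes> x \<in> I"
  shows "left_ideal R I"
proof -
  have "\<ominus> x \<in> I" if "x \<in> I" for x
    using mult[of "\<ominus> \<one>" x] that assms(1) by (auto simp: l_minus)
  then have "additive_subgroup I R"
    using assms(1-3) by (intro additive_subgroup.intro subgroup.intro) (auto simp: a_inv_def)
  then show ?thesis using mult by (simp add: left_ideal_def)
qed

lemma left_idealD:
  assumes "left_ideal R I"
  shows "I \<subseteq> carrier R" "\<zero> \<in> I" "\<And>x y. x \<in> I \<Longrightarrow> y \<in> I \<Longrightarrow> x \<oplus> y \<in> I"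
    "\<And>a x. a \<in> carrier R \<Longrightarrow> x \<in> I \<Longrightarrow> a \<otimes> x \<in> I"
    "\<And>x y. x \<in> I \<Longrightarrow> y \<in> I \<Longrightarrow> x \<ominus> y \<in> I"
proof -
  interpret additive_subgroup I R using assms by (simp add: left_ideal_def)
  show "I \<subseteq> carrier R" "\<zero> \<in> I" "\<And>x y. x \<in> I \<Longrightarrow> y \<in> I \<Longrightarrow> x \<oplus> y \<in> I"
    by (auto simp: a_subset)
  show "\<And>a x. a \<in> carrier R \<Longrightarrow> x \<in> I \<Longrightarrow> a \<otimes> x \<in> I" using assms by (simp add: left_ideal_def)
  show "\<And>x y. x \<in> I \<Longrightarrow> y \<in> I \<Longrightarrow> x \<ominus> y \<in> I" by (simp add: minus_eq a_inv_closed)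
qed

lemma left_ideal_one: "left_ideal R I \<Longrightarrow> \<one> \<in> I \<Longrightarrow> I = carrier R"
  using left_idealD[of I] by (metis r_one subset_antisym subsetI)

lemma left_ideal_sum_principal:
  assumes I: "left_ideal R I" and y: "y \<in> carrier R"
  shows "left_ideal R {i \<oplus> c \<otimes> y | i c. i \<in> I \<and> c \<in> carrier R}" (is "left_ideal R ?L")
proof (rule left_idealI)
  note D = left_idealD[OF I]
  show "?L \<subseteq> carrier R" using D(1) y by auto
  have "\<zero> = \<zero> \<oplus> \<zero> \<otimes> y" using y by simp
  then show "\<zero> \<in> ?L" using D(2) by blast
  show "u \<oplus> v \<in> ?L" if uv: "u \<in> ?L" "v \<in> ?L" for u v
  proof -
    obtain i c j d where *: "u = i \<oplus> c \<otimes> y" "v = j \<oplus> d \<otimes> y" "i \<in> I" "j \<in> I" "c \<in> carrier R" "d \<in> carrier R"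
      using uv by blast
    then have "u \<oplus> v = (i \<oplus> j) \<oplus> (c \<oplus> d) \<otimes> y"
      using D(1) y by (simp add: l_distr subset_iff a_ac)
    then show ?thesis using * D(3) by blast
  qed
  show "a \<otimes> u \<in> ?L" if au: "a \<in> carrier R" "u \<in> ?L" for a u
  proof -
    obtain i c where *: "u = i \<oplus> c \<otimes> y" "i \<in> I" "c \<in> carrier R" using au by blast
    then have "a \<otimes> u = (a \<otimes> i) \<oplus> (a \<otimes> c) \<otimes> y"
      using D(1) y au(1) by (simp add: r_distr subset_iff m_assoc)
    then show ?thesis using * D(4) au(1) by blast
  qed
qed

lemma left_ideal_Union:
  assumes "C \<noteq> {}" "\<And>I. I \<in> C \<Longrightarrow> left_ideal R I" "\<And>I J. I \<in> C \<Longrightarrow> J \<in> C \<Longrightarrow> I \<subseteq> J \<or> J \<subseteq> I"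
  shows "left_ideal R (\<Union>C)"
proof (rule left_idealI)
  show "\<Union>C \<subseteq> carrier R" using left_idealD(1)[OF assms(2)] by blast
  show "\<zero> \<in> \<Union>C" using left_idealD(2)[OF assms(2)] assms(1) by blast
  show "x \<oplus> y \<in> \<Union>C" if xy: "x \<in> \<Union>C" "y \<in> \<Union>C" for x y
  proof -
    obtain I J where "I \<in> C" "x \<in> I" "J \<in> C" "y \<in> J" using xy by blast
    then obtain I where "I \<in> C" "x \<in> I" "y \<in> I" using assms(3)[of I J] by auto
    then show ?thesis using left_idealD(3)[OF assms(2)] by blast
  qed
  show "a \<otimes> x \<in> \<Union>C" if "a \<in> carrier R" "x \<in> \<Union>C" for a x
    using that left_idealD(4)[OF assms(2)] by blast
qed

text \<open>Otherwise the left ideal generated by \<open>y = \<one> \<ominus> b \<otimes> a\<close>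
  is proper and lies in a maximal one, which contains \<open>a\<close> and therefore
  \<open>\<one>\<close>.\<close>

lemma jacobson_radical_left_inverse:
  assumes a: "a \<in> jacobson_radical R" and b: "b \<in> carrier R"
  shows "\<exists>u\<in>carrier R. u \<otimes> (\<one> \<ominus> b \<otimes> a) = \<one>"
proof (rule ccontr)
  assume neg: "\<not> ?thesis"
  have aR: "a \<in> carrier R" using a by (simp add: jacobson_radical_def)
  define y where "y = \<one> \<ominus> b \<otimes> a"
  have y: "y \<in> carrier R" using aR b by (simp add: y_def)
  \<comment> \<open>The principal left ideal of \<open>y\<close>, written as a sum with the zero
    ideal so that \<open>left_ideal_sum_principal\<close> applies.\<close>
  let ?L = "{i \<oplus> c \<otimes> y | i c. i \<in> {\<zero>} \<and> c \<in> carrier R}"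
  have "left_ideal R {\<zero>}" by (rule left_idealI) auto
  then have L: "left_ideal R ?L" using y by (rule left_ideal_sum_principal)
  have L1: "\<one> \<notin> ?L" using neg y unfolding y_def[symmetric] by auto
  obtain I where I: "left_ideal R I" "?L \<subseteq> I" "\<one> \<notin> I"
    "\<And>J. left_ideal R J \<Longrightarrow> I \<subseteq> J \<Longrightarrow> \<one> \<notin> J \<Longrightarrow> J = I"
  proof (rule exists_maximal_avoiding[of "left_ideal R" ?L \<one>])
    note concl = that
    show "left_ideal R (\<Union>C)" if "C \<noteq> {}" "\<And>I. I \<in> C \<Longrightarrow> left_ideal R I"
      "\<And>I J. I \<in> C \<Longrightarrow> J \<in> C \<Longrightarrow> I \<subseteq> J \<or> J \<subseteq> I" for C
      using that by (rule left_ideal_Union)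
    show thesis if "left_ideal R I" "?L \<subseteq> I" "\<one> \<notin> I"
      "\<And>J. left_ideal R J \<Longrightarrow> I \<subseteq> J \<Longrightarrow> \<one> \<notin> J \<Longrightarrow> J = I" for I
      by (rule concl) (fact that)+
  qed (rule L L1)+
  have "maximal_left_ideal R I"
    unfolding maximal_left_ideal_def using I left_ideal_one by auto
  then have "a \<in> I" using a by (auto simp: jacobson_radical_def)
  then have ba: "b \<otimes> a \<in> I" using left_idealD(4)[OF I(1) b] by blast
  have "y = \<zero> \<oplus> \<one> \<otimes> y" using y by simp
  then have "y \<in> ?L" by blast
  then have "y \<oplus> b \<otimes> a \<in> I" using I(2) ba left_idealD(3)[OF I(1)] by blast
  moreover have "y \<oplus> b \<otimes> a = \<one>"
    using aR b by (simp add: y_def minus_eq a_assoc l_neg)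
  ultimately show False using I(3) by simp
qed

text \<open>If a maximal left ideal \<open>I\<close> missed \<open>a\<close>, then
  \<open>\<one> = i \<oplus> c \<otimes> a\<close> with \<open>i\<close> in \<open>I\<close>; a left
  inverse of \<open>i = \<one> \<ominus> c \<otimes> a\<close> would put \<open>\<one>\<close> into
  \<open>I\<close>.\<close>

lemma jacobson_radicalI:
  assumes a: "a \<in> carrier R" and inv: "\<And>b. b \<in> carrier R \<Longrightarrow> \<exists>u\<in>carrier R. u \<otimes> (\<one> \<ominus> b \<otimes> a) = \<one>"
  shows "a \<in> jacobson_radical R"
proof -
  have "a \<in> I" if I: "maximal_left_ideal R I" for I
  proof (rule ccontr)
    assume aI: "a \<notin> I"
    have L: "left_ideal R I" using I by (simp add: maximal_left_ideal_def)
    note D = left_idealD[OF L]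
    let ?L = "{i \<oplus> c \<otimes> a | i c. i \<in> I \<and> c \<in> carrier R}"
    have L': "left_ideal R ?L" using L a by (rule left_ideal_sum_principal)
    have IL: "I \<subseteq> ?L"
    proof
      fix i assume i: "i \<in> I"
      then have "i = i \<oplus> \<zero> \<otimes> a" using a D(1) by (simp add: subset_iff)
      then show "i \<in> ?L" using i by blast
    qed
    have "a = \<zero> \<oplus> \<one> \<otimes> a" using a by simp
    then have aL: "a \<in> ?L" using D(2) by blast
    have "?L = carrier R"
    proof (rule ccontr)
      assume "?L \<noteq> carrier R"
      then have "?L = I" using I L' IL unfolding maximal_left_ideal_def by simp
      then show False using aL aI by simp
    qed
    then have "\<one> \<in> ?L" by simp
    then obtain i c where ic: "\<one> = i \<oplus> c \<otimes> a" "i \<in> I" "c \<in> carrier R" by blast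
    have iR: "i \<in> carrier R" using ic D(1) by blast
    then have "i = \<one> \<ominus> c \<otimes> a" unfolding ic(1) using a ic(3) by (simp add: minus_eq a_assoc r_neg)
    then obtain u where "u \<in> carrier R" "u \<otimes> i = \<one>" using inv[OF ic(3)] by auto
    then have "\<one> \<in> I" using D(4)[of u i] ic(2) by simp
    then have "I = carrier R" by (rule left_ideal_one[OF L])
    then show False using I by (simp add: maximal_left_ideal_def)
  qed
  then show ?thesis using a by (auto simp: jacobson_radical_def)
qed

lemma jacobson_radical_mult:
  assumes "a \<in> jacobson_radical R" "c \<in> carrier R"
  shows "c \<otimes> a \<in> jacobson_radical R"
proof -
  have "c \<otimes> a \<in> I" if "maximal_left_ideal R I" for I
    using that assms left_idealD(4)[of I c a] by (auto simp: jacobson_radical_def maximal_left_ideal_def)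
  then show ?thesis using assms by (auto simp: jacobson_radical_def)
qed

text \<open>Through the geometric sum a left inverse of \<open>\<one> \<ominus> y [^] n\<close>
  yields one of \<open>\<one> \<ominus> y\<close>, which reduces quasi-regularity of
  \<open>y\<close> to that of a power.\<close>

lemma geometric_left_factor:
  assumes y: "y \<in> carrier R"
  shows "\<exists>w\<in>carrier R. w \<otimes> (\<one> \<ominus> y) = \<one> \<ominus> y [^] (n::nat)"
proof (induction n)
  case 0
  have "\<zero> \<otimes> (\<one> \<ominus> y) = \<one> \<ominus> y [^] (0::nat)" using y by (simp add: minus_eq r_neg)
  then show ?case by blast
next
  case (Suc n)
  then obtain w where w: "w \<in> carrier R" "w \<otimes> (\<one> \<ominus> y) = \<one> \<ominus> y [^] n" by blast
  have yn: "y [^] n \<in> carrier R" using y by simp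
  have "(w \<oplus> y [^] n) \<otimes> (\<one> \<ominus> y) = (\<one> \<ominus> y [^] n) \<oplus> y [^] n \<otimes> (\<one> \<ominus> y)"
    using w y yn by (simp add: l_distr)
  also have "y [^] n \<otimes> (\<one> \<ominus> y) = y [^] n \<ominus> y [^] Suc n"
    using y yn by (simp add: minus_eq r_distr r_minus)
  also have "(\<one> \<ominus> y [^] n) \<oplus> (y [^] n \<ominus> y [^] Suc n) = \<one> \<ominus> y [^] Suc n"
    using y yn by (simp add: minus_eq a_assoc r_neg1)
  finally show ?case using w(1) yn by blast
qed

end

subsection \<open>The crossed product and its graded radical\<close>

locale crossed_order = valued_galois_max V F M for V F M :: "'k::field set" +
  fixes f :: "('k \<Rightarrow> 'k) \<Rightarrow> ('k \<Rightarrow> 'k) \<Rightarrow> 'k"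
  assumes cocycle: "normalized_cocycle (gal F) (integral_closure V) f"
begin

abbreviation A where "A \<equiv> crossed_product G S f"

abbreviation A_times (infixl "\<odot>" 70) where "a \<odot> b \<equiv> a \<otimes>\<^bsub>A\<^esub> b"

abbreviation A_unit ("1\<^sub>A") where "1\<^sub>A \<equiv> \<one>\<^bsub>A\<^esub>"

lemma f_S: "\<sigma> \<in> G \<Longrightarrow> \<tau> \<in> G \<Longrightarrow> f \<sigma> \<tau> \<in> S"
  and f_cocycle: "\<sigma> \<in> G \<Longrightarrow> \<tau> \<in> G \<Longrightarrow> \<gamma> \<in> G \<Longrightarrow> \<sigma> (f \<tau> \<gamma>) * f \<sigma> (\<tau> \<circ> \<gamma>) = f \<sigma> \<tau> * f (\<sigma> \<circ> \<tau>) \<gamma>"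
  and f_id: "\<sigma> \<in> G \<Longrightarrow> f id \<sigma> = 1" "\<sigma> \<in> G \<Longrightarrow> f \<sigma> id = 1"
  using cocycle unfolding normalized_cocycle_def by auto

text \<open>\<open>rmat b\<close> is the matrix of right multiplication by \<open>b\<close> on the free left \<open>S\<close>-module
  \<open>A\<close>, acting on row vectors.\<close>

definition rmat :: "(('k \<Rightarrow> 'k) \<Rightarrow> 'k) \<Rightarrow> ('k \<Rightarrow> 'k) \<Rightarrow> ('k \<Rightarrow> 'k) \<Rightarrow> 'k" where
  "rmat b \<sigma> \<rho> = \<sigma> (b (ginv \<sigma> \<circ> \<rho>)) * f \<sigma> (ginv \<sigma> \<circ> \<rho>)"

lemma A_carrier: "a \<in> carrier A \<longleftrightarrow> (\<forall>\<sigma>\<in>G. a \<sigma> \<in> S) \<and> (\<forall>\<sigma>. \<sigma> \<notin> G \<longrightarrow> a \<sigma> = 0)"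
  by (simp add: crossed_product_def)

lemma A_zero: "\<zero>\<^bsub>A\<^esub> = (\<lambda>\<rho>. 0)" and A_one: "1\<^sub>A = (\<lambda>\<rho>. if \<rho> = id then 1 else 0)"
  and A_add: "a \<oplus>\<^bsub>A\<^esub> b = (\<lambda>\<rho>. a \<rho> + b \<rho>)"
  by (simp_all add: crossed_product_def)

lemma comp_eq_iff: "\<sigma> \<in> G \<Longrightarrow> \<sigma> \<circ> \<tau> = \<rho> \<longleftrightarrow> \<tau> = ginv \<sigma> \<circ> \<rho>"
  using gal_comp_cancel by metis

lemma A_mult: "(a \<odot> b) \<rho> = (if \<rho> \<in> G then \<Sum>\<sigma>\<in>G. a \<sigma> * rmat b \<sigma> \<rho> else 0)"
proof -
  have m: "(a \<odot> b) \<rho> = (\<Sum>\<sigma>\<in>G. \<Sum>\<tau>\<in>G. if \<sigma> \<circ> \<tau> = \<rho> then a \<sigma> * \<sigma> (b \<tau>) * f \<sigma> \<tau> else 0)"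
    by (simp add: crossed_product_def)
  show ?thesis
  proof (cases "\<rho> \<in> G")
    case True
    have "(\<Sum>\<tau>\<in>G. if \<sigma> \<circ> \<tau> = \<rho> then a \<sigma> * \<sigma> (b \<tau>) * f \<sigma> \<tau> else 0) = a \<sigma> * rmat b \<sigma> \<rho>"
      if \<sigma>: "\<sigma> \<in> G" for \<sigma>
    proof -
      have "ginv \<sigma> \<circ> \<rho> \<in> G" using \<sigma> True by (intro gal_comp ginv_gal)
      then show ?thesis unfolding comp_eq_iff[OF \<sigma>]
        using finite_G by (simp add: sum.delta rmat_def mult.assoc)
    qed
    then show ?thesis unfolding m using True by simp
  next
    case False
    then have "\<sigma> \<circ> \<tau> \<noteq> \<rho>" if "\<sigma> \<in> G" "\<tau> \<in> G" for \<sigma> \<tau> using gal_comp[OF that] by auto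
    then show ?thesis unfolding m using False by simp
  qed
qed

lemma rmat_S: "b \<in> carrier A \<Longrightarrow> \<sigma> \<in> G \<Longrightarrow> \<rho> \<in> G \<Longrightarrow> rmat b \<sigma> \<rho> \<in> S"
  unfolding rmat_def
  by (rule M.mult_R, rule gal_S) (auto simp: A_carrier intro!: gal_comp ginv_gal f_S)

lemma rmat_add: "\<sigma> \<in> G \<Longrightarrow> rmat (\<lambda>\<rho>. a \<rho> + b \<rho>) \<sigma> \<rho> = rmat a \<sigma> \<rho> + rmat b \<sigma> \<rho>"
  by (simp add: rmat_def gal_hom distrib_right)

text \<open>Right multiplications compose, and row vectors keep the order of the factors. The
  cocycle identity is absorbed here, so that associativity of \<open>A\<close> reduces to reordering
  a double sum.\<close>

lemma rmat_mult:
  assumes \<sigma>: "\<sigma> \<in> G" and \<rho>: "\<rho> \<in> G"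
  shows "rmat (a \<odot> b) \<sigma> \<rho> = (\<Sum>\<mu>\<in>G. rmat a \<sigma> \<mu> * rmat b \<mu> \<rho>)"
proof -
  have \<sigma>\<rho>: "ginv \<sigma> \<circ> \<rho> \<in> G" using \<sigma> \<rho> by (intro gal_comp ginv_gal)
  have "rmat (a \<odot> b) \<sigma> \<rho>
    = (\<Sum>\<tau>\<in>G. \<sigma> (a \<tau>) * \<sigma> (rmat b \<tau> (ginv \<sigma> \<circ> \<rho>)) * f \<sigma> (ginv \<sigma> \<circ> \<rho>))"
    unfolding rmat_def[of "a \<odot> b"] A_mult
    using \<sigma> \<sigma>\<rho> by (simp add: gal_sum gal_hom sum_distrib_right)
  also have "\<dots> = (\<Sum>\<tau>\<in>G. rmat a \<sigma> (\<sigma> \<circ> \<tau>) * rmat b (\<sigma> \<circ> \<tau>) \<rho>)"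
  proof (rule sum.cong[OF refl])
    fix \<tau> assume \<tau>: "\<tau> \<in> G"
    \<comment> \<open>The degree completing \<open>\<sigma>\<close> and \<open>\<tau>\<close> to
      \<open>\<rho>\<close>, that is, the third argument of the cocycle identity.\<close>
    define \<gamma> where "\<gamma> = ginv \<tau> \<circ> (ginv \<sigma> \<circ> \<rho>)"
    have \<gamma>: "\<gamma> \<in> G" unfolding \<gamma>_def by (rule gal_comp[OF ginv_gal[OF \<tau>] \<sigma>\<rho>])
    have st: "\<sigma> \<circ> \<tau> \<in> G" using \<sigma> \<tau> by (rule gal_comp)
    have g0: "(\<sigma> \<circ> \<tau>) \<circ> \<gamma> = \<rho>" unfolding \<gamma>_def using \<sigma> \<tau> by (simp add: comp_assoc gal_comp_cancel)
    have g1: "ginv (\<sigma> \<circ> \<tau>) \<circ> \<rho> = \<gamma>" by (rule iffD1[OF comp_eq_iff[OF st] g0, symmetric])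
    have g2: "\<tau> \<circ> \<gamma> = ginv \<sigma> \<circ> \<rho>" unfolding \<gamma>_def using \<tau> by (simp add: gal_comp_cancel)
    have g3: "ginv \<sigma> \<circ> (\<sigma> \<circ> \<tau>) = \<tau>" using \<sigma> by (rule gal_comp_cancel)
    have "\<sigma> (rmat b \<tau> (ginv \<sigma> \<circ> \<rho>)) * f \<sigma> (ginv \<sigma> \<circ> \<rho>)
      = \<sigma> (\<tau> (b \<gamma>)) * (\<sigma> (f \<tau> \<gamma>) * f \<sigma> (\<tau> \<circ> \<gamma>))"
      unfolding rmat_def \<gamma>_def[symmetric] g2 using \<sigma> by (simp add: gal_hom mult.assoc)
    also have "\<dots> = f \<sigma> \<tau> * rmat b (\<sigma> \<circ> \<tau>) \<rho>"
      unfolding f_cocycle[OF \<sigma> \<tau> \<gamma>] rmat_def g1 by simp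
    finally show "\<sigma> (a \<tau>) * \<sigma> (rmat b \<tau> (ginv \<sigma> \<circ> \<rho>)) * f \<sigma> (ginv \<sigma> \<circ> \<rho>)
      = rmat a \<sigma> (\<sigma> \<circ> \<tau>) * rmat b (\<sigma> \<circ> \<tau>) \<rho>"
      unfolding rmat_def[of a] g3 by (simp add: mult.assoc)
  qed
  also have "\<dots> = (\<Sum>\<mu>\<in>G. rmat a \<sigma> \<mu> * rmat b \<mu> \<rho>)"
    by (rule sum.reindex_bij_betw[OF bij_left_mult[OF \<sigma>]])
  finally show ?thesis .
qed

lemma rmat_one: "\<sigma> \<in> G \<Longrightarrow> \<rho> \<in> G \<Longrightarrow> rmat 1\<^sub>A \<sigma> \<rho> = (if \<sigma> = \<rho> then 1 else 0)"
proof -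
  assume \<sigma>: "\<sigma> \<in> G" and \<rho>: "\<rho> \<in> G"
  have "ginv \<sigma> \<circ> \<rho> = id \<longleftrightarrow> \<sigma> = \<rho>" using comp_eq_iff[OF \<sigma>, of id \<rho>] by auto
  then show ?thesis unfolding rmat_def A_one using \<sigma> by (auto simp: gal_0 gal_hom f_id)
qed

lemma rmat_id: "\<rho> \<in> G \<Longrightarrow> rmat b id \<rho> = b \<rho>"
  using ginv_comp[OF gal_id] by (simp add: rmat_def f_id)

lemma A_assoc: "(a \<odot> b) \<odot> c = a \<odot> (b \<odot> c)"
proof
  fix \<rho>
  show "((a \<odot> b) \<odot> c) \<rho> = (a \<odot> (b \<odot> c)) \<rho>"
  proof (cases "\<rho> \<in> G")
    case True
    have "((a \<odot> b) \<odot> c) \<rho> = (\<Sum>\<mu>\<in>G. (\<Sum>\<sigma>\<in>G. a \<sigma> * rmat b \<sigma> \<mu>) * rmat c \<mu> \<rho>)"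
      unfolding A_mult[of "a \<odot> b"] using True by (simp add: A_mult)
    also have "\<dots> = (\<Sum>\<sigma>\<in>G. a \<sigma> * (\<Sum>\<mu>\<in>G. rmat b \<sigma> \<mu> * rmat c \<mu> \<rho>))"
      unfolding sum_distrib_left sum_distrib_right by (subst sum.swap) (simp add: mult.assoc)
    also have "\<dots> = (a \<odot> (b \<odot> c)) \<rho>"
      unfolding A_mult[of a "b \<odot> c"] using True by (simp add: rmat_mult)
    finally show ?thesis .
  qed (simp add: A_mult)
qed

lemma A_mult_closed: "a \<in> carrier A \<Longrightarrow> b \<in> carrier A \<Longrightarrow> a \<odot> b \<in> carrier A"
  unfolding A_carrier[of "a \<odot> b"] A_mult
  by (auto simp: A_carrier[of a] intro!: M.sum_R M.mult_R rmat_S)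

lemma A_one_closed: "1\<^sub>A \<in> carrier A"
  using gal_id by (auto simp: A_carrier A_one M.one_R M.zero_R)

lemma A_l_one: "a \<in> carrier A \<Longrightarrow> 1\<^sub>A \<odot> a = a"
  using gal_id finite_G
  by (intro ext) (auto simp: A_mult A_one A_carrier rmat_id if_distrib[of "\<lambda>x. x * _"] sum.delta cong: if_cong)

lemma A_r_one: "a \<in> carrier A \<Longrightarrow> a \<odot> 1\<^sub>A = a"
  using finite_G
  by (intro ext) (auto simp: A_mult rmat_one A_carrier if_distrib[of "\<lambda>x. _ * x"] sum.delta cong: if_cong)

sublocale A: ring A
proof (rule ringI)
  show "abelian_group A"
  proof (rule abelian_groupI)
    show "\<exists>y\<in>carrier A. y \<oplus>\<^bsub>A\<^esub> x = \<zero>\<^bsub>A\<^esub>" if "x \<in> carrier A" for x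
      using that by (intro bexI[of _ "\<lambda>\<rho>. - x \<rho>"]) (auto simp: A_add A_zero A_carrier M.uminus_R)
  qed (auto simp: A_add A_zero A_carrier M.add_R M.zero_R algebra_simps)
  show "monoid A"
    by (rule monoidI) (auto simp: A_mult_closed A_one_closed A_assoc A_l_one A_r_one)
  show "(x \<oplus>\<^bsub>A\<^esub> y) \<odot> z = x \<odot> z \<oplus>\<^bsub>A\<^esub> y \<odot> z" for x y z
    by (intro ext) (auto simp: A_mult A_add distrib_right sum.distrib)
  show "z \<odot> (x \<oplus>\<^bsub>A\<^esub> y) = z \<odot> x \<oplus>\<^bsub>A\<^esub> z \<odot> y" for x y z
    by (intro ext) (auto simp: A_mult A_add rmat_add distrib_left sum.distrib)
qed

lemma A_diff: assumes "a \<in> carrier A" "b \<in> carrier A" shows "a \<ominus>\<^bsub>A\<^esub> b = (\<lambda>\<rho>. a \<rho> - b \<rho>)"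
proof -
  have c: "(\<lambda>\<rho>. - b \<rho>) \<in> carrier A" using assms by (auto simp: A_carrier M.uminus_R)
  have "(\<lambda>\<rho>. - b \<rho>) \<oplus>\<^bsub>A\<^esub> b = \<zero>\<^bsub>A\<^esub>" by (simp add: A_add A_zero)
  then have "\<ominus>\<^bsub>A\<^esub> b = (\<lambda>\<rho>. - b \<rho>)" using A.minus_equality[OF _ assms(2) c] by simp
  then show ?thesis by (simp add: A.minus_eq A_add)
qed

lemma rmat_diff: "\<sigma> \<in> G \<Longrightarrow> rmat (\<lambda>\<rho>. a \<rho> - b \<rho>) \<sigma> \<rho> = rmat a \<sigma> \<rho> - rmat b \<sigma> \<rho>"
  by (simp add: rmat_def gal_diff left_diff_distrib)

section \<open>Scalars, basis elements and homogeneous components\<close>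

definition sc :: "'k \<Rightarrow> ('k \<Rightarrow> 'k) \<Rightarrow> 'k" where "sc s = (\<lambda>\<rho>. if \<rho> = id then s else 0)"

definition xg :: "('k \<Rightarrow> 'k) \<Rightarrow> ('k \<Rightarrow> 'k) \<Rightarrow> 'k" where "xg \<sigma> = (\<lambda>\<rho>. if \<rho> = \<sigma> then 1 else 0)"

lemma sc_carrier: "s \<in> S \<Longrightarrow> sc s \<in> carrier A"
  using gal_id by (auto simp: A_carrier sc_def M.zero_R)

lemma xg_carrier: "\<sigma> \<in> G \<Longrightarrow> xg \<sigma> \<in> carrier A"
  by (auto simp: A_carrier xg_def M.zero_R M.one_R)

lemma hcomp_carrier: "a \<in> carrier A \<Longrightarrow> hcomp a \<sigma> \<in> carrier A"
  by (auto simp: A_carrier hcomp_def M.zero_R)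

lemma hcomp_mult: "\<sigma> \<in> G \<Longrightarrow> \<rho> \<in> G \<Longrightarrow> (hcomp a \<sigma> \<odot> b) \<rho> = a \<sigma> * rmat b \<sigma> \<rho>"
  using finite_G by (simp add: A_mult hcomp_def if_distrib[of "\<lambda>x. x * _"] sum.delta cong: if_cong)

lemma xg_mult: "\<sigma> \<in> G \<Longrightarrow> \<rho> \<in> G \<Longrightarrow> (xg \<sigma> \<odot> b) \<rho> = rmat b \<sigma> \<rho>"
  using finite_G by (simp add: A_mult xg_def if_distrib[of "\<lambda>x. x * _"] sum.delta cong: if_cong)

lemma sc_mult: "b \<in> carrier A \<Longrightarrow> sc s \<odot> b = (\<lambda>\<rho>. s * b \<rho>)"
  using finite_G gal_id
  by (intro ext) (auto simp: A_mult sc_def rmat_id A_carrier if_distrib[of "\<lambda>x. x * _"] sum.delta cong: if_cong)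

lemma rmat_hcomp: "\<mu> \<in> G \<Longrightarrow> rmat (hcomp b \<sigma>) \<mu> \<rho> = (if ginv \<mu> \<circ> \<rho> = \<sigma> then rmat b \<mu> \<rho> else 0)"
  by (auto simp: rmat_def hcomp_def gal_0)

text \<open>Right multiplication by an element of degree \<open>\<sigma>\<close> shifts degrees by
  \<open>\<sigma>\<close>. Components of multiples of a homogeneous \<open>y\<close> are therefore
  multiples of \<open>y\<close>, which makes \<open>I + A y\<close> graded for graded
  \<open>I\<close>.\<close>

lemma hcomp_of_mult:
  assumes \<sigma>: "\<sigma> \<in> G" and \<tau>: "\<tau> \<in> G"
  shows "hcomp (c \<odot> hcomp b \<sigma>) \<tau> = hcomp c (\<tau> \<circ> ginv \<sigma>) \<odot> hcomp b \<sigma>"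
proof
  fix \<rho>
  have m: "\<tau> \<circ> ginv \<sigma> \<in> G" using \<sigma> \<tau> by (intro gal_comp ginv_gal)
  have iff: "ginv \<mu> \<circ> \<rho>' = \<sigma> \<longleftrightarrow> \<mu> = \<rho>' \<circ> ginv \<sigma>" if \<mu>: "\<mu> \<in> G" for \<mu> \<rho>' :: "'k \<Rightarrow> 'k"
  proof
    assume "ginv \<mu> \<circ> \<rho>' = \<sigma>"
    then have "\<rho>' = \<mu> \<circ> \<sigma>" using comp_eq_iff[OF \<mu>] by metis
    then show "\<mu> = \<rho>' \<circ> ginv \<sigma>" by (simp add: comp_assoc ginv_comp[OF \<sigma>])
  next
    assume "\<mu> = \<rho>' \<circ> ginv \<sigma>"
    then have "\<mu> \<circ> \<sigma> = \<rho>'" by (simp add: comp_assoc ginv_comp[OF \<sigma>])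
    then show "ginv \<mu> \<circ> \<rho>' = \<sigma>" using comp_eq_iff[OF \<mu>] by metis
  qed
  show "hcomp (c \<odot> hcomp b \<sigma>) \<tau> \<rho> = (hcomp c (\<tau> \<circ> ginv \<sigma>) \<odot> hcomp b \<sigma>) \<rho>"
  proof (cases "\<rho> \<in> G")
    case True
    have R: "(hcomp c (\<tau> \<circ> ginv \<sigma>) \<odot> hcomp b \<sigma>) \<rho>
      = c (\<tau> \<circ> ginv \<sigma>) * (if \<tau> \<circ> ginv \<sigma> = \<rho> \<circ> ginv \<sigma> then rmat b (\<tau> \<circ> ginv \<sigma>) \<rho> else 0)"
      unfolding hcomp_mult[OF m True] rmat_hcomp[OF m] iff[OF m] by simp
    have inj: "\<tau> \<circ> ginv \<sigma> = \<rho> \<circ> ginv \<sigma> \<longleftrightarrow> \<tau> = \<rho>"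
      by (metis comp_assoc comp_id ginv_comp(1)[OF \<sigma>])
    have "(c \<odot> hcomp b \<sigma>) \<tau> = (\<Sum>\<mu>\<in>G. if \<mu> = \<tau> \<circ> ginv \<sigma> then c \<mu> * rmat b \<mu> \<tau> else 0)"
      unfolding A_mult using \<tau> by (auto intro!: sum.cong simp: rmat_hcomp iff)
    also have "\<dots> = c (\<tau> \<circ> ginv \<sigma>) * rmat b (\<tau> \<circ> ginv \<sigma>) \<tau>"
      using finite_G m by (simp add: sum.delta)
    finally show ?thesis unfolding R inj hcomp_def[of "c \<odot> hcomp b \<sigma>"] by auto
  next
    case False
    then have "\<rho> \<noteq> \<tau>" using \<tau> by auto
    then show ?thesis using False by (simp add: A_mult hcomp_def[of "c \<odot> hcomp b \<sigma>"])
  qed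
qed

lemma left_ideal_hcomp_sum:
  assumes I: "left_ideal A I" and b: "b \<in> carrier A" "\<And>\<sigma>. \<sigma> \<in> G \<Longrightarrow> hcomp b \<sigma> \<in> I"
  shows "b \<in> I"
proof -
  have "(\<lambda>\<rho>. if \<rho> \<in> X then b \<rho> else 0) \<in> I" if "X \<subseteq> G" for X
    using finite_subset[OF that finite_G] that
  proof (induction X)
    case empty
    then show ?case using A.left_idealD(2)[OF I] by (simp add: A_zero)
  next
    case (insert \<sigma> X)
    have "(\<lambda>\<rho>. if \<rho> \<in> insert \<sigma> X then b \<rho> else 0) = hcomp b \<sigma> \<oplus>\<^bsub>A\<^esub> (\<lambda>\<rho>. if \<rho> \<in> X then b \<rho> else 0)"
      using insert.hyps by (intro ext) (auto simp: A_add hcomp_def)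
    then show ?case using insert b(2) A.left_idealD(3)[OF I] by simp
  qed
  from this[of G] have "(\<lambda>\<rho>. if \<rho> \<in> G then b \<rho> else 0) \<in> I" by simp
  moreover have "(\<lambda>\<rho>. if \<rho> \<in> G then b \<rho> else 0) = b" using b(1) by (intro ext) (auto simp: A_carrier)
  ultimately show ?thesis by simp
qed

text \<open>\<open>rmat b \<mu> id\<close> is the identity coefficient of
  \<open>xg \<mu> \<odot> b\<close>. For an ideal \<open>P\<close> of \<open>S\<close> this is the
  largest left ideal of \<open>A\<close> whose elements all have their identity coefficient in
  \<open>P\<close>.\<close>

definition grad :: "'k set \<Rightarrow> (('k \<Rightarrow> 'k) \<Rightarrow> 'k) set" where
  "grad P = {b \<in> carrier A. \<forall>\<mu>\<in>G. rmat b \<mu> id \<in> P}"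

lemma grad_left_ideal:
  assumes "ideal_pair S P" shows "graded_left_ideal A (grad P)"
proof -
  interpret P: ideal_pair S P by fact
  have "left_ideal A (grad P)"
  proof (rule A.left_idealI)
    show "\<zero>\<^bsub>A\<^esub> \<in> grad P" using A.zero_closed by (auto simp: grad_def A_zero rmat_def gal_0 P.zero_I)
    show "x \<oplus>\<^bsub>A\<^esub> y \<in> grad P" if "x \<in> grad P" "y \<in> grad P" for x y
      using that A.a_closed[of x y] by (auto simp: grad_def A_add rmat_add P.add_I)
    show "a \<odot> x \<in> grad P" if "a \<in> carrier A" "x \<in> grad P" for a x
      using that A.m_closed[of a x] gal_id
      by (auto simp: grad_def rmat_mult intro!: P.sum_I P.mult_I rmat_S)
  qed (auto simp: grad_def)
  moreover have "hcomp b \<sigma> \<in> grad P" if "b \<in> grad P" for b \<sigma>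
    using that by (auto simp: grad_def hcomp_carrier rmat_hcomp P.zero_I)
  ultimately show ?thesis by (simp add: graded_left_ideal_def)
qed

lemma sc_grad: "ideal_pair S P \<Longrightarrow> p \<in> P \<Longrightarrow> sc p \<in> grad P"
proof -
  assume "ideal_pair S P" and p: "p \<in> P"
  then interpret P: ideal_pair S P by simp
  have "rmat (sc p) \<mu> id \<in> P" if \<mu>: "\<mu> \<in> G" for \<mu>
  proof (cases "ginv \<mu> = id")
    case True
    then have "\<mu> = id" using comp_eq_iff[OF \<mu>, of id id] by simp
    then show ?thesis using p gal_id by (simp add: rmat_id sc_def)
  next
    case False
    then show ?thesis using \<mu> by (simp add: rmat_def sc_def gal_0 P.zero_I)
  qed
  then show ?thesis using sc_carrier[OF P.in_R[OF p]] by (simp add: grad_def)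
qed

text \<open>A larger graded left ideal contains a scalar \<open>t\<close> outside \<open>P\<close>,
  extracted as an identity component, besides all scalars from \<open>P\<close>. Since
  \<open>t\<close> is invertible modulo \<open>P\<close>, it contains 1.\<close>

lemma grad_maximal:
  assumes "residue_pair S P" shows "maximal_graded_left_ideal A (grad P)"
proof -
  interpret P: residue_pair S P by fact
  have gl: "graded_left_ideal A (grad P)" by (rule grad_left_ideal) (rule P.ideal_pair_axioms)
  have one: "1\<^sub>A \<notin> grad P" using gal_id P.one_notin by (auto simp: grad_def rmat_one)
  have "L = grad P" if L: "graded_left_ideal A L" "grad P \<subseteq> L" "L \<noteq> carrier A" for L
  proof (rule ccontr)
    assume "L \<noteq> grad P"
    then obtain b where b: "b \<in> L" "b \<notin> grad P" using L(2) by blast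
    have LI: "left_ideal A L" and Lh: "\<And>a \<sigma>. a \<in> L \<Longrightarrow> hcomp a \<sigma> \<in> L"
      using L(1) by (auto simp: graded_left_ideal_def)
    note D = A.left_idealD[OF LI]
    obtain \<mu> where \<mu>: "\<mu> \<in> G" "rmat b \<mu> id \<notin> P" using b D(1) by (auto simp: grad_def)
    define t where "t = rmat b \<mu> id"
    have t: "t \<in> S" unfolding t_def using rmat_S \<mu>(1) gal_id b(1) D(1) by blast
    have "hcomp (xg \<mu> \<odot> b) id = sc t"
      using xg_mult[OF \<mu>(1) gal_id] by (auto simp: hcomp_def sc_def t_def)
    then have st: "sc t \<in> L" using Lh[of "xg \<mu> \<odot> b" id] D(4)[OF xg_carrier[OF \<mu>(1)] b(1)] by simp
    obtain y where y: "y \<in> S" "t * y - 1 \<in> P" using P.inverse_mod[OF t] \<mu>(2) unfolding t_def by blast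
    have 1: "sc y \<odot> sc t \<in> L" using D(4)[OF sc_carrier[OF y(1)] st] .
    have 2: "sc (t * y - 1) \<in> L" using sc_grad[OF P.ideal_pair_axioms y(2)] L(2) by blast
    have "(sc y \<odot> sc t) \<ominus>\<^bsub>A\<^esub> sc (t * y - 1) = (\<lambda>\<rho>. (sc y \<odot> sc t) \<rho> - sc (t * y - 1) \<rho>)"
      using 1 2 D(1) by (intro A_diff) auto
    also have "\<dots> = 1\<^sub>A"
      unfolding sc_mult[OF sc_carrier[OF t]] by (rule ext) (simp add: sc_def A_one mult.commute)
    finally have "(sc y \<odot> sc t) \<ominus>\<^bsub>A\<^esub> sc (t * y - 1) = 1\<^sub>A" .
    then have "1\<^sub>A \<in> L" using D(5)[OF 1 2] by simp
    then show False using A.left_ideal_one[OF LI] L(3) by blast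
  qed
  then show ?thesis using gl one A_one_closed unfolding maximal_graded_left_ideal_def by auto
qed

text \<open>The maximal ideals of \<open>S\<close> give enough maximal graded left ideals for one
  inclusion. For the other, a homogeneous \<open>y\<close> in \<open>grad JS\<close> outside a
  maximal graded \<open>I\<close> would give \<open>1 = i + c y\<close> with \<open>i\<close> in
  \<open>I\<close>. The identity coefficient of \<open>c y\<close> lies in \<open>JS\<close>, so
  that of \<open>i\<close> is a unit of \<open>S\<close>, and its scalar is in \<open>I\<close> by
  gradedness.\<close>

lemma graded_jacobson_radical_eq: "graded_jacobson_radical A = grad JS"
proof
  show "graded_jacobson_radical A \<subseteq> grad JS"
  proof
    fix b assume b: "b \<in> graded_jacobson_radical A"
    have bA: "b \<in> carrier A" using b by (simp add: graded_jacobson_radical_def)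
    have "rmat b \<mu> id \<in> JS" if \<mu>: "\<mu> \<in> G" for \<mu>
    proof -
      have "\<tau> (rmat b \<mu> id) \<in> M" if \<tau>: "\<tau> \<in> G" for \<tau>
      proof -
        have "b \<in> grad (conj_max \<tau>)"
          using b grad_maximal[OF conj_max_residue_pair[OF \<tau>]] by (auto simp: graded_jacobson_radical_def)
        then show ?thesis using \<mu> by (auto simp: grad_def conj_max_def)
      qed
      then show ?thesis using rmat_S[OF bA \<mu> gal_id] by (simp add: JS_def)
    qed
    then show "b \<in> grad JS" using bA by (simp add: grad_def)
  qed
  show "grad JS \<subseteq> graded_jacobson_radical A"
  proof
    fix b assume b: "b \<in> grad JS"
    have bA: "b \<in> carrier A" using b by (simp add: grad_def)
    have "b \<in> I" if I: "maximal_graded_left_ideal A I" for I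
    proof -
      have LI: "left_ideal A I" and Ih: "\<And>a \<sigma>. a \<in> I \<Longrightarrow> hcomp a \<sigma> \<in> I" and proper: "I \<noteq> carrier A"
        using I by (auto simp: maximal_graded_left_ideal_def graded_left_ideal_def)
      note D = A.left_idealD[OF LI]
      have "hcomp b \<sigma> \<in> I" if \<sigma>: "\<sigma> \<in> G" for \<sigma>
      proof (rule ccontr)
        define y where "y = hcomp b \<sigma>"
        assume "hcomp b \<sigma> \<notin> I"
        then have yI: "y \<notin> I" by (simp add: y_def)
        have yN: "y \<in> grad JS"
          using grad_left_ideal[OF J.ideal_pair_axioms] b by (simp add: y_def graded_left_ideal_def)
        have yA: "y \<in> carrier A" using yN by (simp add: grad_def)
        let ?L = "{i \<oplus>\<^bsub>A\<^esub> c \<odot> y | i c. i \<in> I \<and> c \<in> carrier A}"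
        have LL: "left_ideal A ?L" using LI yA by (rule A.left_ideal_sum_principal)
        have "hcomp u \<tau> \<in> ?L" if u: "u \<in> ?L" for u \<tau>
        proof -
          obtain i c where ic: "u = i \<oplus>\<^bsub>A\<^esub> c \<odot> y" "i \<in> I" "c \<in> carrier A" using u by blast
          show ?thesis
          proof (cases "\<tau> \<in> G")
            case True
            have "hcomp u \<tau> = hcomp i \<tau> \<oplus>\<^bsub>A\<^esub> hcomp (c \<odot> y) \<tau>"
              unfolding ic(1) by (intro ext) (auto simp: hcomp_def A_add)
            then have "hcomp u \<tau> = hcomp i \<tau> \<oplus>\<^bsub>A\<^esub> hcomp c (\<tau> \<circ> ginv \<sigma>) \<odot> y"
              unfolding y_def hcomp_of_mult[OF \<sigma> True] .
            then show ?thesis using Ih[OF ic(2)] hcomp_carrier[OF ic(3)] by blast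
          next
            case False
            have "u \<in> carrier A" using u A.left_idealD(1)[OF LL] by blast
            then have "hcomp u \<tau> = \<zero>\<^bsub>A\<^esub>" using False by (intro ext) (auto simp: hcomp_def A_zero A_carrier)
            then show ?thesis using A.left_idealD(2)[OF LL] by simp
          qed
        qed
        then have gL: "graded_left_ideal A ?L" using LL by (simp only: graded_left_ideal_def) blast
        have IL: "I \<subseteq> ?L"
        proof
          fix i assume i: "i \<in> I"
          then have "i = i \<oplus>\<^bsub>A\<^esub> \<zero>\<^bsub>A\<^esub> \<odot> y" using yA D(1) by (simp add: subset_iff)
          then show "i \<in> ?L" using i by blast
        qed
        have "y = \<zero>\<^bsub>A\<^esub> \<oplus>\<^bsub>A\<^esub> 1\<^sub>A \<odot> y" using yA by simp
        then have yL: "y \<in> ?L" using D(2) by blast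
        have "?L = carrier A"
        proof (rule ccontr)
          assume "?L \<noteq> carrier A"
          then have "?L = I" using I gL IL unfolding maximal_graded_left_ideal_def by simp
          then show False using yL yI by simp
        qed
        then have "1\<^sub>A \<in> ?L" by simp
        then obtain i c where ic: "1\<^sub>A = i \<oplus>\<^bsub>A\<^esub> c \<odot> y" "i \<in> I" "c \<in> carrier A" by blast
        define j where "j = (c \<odot> y) id"
        have "j = (\<Sum>\<mu>\<in>G. c \<mu> * rmat y \<mu> id)" using gal_id by (simp add: j_def A_mult)
        also have "\<dots> \<in> JS"
          using ic(3) yN by (intro J.sum_I J.mult_I) (auto simp: A_carrier grad_def)
        finally have j: "j \<in> JS" .
        have "i id = 1 - j" using fun_cong[OF ic(1), of id] by (simp add: A_one A_add j_def eq_diff_eq)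
        then have "hcomp i id = sc (1 - j)" by (auto simp: hcomp_def sc_def)
        then have sI: "sc (1 - j) \<in> I" using Ih[OF ic(2), of id] by simp
        have jS: "1 - j \<in> S" using J.in_R[OF j] by (intro M.diff_R M.one_R)
        obtain z where z: "z \<in> S" "(1 - j) * z = 1" using unit_one_minus_JS[OF j] by blast
        have "sc z \<odot> sc (1 - j) = 1\<^sub>A"
          using sc_mult[OF sc_carrier[OF jS], of z] z(2) by (intro ext) (auto simp: sc_def A_one mult.commute)
        then have "1\<^sub>A \<in> I" using D(4)[OF sc_carrier[OF z(1)] sI] by simp
        then show False using A.left_ideal_one[OF LI] proper by blast
      qed
      then show ?thesis by (rule left_ideal_hcomp_sum[OF LI bA])
    qed
    then show "b \<in> graded_jacobson_radical A" using bA by (auto simp: graded_jacobson_radical_def)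
  qed
qed

end

subsection \<open>Comparison of the two radicals\<close>

context crossed_order
begin

section \<open>The ideal \<open>J(S) A\<close> and invertibility modulo it\<close>

definition JA :: "(('k \<Rightarrow> 'k) \<Rightarrow> 'k) set" where "JA = {z \<in> carrier A. \<forall>\<sigma>\<in>G. z \<sigma> \<in> JS}"

text \<open>Unlike \<open>M\<close>, the ideal \<open>JS\<close> is stable under \<open>G\<close>,
  so twisting the coefficients of \<open>z\<close> does not lead out of it.\<close>

lemma JA_rmat: "z \<in> JA \<Longrightarrow> \<sigma> \<in> G \<Longrightarrow> \<rho> \<in> G \<Longrightarrow> rmat z \<sigma> \<rho> \<in> JS"
  unfolding rmat_def
  by (rule J.mult_I2, rule JS_gal) (auto simp: JA_def intro!: gal_comp ginv_gal f_S)

lemma JA_mult: assumes "z \<in> JA" "b \<in> carrier A" shows "z \<odot> b \<in> JA"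
  using assms A_mult_closed[of z b] unfolding JA_def
  by (auto simp: A_mult intro!: J.sum_I J.mult_I2 rmat_S)

lemma exists_enum: "\<exists>e. bij_betw e {0..<card G} G"
  using ex_bij_betw_nat_finite[OF finite_G] .

definition enum :: "nat \<Rightarrow> 'k \<Rightarrow> 'k" where "enum = (SOME e. bij_betw e {0..<card G} G)"

lemma bij_enum: "bij_betw enum {0..<card G} G"
  unfolding enum_def using exists_enum by (rule someI_ex)

lemma enum_G: "i < card G \<Longrightarrow> enum i \<in> G"
  using bij_enum by (auto simp: bij_betw_def)

lemma enum_inj: "i < card G \<Longrightarrow> j < card G \<Longrightarrow> enum i = enum j \<longleftrightarrow> i = j"
  using bij_enum by (auto simp: bij_betw_def inj_on_def)

definition Q :: "(('k \<Rightarrow> 'k) \<Rightarrow> 'k) \<Rightarrow> 'k mat" where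
  "Q b = mat (card G) (card G) (\<lambda>(i, j). rmat b (enum i) (enum j))"

lemma Q_carrier: "Q b \<in> carrier_mat (card G) (card G)" by (simp add: Q_def)

lemma Q_mult: "Q (a \<odot> b) = Q a * Q b"
proof (rule eq_matI)
  fix i j assume "i < dim_row (Q a * Q b)" "j < dim_col (Q a * Q b)"
  then have ij: "i < card G" "j < card G" by (simp_all add: Q_def)
  have "(Q a * Q b) $$ (i, j) = (\<Sum>k = 0..<card G. rmat a (enum i) (enum k) * rmat b (enum k) (enum j))"
    using ij by (simp add: Q_def scalar_prod_def)
  also have "\<dots> = (\<Sum>\<mu>\<in>G. rmat a (enum i) \<mu> * rmat b \<mu> (enum j))"
    by (rule sum.reindex_bij_betw[OF bij_enum])
  also have "\<dots> = Q (a \<odot> b) $$ (i, j)" using ij by (simp add: Q_def rmat_mult enum_G)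
  finally show "Q (a \<odot> b) $$ (i, j) = (Q a * Q b) $$ (i, j)" ..
qed (simp_all add: Q_def)

lemma Q_one: "Q 1\<^sub>A = 1\<^sub>m (card G)"
  by (rule eq_matI) (auto simp: Q_def rmat_one enum_G enum_inj)

lemma Q_pow: "Q (b [^]\<^bsub>A\<^esub> (m::nat)) = Q b ^\<^sub>m m"
  using Q_carrier[of b] by (induction m) (simp_all add: Q_one Q_mult)

text \<open>The matrix of \<open>1 - z\<close> is the identity modulo \<open>JS\<close>, so its
  determinant is a unit of \<open>S\<close> and its inverse, through the adjugate, has entries in
  \<open>S\<close>.\<close>

lemma one_minus_JA_left_inverse:
  assumes z: "z \<in> JA"
  shows "\<exists>u\<in>carrier A. u \<odot> (1\<^sub>A \<ominus>\<^bsub>A\<^esub> z) = 1\<^sub>A"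
proof -
  let ?n = "card G"
  have zA: "z \<in> carrier A" using z by (simp add: JA_def)
  define y where "y = 1\<^sub>A \<ominus>\<^bsub>A\<^esub> z"
  have yA: "y \<in> carrier A" using zA by (simp add: y_def)
  have y: "rmat y \<sigma> \<rho> = (if \<sigma> = \<rho> then 1 else 0) - rmat z \<sigma> \<rho>" if "\<sigma> \<in> G" "\<rho> \<in> G" for \<sigma> \<rho>
    unfolding y_def A_diff[OF A_one_closed zA] using that by (simp add: rmat_diff rmat_one)
  have QS: "Q y $$ (i, j) \<in> S" if "i < ?n" "j < ?n" for i j
    using that rmat_S[OF yA] enum_G by (simp add: Q_def)
  have "det (Q y) - det (1\<^sub>m ?n) \<in> JS"
  proof (rule J.det_cong[OF Q_carrier one_carrier_mat QS])
    fix i j assume ij: "i < ?n" "j < ?n"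
    show "Q y $$ (i, j) - 1\<^sub>m ?n $$ (i, j) \<in> JS"
      using ij J.uminus_I[OF JA_rmat[OF z enum_G[OF ij(1)] enum_G[OF ij(2)]]]
      by (simp add: Q_def y enum_G enum_inj)
  qed
  then have "1 - det (Q y) \<in> JS" using J.uminus_I[of "det (Q y) - 1"] by simp
  then obtain d where d: "d \<in> S" "det (Q y) * d = 1" using unit_one_minus_JS[of "1 - det (Q y)"] by auto
  have adj: "adj_mat (Q y) \<in> carrier_mat ?n ?n" "adj_mat (Q y) * Q y = det (Q y) \<cdot>\<^sub>m 1\<^sub>m ?n"
    using adj_mat[OF Q_carrier] by auto
  have adjS: "adj_mat (Q y) $$ (i, j) \<in> S" if ij: "i < ?n" "j < ?n" for i j
  proof -
    have "det (mat_delete (Q y) j i) \<in> S"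
    proof (rule J.det_R[of _ "?n - 1"])
      show "mat_delete (Q y) j i \<in> carrier_mat (?n - 1) (?n - 1)"
        by (rule mat_delete_carrier[OF Q_carrier])
      fix k l assume "k < ?n - 1" "l < ?n - 1"
      then show "mat_delete (Q y) j i $$ (k, l) \<in> S"
        using Q_carrier[of y] by (auto simp: mat_delete_def intro!: QS)
    qed
    then show ?thesis using ij Q_carrier[of y]
      by (auto simp: adj_mat_def cofactor_def intro!: J.mult_R J.power_R J.uminus_R J.one_R)
  qed
  have "id \<in> enum ` {0..<?n}" using bij_enum gal_id by (simp add: bij_betw_def)
  then obtain k where k: "k < ?n" "enum k = id" by auto
  define idx where "idx = inv_into {0..<?n} enum"
  have idx: "idx \<sigma> < ?n \<and> enum (idx \<sigma>) = \<sigma>" if "\<sigma> \<in> G" for \<sigma>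
  proof -
    have "\<sigma> \<in> enum ` {0..<?n}" using bij_enum that by (simp add: bij_betw_def)
    then show ?thesis using inv_into_into[of \<sigma> enum "{0..<?n}"] f_inv_into_f[of \<sigma> enum "{0..<?n}"]
      unfolding idx_def by auto
  qed
  have idx_enum: "idx (enum i) = i" if "i < ?n" for i
    using idx[OF enum_G[OF that]] enum_inj that by auto
  \<comment> \<open>The row of the inverse matrix at the index \<open>k\<close> of
    \<open>id\<close>, which is the row vector of 1 times that inverse; multiplying it by
    \<open>Q y\<close> returns the row vector of 1.\<close>
  define u where "u = (\<lambda>\<sigma>. if \<sigma> \<in> G then d * adj_mat (Q y) $$ (k, idx \<sigma>) else 0)"
  have uA: "u \<in> carrier A" using d adjS k idx by (auto simp: A_carrier u_def intro!: J.mult_R)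
  have "u \<odot> y = 1\<^sub>A"
  proof
    fix \<rho>
    show "(u \<odot> y) \<rho> = 1\<^sub>A \<rho>"
    proof (cases "\<rho> \<in> G")
      case True
      have "(u \<odot> y) \<rho> = (\<Sum>\<sigma>\<in>G. u \<sigma> * rmat y \<sigma> \<rho>)" using True by (simp add: A_mult)
      also have "\<dots> = (\<Sum>i = 0..<?n. u (enum i) * rmat y (enum i) \<rho>)"
        by (rule sum.reindex_bij_betw[OF bij_enum, symmetric])
      also have "\<dots> = (\<Sum>i = 0..<?n. d * (adj_mat (Q y) $$ (k, i) * Q y $$ (i, idx \<rho>)))"
        using idx[OF True] by (intro sum.cong refl) (simp add: u_def enum_G idx_enum Q_def mult.assoc)
      also have "\<dots> = d * (adj_mat (Q y) * Q y) $$ (k, idx \<rho>)"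
        using k(1) idx[OF True] adj(1) Q_carrier[of y]
        by (simp add: scalar_prod_def sum_distrib_left)
      also have "\<dots> = (if \<rho> = id then 1 else 0)"
        unfolding adj(2) using k idx[OF True] d(2) enum_inj[of k "idx \<rho>"] by (auto simp: mult.commute)
      finally show ?thesis by (simp add: A_one)
    next
      case False
      then show ?thesis using gal_id by (auto simp: A_mult A_one)
    qed
  qed
  then show ?thesis using uA unfolding y_def by blast
qed

section \<open>Nilpotency of the graded radical modulo \<open>J(S) A\<close>\<close>

definition homog :: "('k \<Rightarrow> 'k) \<Rightarrow> (('k \<Rightarrow> 'k) \<Rightarrow> 'k) \<Rightarrow> bool" where
  "homog \<rho> w \<longleftrightarrow> w \<in> carrier A \<and> (\<forall>\<sigma>. \<sigma> \<noteq> \<rho> \<longrightarrow> w \<sigma> = 0)"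

lemma homog_hcomp: "homog \<rho> w \<Longrightarrow> w = hcomp w \<rho>"
  by (intro ext) (auto simp: homog_def hcomp_def)

lemma homog_hcompI: "a \<in> carrier A \<Longrightarrow> homog \<rho> (hcomp a \<rho>)"
  using hcomp_carrier[of a \<rho>] by (auto simp: homog_def hcomp_def)

lemma homog_mult_eq:
  assumes "homog \<rho> w" "\<rho> \<in> G" "\<tau> \<in> G" shows "(w \<odot> b) \<tau> = w \<rho> * rmat b \<rho> \<tau>"
  using hcomp_mult[OF assms(2,3), of w b] homog_hcomp[OF assms(1)] by simp

lemma homog_mult:
  assumes "homog \<rho> w" "homog \<tau> z" "\<rho> \<in> G" "\<tau> \<in> G" shows "homog (\<rho> \<circ> \<tau>) (w \<odot> z)"
proof -
  have "(w \<odot> z) \<sigma> = 0" if "\<sigma> \<noteq> \<rho> \<circ> \<tau>" for \<sigma>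
  proof (cases "\<sigma> \<in> G")
    case True
    have "ginv \<rho> \<circ> \<sigma> \<noteq> \<tau>" using that comp_eq_iff[OF assms(3), of \<tau> \<sigma>] by auto
    then have "rmat z \<rho> \<sigma> = 0" using assms(2,3) by (simp add: rmat_def homog_def gal_0)
    then show ?thesis using homog_mult_eq[OF assms(1,3) True] by simp
  qed (simp add: A_mult)
  then show ?thesis using assms A_mult_closed by (simp add: homog_def)
qed

lemma f_inverse: assumes \<mu>: "\<mu> \<in> G" shows "\<mu> (f (ginv \<mu>) \<mu>) = f \<mu> (ginv \<mu>)"
  using f_cocycle[OF \<mu> ginv_gal[OF \<mu>] \<mu>] \<mu> by (simp add: ginv_comp f_id)

text \<open>The defining condition of \<open>grad JS\<close> at \<open>ginv \<mu>\<close>, moved by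
  \<open>\<mu>\<close>: it becomes the coefficient that appears when the component of
  \<open>y\<close> of degree \<open>\<mu>\<close> is multiplied from the right by an element of the
  inverse degree.\<close>

lemma grad_coeff:
  assumes y: "y \<in> grad JS" and \<mu>: "\<mu> \<in> G" shows "y \<mu> * f \<mu> (ginv \<mu>) \<in> JS"
proof -
  have g: "ginv \<mu> \<in> G" using \<mu> by (rule ginv_gal)
  have "rmat y (ginv \<mu>) id \<in> JS" using y g by (simp add: grad_def)
  then have "\<mu> (ginv \<mu> (y \<mu>) * f (ginv \<mu>) \<mu>) \<in> JS"
    using JS_gal[OF _ \<mu>] by (simp add: rmat_def ginv_ginv[OF \<mu>])
  then show ?thesis by (simp add: gal_hom(2)[OF \<mu>] ginv_right[OF \<mu>] f_inverse[OF \<mu>])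
qed

text \<open>Pigeonhole on the degrees of the partial products: \<open>P\<close> records the degrees already
  visited by the factors of \<open>w\<close>, and meeting one of them twice splits off a factor of degree
  \<open>id\<close> in \<open>grad JS\<close>, that is, in \<open>JS\<close>.\<close>

lemma grad_JS_nilpotent_step:
  assumes y: "y \<in> grad JS"
  shows "P \<subseteq> G \<Longrightarrow> card (G - P) = k \<Longrightarrow> \<rho> \<in> G \<Longrightarrow> homog \<rho> w \<Longrightarrow>
    (\<forall>p\<in>P. \<forall>z. homog (ginv \<rho> \<circ> p) z \<longrightarrow> w \<odot> z \<in> JA) \<Longrightarrow> w \<odot> y [^]\<^bsub>A\<^esub> k \<in> JA"
proof (induction k arbitrary: P \<rho> w)
  case 0
  note prems = 0
  have wA: "w \<in> carrier A" using prems(4) by (simp add: homog_def)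
  \<comment> \<open>No degree is left unvisited, so the current one has occurred before, and the
    invariant applies with \<open>z\<close> equal to 1.\<close>
  have "\<rho> \<in> P" using prems(1-3) finite_G by auto
  moreover have "homog (ginv \<rho> \<circ> \<rho>) 1\<^sub>A" using A_one_closed by (simp add: ginv_comp[OF prems(3)] homog_def A_one)
  ultimately have "w \<odot> 1\<^sub>A \<in> JA" using prems(5) by blast
  then show ?case using wA by simp
next
  case (Suc k)
  note prems = Suc.prems
  have yA: "y \<in> carrier A" using y by (simp add: grad_def)
  have wA: "w \<in> carrier A" using prems(4) by (simp add: homog_def)
  show ?case
  proof (cases "\<rho> \<in> P")
    case True
    have "homog (ginv \<rho> \<circ> \<rho>) 1\<^sub>A" using A_one_closed by (simp add: ginv_comp[OF prems(3)] homog_def A_one)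
    then have "w \<odot> 1\<^sub>A \<in> JA" using prems(5) True by blast
    then have "w \<in> JA" using wA by simp
    then show ?thesis using yA by (intro JA_mult A.nat_pow_closed)
  next
    case False
    define v where "v = w \<odot> y"
    define q where "q = y [^]\<^bsub>A\<^esub> k"
    have vA: "v \<in> carrier A" and qA: "q \<in> carrier A" using wA yA by (auto simp: v_def q_def)
    \<comment> \<open>\<open>w \<odot> y\<close> is split into homogeneous components; for each of
      them the induction continues with \<open>\<rho>\<close> marked as visited.\<close>
    have comp: "hcomp v \<tau> \<odot> q \<in> JA" if \<tau>: "\<tau> \<in> G" for \<tau>
      unfolding q_def
    proof (rule Suc.IH[of "insert \<rho> P" \<tau>])
      show "insert \<rho> P \<subseteq> G" using prems(1,3) by simp
      have "G - insert \<rho> P = (G - P) - {\<rho>}" by blast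
      then show "card (G - insert \<rho> P) = k" using prems(2,3) False by simp
      show "\<tau> \<in> G" by (rule \<tau>)
      show "homog \<tau> (hcomp v \<tau>)" using vA by (rule homog_hcompI)
      define \<mu> where "\<mu> = ginv \<rho> \<circ> \<tau>"
      have \<mu>: "\<mu> \<in> G" unfolding \<mu>_def by (rule gal_comp[OF ginv_gal[OF prems(3)] \<tau>])
      have hv: "hcomp v \<tau> = w \<odot> hcomp y \<mu>"
      proof
        fix \<sigma>
        show "hcomp v \<tau> \<sigma> = (w \<odot> hcomp y \<mu>) \<sigma>"
        proof (cases "\<sigma> \<in> G")
          case True
          have "ginv \<rho> \<circ> \<sigma> = \<mu> \<longleftrightarrow> \<sigma> = \<tau>"
            unfolding \<mu>_def using comp_eq_iff[OF prems(3)] gal_comp_cancel(2)[OF prems(3)] by metis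
          then show ?thesis
            using homog_mult_eq[OF prems(4,3) True, of "hcomp y \<mu>"] homog_mult_eq[OF prems(4,3) True, of y]
            by (auto simp: rmat_hcomp[OF prems(3)] v_def hcomp_def[of "w \<odot> y"])
        next
          case False
          then show ?thesis using \<tau> by (auto simp: A_mult hcomp_def[of v])
        qed
      qed
      show "\<forall>p\<in>insert \<rho> P. \<forall>z. homog (ginv \<tau> \<circ> p) z \<longrightarrow> hcomp v \<tau> \<odot> z \<in> JA"
      proof (intro ballI allI impI)
        fix p z assume p: "p \<in> insert \<rho> P" and z: "homog (ginv \<tau> \<circ> p) z"
        have pG: "p \<in> G" using p prems(1,3) by auto
        have zA: "z \<in> carrier A" using z by (simp add: homog_def)
        have deg: "\<mu> \<circ> (ginv \<tau> \<circ> p) = ginv \<rho> \<circ> p"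
          unfolding \<mu>_def by (simp add: comp_assoc gal_comp_cancel(2)[OF \<tau>])
        let ?t = "hcomp y \<mu> \<odot> z"
        have th: "homog (ginv \<rho> \<circ> p) ?t"
          using homog_mult[OF homog_hcompI[OF yA] z \<mu> gal_comp[OF ginv_gal[OF \<tau>] pG]] unfolding deg .
        have eq: "hcomp v \<tau> \<odot> z = w \<odot> ?t" unfolding hv A_assoc ..
        show "hcomp v \<tau> \<odot> z \<in> JA"
        proof (cases "p \<in> P")
          case True
          then show ?thesis unfolding eq using prems(5) th by blast
        next
          case False
          then have "p = \<rho>" using p by simp
          then have th': "homog id ?t" using th by (simp add: ginv_comp[OF prems(3)])
          \<comment> \<open>Here the product returns to \<open>\<rho>\<close>: \<open>z\<close> has
            the degree inverse to \<open>\<mu>\<close>, so the factor controlled by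
            \<open>grad_coeff\<close> splits off.\<close>
          have "?t id = y \<mu> * rmat z \<mu> id" by (rule hcomp_mult[OF \<mu> gal_id])
          also have "\<dots> = (y \<mu> * f \<mu> (ginv \<mu>)) * \<mu> (z (ginv \<mu>))" by (simp add: rmat_def mult_ac)
          also have "\<dots> \<in> JS"
            using zA ginv_gal[OF \<mu>] by (intro J.mult_I2[OF grad_coeff[OF y \<mu>]] gal_S[OF \<mu>]) (simp add: A_carrier)
          finally have tid: "?t id \<in> JS" .
          have "?t \<sigma> \<in> JS" for \<sigma>
            using th' tid J.zero_I by (cases "\<sigma> = id") (auto simp: homog_def)
          then have "?t \<in> JA" using th' by (simp add: JA_def homog_def)
          then have "(w \<odot> ?t) \<sigma> \<in> JS" if \<sigma>: "\<sigma> \<in> G" for \<sigma>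
            using homog_mult_eq[OF prems(4,3) \<sigma>, of ?t] JA_rmat[OF _ prems(3) \<sigma>, of ?t] wA prems(3)
            by (simp add: A_carrier J.mult_I)
          moreover have "w \<odot> ?t \<in> carrier A" using wA th by (simp add: homog_def A_mult_closed)
          ultimately show ?thesis unfolding eq by (simp add: JA_def)
        qed
      qed
    qed
    have "(v \<odot> q) \<sigma> \<in> JS" if \<sigma>: "\<sigma> \<in> G" for \<sigma>
    proof -
      have "v \<tau> * rmat q \<tau> \<sigma> \<in> JS" if \<tau>: "\<tau> \<in> G" for \<tau>
      proof -
        have "(hcomp v \<tau> \<odot> q) \<sigma> \<in> JS" using comp[OF \<tau>] \<sigma> unfolding JA_def by blast
        then show ?thesis by (simp only: hcomp_mult[OF \<tau> \<sigma>])
      qed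
      then have "(\<Sum>\<tau>\<in>G. v \<tau> * rmat q \<tau> \<sigma>) \<in> JS" by (rule J.sum_I)
      then show ?thesis using \<sigma> by (simp add: A_mult)
    qed
    then have "v \<odot> q \<in> JA" using A_mult_closed[OF vA qA] by (simp add: JA_def)
    moreover have "y [^]\<^bsub>A\<^esub> Suc k = y \<odot> q" unfolding q_def using yA by (rule A.nat_pow_Suc2)
    ultimately show ?thesis unfolding v_def by (simp only: A_assoc)
  qed
qed

lemma grad_JS_nilpotent: assumes y: "y \<in> grad JS" shows "y [^]\<^bsub>A\<^esub> card G \<in> JA"
proof -
  have yA: "y \<in> carrier A" using y by (simp add: grad_def)
  have "homog id 1\<^sub>A" using A_one_closed by (simp add: homog_def A_one)
  then have "1\<^sub>A \<odot> y [^]\<^bsub>A\<^esub> card G \<in> JA"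
    using grad_JS_nilpotent_step[OF y, of "{}" "card G" id "1\<^sub>A"] gal_id by simp
  then show ?thesis using yA by simp
qed

text \<open>\<open>grad JS\<close> is a left ideal, so \<open>c \<odot> b\<close> is again nilpotent
  modulo \<open>JA\<close>; left inverses pass from one minus its power to one minus itself.\<close>

lemma grad_subset_jacobson: "grad JS \<subseteq> jacobson_radical A"
proof
  fix b assume b: "b \<in> grad JS"
  show "b \<in> jacobson_radical A"
  proof (rule A.jacobson_radicalI)
    show "b \<in> carrier A" using b by (simp add: grad_def)
    fix c assume c: "c \<in> carrier A"
    define y where "y = c \<odot> b"
    have y: "y \<in> grad JS"
      using grad_left_ideal[OF J.ideal_pair_axioms] b c unfolding y_def graded_left_ideal_def
      by (auto dest: A.left_idealD(4))
    have yA: "y \<in> carrier A" using y by (simp add: grad_def)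
    obtain w where w: "w \<in> carrier A" "w \<odot> (1\<^sub>A \<ominus>\<^bsub>A\<^esub> y) = 1\<^sub>A \<ominus>\<^bsub>A\<^esub> y [^]\<^bsub>A\<^esub> card G"
      using A.geometric_left_factor[OF yA] by blast
    obtain u where u: "u \<in> carrier A" "u \<odot> (1\<^sub>A \<ominus>\<^bsub>A\<^esub> y [^]\<^bsub>A\<^esub> card G) = 1\<^sub>A"
      using one_minus_JA_left_inverse[OF grad_JS_nilpotent[OF y]] by blast
    have "(u \<odot> w) \<odot> (1\<^sub>A \<ominus>\<^bsub>A\<^esub> y) = 1\<^sub>A" using u w by (simp add: A_assoc)
    then show "\<exists>u\<in>carrier A. u \<odot> (1\<^sub>A \<ominus>\<^bsub>A\<^esub> c \<odot> b) = 1\<^sub>A"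
      using A_mult_closed[OF u(1) w(1)] unfolding y_def by blast
  qed
qed

section \<open>Powers of a radical element modulo \<open>M\<close> and their traces\<close>

definition lincomb :: "nat set \<Rightarrow> (nat \<Rightarrow> 'k) \<Rightarrow> (nat \<Rightarrow> ('k \<Rightarrow> 'k) \<Rightarrow> 'k) \<Rightarrow> ('k \<Rightarrow> 'k) \<Rightarrow> 'k" where
  "lincomb X c g = (\<lambda>\<rho>. \<Sum>i\<in>X. c i * g i \<rho>)"

lemma lincomb_carrier:
  assumes "\<And>i. i \<in> X \<Longrightarrow> c i \<in> V" "\<And>i. i \<in> X \<Longrightarrow> g i \<in> carrier A"
  shows "lincomb X c g \<in> carrier A"
proof -
  have "lincomb X c g \<sigma> \<in> S" if "\<sigma> \<in> G" for \<sigma>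
    unfolding lincomb_def using assms that VS by (intro M.sum_R M.mult_R) (auto simp: A_carrier)
  moreover have "lincomb X c g \<sigma> = 0" if "\<sigma> \<notin> G" for \<sigma>
    unfolding lincomb_def using assms(2) that by (intro sum.neutral) (auto simp: A_carrier)
  ultimately show ?thesis by (simp add: A_carrier)
qed

lemma rmat_lincomb:
  assumes "\<And>i. i \<in> X \<Longrightarrow> c i \<in> V" "\<sigma> \<in> G"
  shows "rmat (lincomb X c g) \<sigma> \<rho> = (\<Sum>i\<in>X. c i * rmat (g i) \<sigma> \<rho>)"
proof -
  have "\<sigma> (c i) = c i" if "i \<in> X" for i using gal_fix[OF assms(2)] assms(1)[OF that] VF by auto
  then show ?thesis
    by (simp add: rmat_def lincomb_def gal_sum[OF assms(2)] gal_hom(2)[OF assms(2)] sum_distrib_right mult.assoc)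
qed

lemma lincomb_mult: "lincomb X c g \<odot> b = lincomb X c (\<lambda>i. g i \<odot> b)"
proof
  fix \<rho>
  show "(lincomb X c g \<odot> b) \<rho> = lincomb X c (\<lambda>i. g i \<odot> b) \<rho>"
  proof (cases "\<rho> \<in> G")
    case True
    then have "(lincomb X c g \<odot> b) \<rho> = (\<Sum>\<sigma>\<in>G. \<Sum>i\<in>X. c i * (g i \<sigma> * rmat b \<sigma> \<rho>))"
      by (simp add: A_mult lincomb_def sum_distrib_right mult.assoc)
    also have "\<dots> = lincomb X c (\<lambda>i. g i \<odot> b) \<rho>"
      using True by (subst sum.swap) (simp add: A_mult lincomb_def sum_distrib_left)
    finally show ?thesis .
  qed (simp add: A_mult lincomb_def)
qed

lemma jacobson_nilpotent_mod:
  assumes b: "b \<in> jacobson_radical A" and rd: "residue_degree V W d"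
  shows "\<exists>m::nat. \<forall>\<sigma>\<in>G. \<forall>\<rho>\<in>G. rmat (b [^]\<^bsub>A\<^esub> m) \<sigma> \<rho> \<in> M"
proof -
  have bA: "b \<in> carrier A" using b by (simp add: jacobson_radical_def)
  have pA: "b [^]\<^bsub>A\<^esub> i \<in> carrier A" for i :: nat using bA by simp
  obtain e where e: "\<forall>i<d. e i \<in> S" "\<forall>y\<in>S. \<exists>c. (\<forall>i<d. c i \<in> V) \<and> y - (\<Sum>i<d. c i * e i) \<in> M"
    using residue_basis_in_S[OF rd] by auto
  have "\<forall>y. \<exists>c. y \<in> S \<longrightarrow> (\<forall>i<d. c i \<in> V) \<and> y - (\<Sum>i<d. c i * e i) \<in> M" using e(2) by blast
  then obtain co where co: "\<And>y i. y \<in> S \<Longrightarrow> i < d \<Longrightarrow> co y i \<in> V"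
    "\<And>y. y \<in> S \<Longrightarrow> y - (\<Sum>i<d. co y i * e i) \<in> M" by metis
  \<comment> \<open>One equation for each matrix position and each coordinate in the residue basis;
    the exponents from 0 to \<open>K\<close> give one unknown more than there are equations.\<close>
  define E where "E = G \<times> G \<times> {..<d}"
  define K where "K = card E"
  define a where "a = (\<lambda>(\<sigma>, \<rho>, j) (i::nat). co (rmat (b [^]\<^bsub>A\<^esub> i) \<sigma> \<rho>) j)"
  have fE: "finite E" unfolding E_def using finite_G by simp
  have "\<exists>c. (\<forall>i\<in>{..K}. c i \<in> V) \<and> (\<exists>i\<in>{..K}. c i \<notin> mV) \<and> (\<forall>t\<in>E. (\<Sum>i\<le>K. a t i * c i) \<in> mV)"
  proof (rule V.homogeneous_system[OF fE])
    show "card E < card {..K}" by (simp add: K_def)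
    fix t i assume "t \<in> E"
    then show "a t i \<in> V" using co(1)[OF rmat_S[OF pA]] by (auto simp: E_def a_def)
  qed simp
  then obtain c where c: "\<forall>i\<le>K. c i \<in> V" "\<exists>i\<le>K. c i \<notin> mV" "\<forall>t\<in>E. (\<Sum>i\<le>K. a t i * c i) \<in> mV"
    by auto
  have rel: "(\<Sum>i\<le>K. c i * rmat (b [^]\<^bsub>A\<^esub> i) \<sigma> \<rho>) \<in> M" if \<sigma>\<rho>: "\<sigma> \<in> G" "\<rho> \<in> G" for \<sigma> \<rho>
  proof -
    let ?r = "\<lambda>i. rmat (b [^]\<^bsub>A\<^esub> (i::nat)) \<sigma> \<rho>"
    have rS: "?r i \<in> S" for i using rmat_S[OF pA \<sigma>\<rho>] .
    have d1: "(\<Sum>i\<le>K. c i * ?r i) - (\<Sum>i\<le>K. c i * (\<Sum>j<d. co (?r i) j * e j)) \<in> M"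
    proof (rule M.cong_sum)
      fix i assume "i \<in> {..K}"
      then have "c i \<in> S" using c(1) VS by auto
      then have "c i * (?r i - (\<Sum>j<d. co (?r i) j * e j)) \<in> M" using co(2)[OF rS] by (rule M.mult_I)
      then show "c i * ?r i - c i * (\<Sum>j<d. co (?r i) j * e j) \<in> M" by (simp add: right_diff_distrib)
    qed
    have d2: "(\<Sum>i\<le>K. c i * (\<Sum>j<d. co (?r i) j * e j)) = (\<Sum>j<d. (\<Sum>i\<le>K. a (\<sigma>, \<rho>, j) i * c i) * e j)"
      unfolding sum_distrib_left sum_distrib_right a_def by (subst sum.swap) (simp add: mult_ac)
    have d3: "(\<Sum>j<d. (\<Sum>i\<le>K. a (\<sigma>, \<rho>, j) i * c i) * e j) \<in> M"
    proof (rule M.sum_I)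
      fix j assume j: "j \<in> {..<d}"
      then have "(\<Sum>i\<le>K. a (\<sigma>, \<rho>, j) i * c i) \<in> M" using c(3) \<sigma>\<rho> mV_M by (auto simp: E_def)
      then show "(\<Sum>i\<le>K. a (\<sigma>, \<rho>, j) i * c i) * e j \<in> M" using e(1) j by (intro M.mult_I2) auto
    qed
    show ?thesis using M.cong_iff[OF d1] d3 unfolding d2 by simp
  qed
  \<comment> \<open>Terms below \<open>m\<close> have coefficients in \<open>mV\<close> and drop out
    modulo \<open>M\<close>.\<close>
  define m where "m = (LEAST i. i \<le> K \<and> c i \<notin> mV)"
  have m: "m \<le> K" "c m \<notin> mV" using LeastI_ex[of "\<lambda>i. i \<le> K \<and> c i \<notin> mV"] c(2) unfolding m_def by auto
  have lt: "c i \<in> mV" if "i < m" for i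
    using not_less_Least[of i "\<lambda>i. i \<le> K \<and> c i \<notin> mV"] that m(1) unfolding m_def by auto
  have cm: "c i \<in> V" if "i \<in> {m..K}" for i using that c(1) by auto
  define h where "h = lincomb {m..K} c (\<lambda>i. b [^]\<^bsub>A\<^esub> (i - m))"
  have hA: "h \<in> carrier A" unfolding h_def using cm pA by (intro lincomb_carrier) auto
  have "h \<odot> b [^]\<^bsub>A\<^esub> m = lincomb {m..K} c (\<lambda>i. b [^]\<^bsub>A\<^esub> i)"
  proof -
    have "b [^]\<^bsub>A\<^esub> (i - m) \<odot> b [^]\<^bsub>A\<^esub> m = b [^]\<^bsub>A\<^esub> i" if "i \<in> {m..K}" for i
      using that A.nat_pow_mult[OF bA, of "i - m" m] by simp
    then show ?thesis unfolding h_def lincomb_mult by (simp add: lincomb_def)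
  qed
  then have hm: "rmat (h \<odot> b [^]\<^bsub>A\<^esub> m) \<sigma> \<rho> \<in> M" if \<sigma>\<rho>: "\<sigma> \<in> G" "\<rho> \<in> G" for \<sigma> \<rho>
  proof -
    let ?r = "\<lambda>i. c i * rmat (b [^]\<^bsub>A\<^esub> (i::nat)) \<sigma> \<rho>"
    have "rmat (h \<odot> b [^]\<^bsub>A\<^esub> m) \<sigma> \<rho> = sum ?r {m..K}"
      unfolding \<open>h \<odot> b [^]\<^bsub>A\<^esub> m = _\<close> using cm \<sigma>\<rho> by (intro rmat_lincomb)
    also have "\<dots> = sum ?r {..K} - sum ?r {..<m}"
    proof -
      have "{..K} = {..<m} \<union> {m..K}" using m(1) by auto
      moreover have "sum ?r ({..<m} \<union> {m..K}) = sum ?r {..<m} + sum ?r {m..K}"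
        by (rule sum.union_disjoint) auto
      ultimately show ?thesis by simp
    qed
    also have "\<dots> \<in> M"
    proof (rule M.diff_I[OF rel[OF \<sigma>\<rho>] M.sum_I])
      fix i assume "i \<in> {..<m}"
      then have "c i \<in> M" using lt mV_M by auto
      then show "?r i \<in> M" using rmat_S[OF pA \<sigma>\<rho>] by (rule M.mult_I2)
    qed
    finally show ?thesis .
  qed
  obtain v where v: "v \<in> V" "c m * v = 1" using V_unit_iff[OF cm[of m]] m by auto
  \<comment> \<open>All terms of \<open>h\<close> except the constant one \<open>c m\<close>, with
    one factor \<open>b\<close> split off on the right.\<close>
  define k where "k = lincomb {Suc m..K} c (\<lambda>i. b [^]\<^bsub>A\<^esub> (i - Suc m))"
  have kA: "k \<in> carrier A" unfolding k_def using c(1) pA by (intro lincomb_carrier) auto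
  have kb: "k \<odot> b = lincomb {Suc m..K} c (\<lambda>i. b [^]\<^bsub>A\<^esub> (i - m))"
  proof -
    have "b [^]\<^bsub>A\<^esub> (i - Suc m) \<odot> b = b [^]\<^bsub>A\<^esub> (i - m)" if "i \<in> {Suc m..K}" for i
    proof -
      have "i - m = Suc (i - Suc m)" using that by auto
      then show ?thesis by simp
    qed
    then show ?thesis unfolding k_def lincomb_mult by (simp add: lincomb_def)
  qed
  have vS: "v \<in> S" "- v \<in> S" using v(1) VS V.uminus_R by auto
  have "h = (\<lambda>\<rho>. sc (c m) \<rho> + (k \<odot> b) \<rho>)"
  proof
    fix \<rho>
    have "{m..K} = insert m {Suc m..K}" using m(1) by auto
    then show "h \<rho> = sc (c m) \<rho> + (k \<odot> b) \<rho>"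
      unfolding h_def kb lincomb_def by (simp add: A_one sc_def)
  qed
  then have vh: "sc v \<odot> h = (\<lambda>\<rho>. 1\<^sub>A \<rho> - (sc (- v) \<odot> (k \<odot> b)) \<rho>)"
    unfolding sc_mult[OF hA] sc_mult[OF A_mult_closed[OF kA bA]]
    using v(2) by (intro ext) (simp add: sc_def A_one distrib_left mult.commute)
  define t where "t = sc (- v) \<odot> k"
  have tA: "t \<in> carrier A" unfolding t_def using sc_carrier[OF vS(2)] kA by (rule A_mult_closed)
  have "sc v \<odot> h = 1\<^sub>A \<ominus>\<^bsub>A\<^esub> t \<odot> b"
    unfolding vh A_diff[OF A_one_closed A_mult_closed[OF tA bA]] by (simp only: t_def A_assoc)
  then obtain u where u: "u \<in> carrier A" "u \<odot> (sc v \<odot> h) = 1\<^sub>A"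
    using A.jacobson_radical_left_inverse[OF b tA] by auto
  have usv: "u \<odot> sc v \<in> carrier A" using u(1) sc_carrier[OF vS(1)] by (rule A_mult_closed)
  have "(u \<odot> sc v) \<odot> (h \<odot> b [^]\<^bsub>A\<^esub> m) = (u \<odot> (sc v \<odot> h)) \<odot> b [^]\<^bsub>A\<^esub> m"
    by (simp add: A_assoc)
  also have "\<dots> = b [^]\<^bsub>A\<^esub> m" unfolding u(2) using pA by simp
  finally have bm: "b [^]\<^bsub>A\<^esub> m = (u \<odot> sc v) \<odot> (h \<odot> b [^]\<^bsub>A\<^esub> m)" ..
  have "rmat (b [^]\<^bsub>A\<^esub> m) \<sigma> \<rho> \<in> M" if \<sigma>\<rho>: "\<sigma> \<in> G" "\<rho> \<in> G" for \<sigma> \<rho>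
  proof -
    \<comment> \<open>Left multiplication by a matrix over \<open>S\<close> keeps entries in
      \<open>M\<close>, although \<open>M\<close> need not be stable under \<open>G\<close>.\<close>
    have "(\<Sum>\<mu>\<in>G. rmat (u \<odot> sc v) \<sigma> \<mu> * rmat (h \<odot> b [^]\<^bsub>A\<^esub> m) \<mu> \<rho>) \<in> M"
      by (rule M.sum_I) (rule M.mult_I[OF rmat_S[OF usv \<sigma>\<rho>(1)] hm[OF _ \<sigma>\<rho>(2)]])
    then show ?thesis by (subst bm) (simp add: rmat_mult[OF \<sigma>\<rho>])
  qed
  then show ?thesis by blast
qed

text \<open>The diagonal entries of the multiplication matrix are
  \<open>\<sigma> (b id) * f \<sigma> id\<close>, and normalization removes the cocycle; its other
  values do not enter the trace.\<close>

lemma jacobson_trace: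
  assumes b: "b \<in> jacobson_radical A" and rd: "residue_degree V W d"
  shows "trace (b id) \<in> M"
proof -
  let ?n = "card G"
  have bA: "b \<in> carrier A" using b by (simp add: jacobson_radical_def)
  obtain m :: nat where m: "\<And>\<sigma> \<rho>. \<sigma> \<in> G \<Longrightarrow> \<rho> \<in> G \<Longrightarrow> rmat (b [^]\<^bsub>A\<^esub> m) \<sigma> \<rho> \<in> M"
    using jacobson_nilpotent_mod[OF b rd] by blast
  have "(\<Sum>i<?n. Q b $$ (i, i)) \<in> M"
  proof (rule M.trace_of_nilpotent_mod[OF Q_carrier])
    show "?n > 0" using finite_G gal_id by (auto simp: card_gt_0_iff)
    show "Q b $$ (i, j) \<in> S" if "i < ?n" "j < ?n" for i j
      using that rmat_S[OF bA] enum_G by (simp add: Q_def)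
    show "(Q b ^\<^sub>m m) $$ (i, j) \<in> M" if "i < ?n" "j < ?n" for i j
      using that m enum_G unfolding Q_pow[symmetric] by (simp add: Q_def)
  qed
  also have "(\<Sum>i<?n. Q b $$ (i, i)) = (\<Sum>i = 0..<?n. rmat b (enum i) (enum i))"
    by (simp add: Q_def atLeast0LessThan)
  also have "\<dots> = (\<Sum>\<sigma>\<in>G. rmat b \<sigma> \<sigma>)" by (rule sum.reindex_bij_betw[OF bij_enum])
  also have "\<dots> = trace (b id)"
    unfolding trace_def by (intro sum.cong refl) (simp add: rmat_def ginv_comp f_id)
  finally show ?thesis .
qed

text \<open>For \<open>a\<close> in the radical so is
  \<open>sc s \<odot> (xg \<mu> \<odot> a)\<close>, whose identity coefficient is
  \<open>s * rmat a \<mu> id\<close>. Its trace lies in \<open>M\<close> for every \<open>s\<close>,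
  so nondegeneracy of the trace form applies.\<close>

lemma jacobson_subset_grad:
  assumes t: "of_nat (card inertia) \<notin> M" and rd: "residue_degree V W d"
  shows "jacobson_radical A \<subseteq> grad JS"
proof
  fix a assume a: "a \<in> jacobson_radical A"
  have aA: "a \<in> carrier A" using a by (simp add: jacobson_radical_def)
  have "rmat a \<mu> id \<in> JS" if \<mu>: "\<mu> \<in> G" for \<mu>
  proof (rule trace_form_radical[OF t])
    show "rmat a \<mu> id \<in> S" using rmat_S[OF aA \<mu> gal_id] .
    fix s assume s: "s \<in> S"
    let ?b = "xg \<mu> \<odot> a"
    have bA: "?b \<in> carrier A" using xg_carrier[OF \<mu>] aA by (rule A_mult_closed)
    have "sc s \<odot> ?b \<in> jacobson_radical A"
      using a xg_carrier[OF \<mu>] sc_carrier[OF s] by (intro A.jacobson_radical_mult)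
    from jacobson_trace[OF this rd] show "trace (s * rmat a \<mu> id) \<in> M"
      unfolding sc_mult[OF bA] by (simp add: xg_mult[OF \<mu> gal_id])
  qed
  then show "a \<in> grad JS" using aA by (simp add: grad_def)
qed

end

theorem theorem3p1:
  fixes V F :: "'k::field set"
    and f :: "('k \<Rightarrow> 'k) \<Rightarrow> ('k \<Rightarrow> 'k) \<Rightarrow> 'k"
  assumes "valuation_domain_with_qf V F"
    and "finite_galois F"
    and "tamely_ramified V F"
    and "defectless V F"
    and "normalized_cocycle (gal F) (integral_closure V) f"
  shows "jacobson_radical (crossed_product (gal F) (integral_closure V) f)
       = graded_jacobson_radical (crossed_product (gal F) (integral_closure V) f)"
proof -
  interpret valued_galois V F using assms(1,2) by unfold_locales
  obtain M where M: "max_ideal_of (integral_closure V) M" using exists_max_ideal[OF subring_S] by blast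
  interpret crossed_order V F M f using M assms(5) by unfold_locales
  \<comment> \<open>The finiteness of the residue degree at \<open>M\<close> is part of
    \<open>defectless\<close>.\<close>
  obtain d where "residue_degree V (localization (integral_closure V) M) d"
    using assms(4) M unfolding defectless_def by blast
  then show ?thesis
    using jacobson_subset_grad[OF card_inertia_notin[OF assms(3,4)]] grad_subset_jacobson
    unfolding graded_jacobson_radical_eq by blast
qed

end
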